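(* Let $q\in\mathbb{C}\setminus\{0\}$, $\delta=q+q^{-1}$, and let $w$ be an infinite link state. Then the $TL_\infty(\delta)$ representation $\mathcal{X}(w)$ is cyclic and indecomposable, and, unless $\delta=0$ and $s(w)=0$, the quotient $\mathcal{X}(w)/\mathcal{R}(w)$ is irreducible.
   Context: $TL_\infty(\delta)$ is the unital $\mathbb{C}$-algebra generated by $\mathbf{1}$ and $e_i$, $i\in\mathbb{N}=\{1,2,\dots\}$, with relations $e_i^2=\delta e_i$, $e_ie_{i\pm1}e_i=e_i$, $e_ie_j=e_je_i$ for $|i-j|>1$; $TL_n(\delta)$ is generated by $1,e_1,\dots,e_{n-1}$ with the same relations. An $(n,p)$-link state is a configuration on the points $1,\dots,n$ with $p$ cups (each joining two points) and $n-2p$ strings (each attached to a single point), non-intersecting: no two cups cross and no string point lies strictly between the endpoints of a cup. $\mathcal{V}_{n,p}$ is the $TL_n(\delta)$ representation with basis the $(n,p)$-link states, acting by diagram concatenation (closed loops replaced by $\delta$; zero if the number of cups increases). $\langle x,y\rangle$ is the bilinear form on $\mathcal{V}_{n,p}$ given on link states by reflecting $x$ and gluing it to $y$: $0$ unless every string of $x$ is connected to a string of $y$, and otherwise $\delta^k$ with $k$ the number of closed loops. $\mathcal{R}_{n,p}$ is the kernel of this form. An infinite link state is the analogous non-intersecting configuration of cups and strings on the points $1,2,3,\dots$; $s(w)$ is its number of strings. $TL_\infty(\delta)$ acts on the span of all infinite link states by concatenation: $e_iw=0$ if $i,i+1$ are both strings; $e_iw=\delta w$ if $i,i+1$ are joined;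 if exactly one of $i,i+1$ is a string and the other is joined to $b$, then $e_iw$ has cup $\{i,i+1\}$ and $b$ a string; if $i$ is joined to $a\ne i+1$ and $i+1$ to $b$, these cups are replaced by $\{i,i+1\},\{a,b\}$. $\mathcal{X}(w)$ is the subrepresentation generated by $w$. The restriction of an infinite link state to length $n$ deletes all points greater than $n$; if this would cut a cup, one instead restricts to the smallest $n'>n$ for which no cup is cut. An element of $\mathcal{X}(w)$ is a finite linear combination of link states that agree beyond some point, and is restricted, for $n$ large enough, term by term. $\mathcal{R}(w)=\{x\in\mathcal{X}(w):$ there is $n$ such that $x$ restricts to an element of $\mathcal{R}_{n',p}$ for all $n'\ge n\}$ ($p$ depending on $n'$). *)

theory Defs
  imports
    Complex_Main
    "HOL-Library.Poly_Mapping"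
    "HOL-Library.Extended_Nat"
    "HOL-Algebra.Algebra"
    "HOL-Algebra.Algebraic_Closure_Type"
begin

text \<open>
  Points and generators are numbered from 0 throughout: the point (or generator) written \<open>k\<close>
  here is the one usually written \<open>k + 1\<close>.
\<close>

section \<open>Left modules over a not necessarily commutative ring\<close>

text \<open>
  \<^locale>\<open>module\<close> requires a commutative ring of scalars; the axioms below are the same, over an
  arbitrary ring.  For a unital \<open>\<complex>\<close>-algebra \<open>A\<close>, the representations of \<open>A\<close> are the left
  \<open>A\<close>-modules, with \<open>c \<in> \<complex>\<close> acting as \<open>c \<cdot> 1 \<in> A\<close>; the subrepresentations are the submodules.
\<close>

locale left_module = R?: ring R + M?: abelian_group M
  for R :: "('a, 'r) ring_scheme" (structure) and M :: "('a, 'b, 'm) module_scheme" (structure) +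
  assumes smult_closed:
      "\<lbrakk>a \<in> carrier R; x \<in> carrier M\<rbrakk> \<Longrightarrow> a \<odot>\<^bsub>M\<^esub> x \<in> carrier M"
    and smult_l_distr:
      "\<lbrakk>a \<in> carrier R; b \<in> carrier R; x \<in> carrier M\<rbrakk> \<Longrightarrow>
        (a \<oplus> b) \<odot>\<^bsub>M\<^esub> x = a \<odot>\<^bsub>M\<^esub> x \<oplus>\<^bsub>M\<^esub> b \<odot>\<^bsub>M\<^esub> x"
    and smult_r_distr:
      "\<lbrakk>a \<in> carrier R; x \<in> carrier M; y \<in> carrier M\<rbrakk> \<Longrightarrow>
        a \<odot>\<^bsub>M\<^esub> (x \<oplus>\<^bsub>M\<^esub> y) = a \<odot>\<^bsub>M\<^esub> x \<oplus>\<^bsub>M\<^esub> a \<odot>\<^bsub>M\<^esub> y"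
    and smult_assoc1:
      "\<lbrakk>a \<in> carrier R; b \<in> carrier R; x \<in> carrier M\<rbrakk> \<Longrightarrow>
        (a \<otimes> b) \<odot>\<^bsub>M\<^esub> x = a \<odot>\<^bsub>M\<^esub> (b \<odot>\<^bsub>M\<^esub> x)"
    and smult_one:
      "x \<in> carrier M \<Longrightarrow> \<one> \<odot>\<^bsub>M\<^esub> x = x"

definition generated_submodule :: "('a, 'r) ring_scheme \<Rightarrow> ('a, 'b) module \<Rightarrow> 'b set \<Rightarrow> 'b set" where
  "generated_submodule R M S = \<Inter>{N. submodule N R M \<and> S \<subseteq> N}"

definition quotient_module :: "('a, 'b) module \<Rightarrow> 'b set \<Rightarrow> ('a, 'b set) module" where
  "quotient_module M N =
    \<lparr>carrier = a_rcosets\<^bsub>M\<^esub> N, monoid.mult = undefined, one = undefined, ring.zero = N, add = set_add M,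
     module.smult = (\<lambda>a C. \<Union>x\<in>C. N +>\<^bsub>M\<^esub> (a \<odot>\<^bsub>M\<^esub> x))\<rparr>"

definition cyclic_module :: "('a, 'r) ring_scheme \<Rightarrow> ('a, 'b) module \<Rightarrow> bool" where
  "cyclic_module R M \<longleftrightarrow>
    left_module R M \<and> (\<exists>v\<in>carrier M. generated_submodule R M {v} = carrier M)"

definition indecomposable_module :: "('a, 'r) ring_scheme \<Rightarrow> ('a, 'b) module \<Rightarrow> bool" where
  "indecomposable_module R M \<longleftrightarrow>
    left_module R M \<and> carrier M \<noteq> {\<zero>\<^bsub>M\<^esub>} \<and>
    \<not> (\<exists>A B. submodule A R M \<and> submodule B R M \<and> A \<noteq> {\<zero>\<^bsub>M\<^esub>} \<and> B \<noteq> {\<zero>\<^bsub>M\<^esub>} \<and>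
             A \<inter> B = {\<zero>\<^bsub>M\<^esub>} \<and> A <+>\<^bsub>M\<^esub> B = carrier M)"

definition irreducible_module :: "('a, 'r) ring_scheme \<Rightarrow> ('a, 'b) module \<Rightarrow> bool" where
  "irreducible_module R M \<longleftrightarrow>
    left_module R M \<and> carrier M \<noteq> {\<zero>\<^bsub>M\<^esub>} \<and>
    (\<forall>N. submodule N R M \<longrightarrow> N = {\<zero>\<^bsub>M\<^esub>} \<or> N = carrier M)"


section \<open>Linear combinations\<close>

text \<open>\<open>'a \<Rightarrow>\<^sub>0 complex\<close> is the complex vector space with basis \<open>'a\<close>.\<close>

definition scale :: "complex \<Rightarrow> ('a \<Rightarrow>\<^sub>0 complex) \<Rightarrow> ('a \<Rightarrow>\<^sub>0 complex)" where
  "scale c x = Poly_Mapping.map ((*) c) x"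

definition linear_extension ::
    "('a \<Rightarrow> ('b \<Rightarrow>\<^sub>0 complex)) \<Rightarrow> ('a \<Rightarrow>\<^sub>0 complex) \<Rightarrow> ('b \<Rightarrow>\<^sub>0 complex)" where
  "linear_extension f x = (\<Sum>k\<in>Poly_Mapping.keys x. scale (Poly_Mapping.lookup x k) (f k))"


section \<open>The Temperley--Lieb algebra on infinitely many generators\<close>

datatype word = Word "nat list"

instantiation word :: monoid_add
begin

definition zero_word :: word where
  "zero_word = Word []"

fun plus_word :: "word \<Rightarrow> word \<Rightarrow> word" where
  "plus_word (Word u) (Word v) = Word (u @ v)"

instance
proof
  fix a b c :: word
  show "a + b + c = a + (b + c)"
    by (cases a; cases b; cases c) simp
  show "0 + a = a"
    by (cases a) (simp add: zero_word_def)
  show "a + 0 = a"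
    by (cases a) (simp add: zero_word_def)
qed

end

text \<open>
  As words form a monoid under concatenation (written additively), the convolution product of
  \<^theory>\<open>HOL-Library.Poly_Mapping\<close> makes this type the free unital associative \<open>\<complex>\<close>-algebra on
  letters indexed by \<^typ>\<open>nat\<close>.
\<close>

type_synonym free_algebra = "word \<Rightarrow>\<^sub>0 complex"

definition letter :: "nat \<Rightarrow> free_algebra" where
  "letter i = Poly_Mapping.single (Word [i]) 1"

definition TL_relations :: "complex \<Rightarrow> free_algebra set" where
  "TL_relations \<delta> =
    {letter i * letter i - scale \<delta> (letter i) | i. True} \<union>
    {letter i * letter j * letter i - letter i | i j. j = Suc i \<or> i = Suc j} \<union>
    {letter i * letter j - letter j * letter i | i j. Suc i < j \<or> Suc j < i}"

definition TL_infinity :: "complex \<Rightarrow> free_algebra set ring" where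
  "TL_infinity \<delta> = ring_of_type_algebra Quot (Idl\<^bsub>ring_of_type_algebra\<^esub> (TL_relations \<delta>))"


section \<open>Link states\<close>

text \<open>
  A configuration of cups and strings on a set \<open>S\<close> of points is encoded by the involution that
  swaps the two ends of each cup and fixes the string points.  Outside \<open>S\<close> the involution is the
  identity, so that distinct configurations have distinct encodings; these outside points do not
  count as strings.
\<close>

definition link_on :: "nat set \<Rightarrow> (nat \<Rightarrow> nat) \<Rightarrow> bool" where
  "link_on S w \<longleftrightarrow>
    (\<forall>i. w (w i) = i) \<and> (\<forall>i. i \<notin> S \<longrightarrow> w i = i) \<and>
    (\<forall>a b. \<not> (a < b \<and> b < w a \<and> w a < w b)) \<and>
    (\<forall>a i. \<not> (a < i \<and> i < w a \<and> w i = i))"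

definition infinite_link_state :: "(nat \<Rightarrow> nat) \<Rightarrow> bool" where
  "infinite_link_state w \<longleftrightarrow> link_on UNIV w"

definition num_strings :: "(nat \<Rightarrow> nat) \<Rightarrow> enat" where
  "num_strings w = (if finite {i. w i = i} then enat (card {i. w i = i}) else \<infinity>)"

text \<open>
  The first component is the length, which the involution does not determine.
\<close>

type_synonym finite_link = "nat \<times> (nat \<Rightarrow> nat)"

definition link_states :: "nat \<Rightarrow> nat \<Rightarrow> finite_link set" where
  "link_states n p = {(n, x) | x. link_on {..<n} x \<and> card {i. i < n \<and> i < x i} = p}"


section \<open>The bilinear form on finite link states\<close>

definition glued :: "nat \<Rightarrow> (nat \<Rightarrow> nat) \<Rightarrow> (nat \<Rightarrow> nat) \<Rightarrow> (nat \<times> nat) set" where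
  "glued n x y = {(i, j). i < n \<and> j < n \<and> (j = x i \<or> j = y i)}\<^sup>*"

definition closed_loops :: "nat \<Rightarrow> (nat \<Rightarrow> nat) \<Rightarrow> (nat \<Rightarrow> nat) \<Rightarrow> nat set set" where
  "closed_loops n x y = {C \<in> {..<n} // glued n x y. \<forall>i\<in>C. x i \<noteq> i \<and> y i \<noteq> i}"

definition link_form :: "complex \<Rightarrow> nat \<Rightarrow> (nat \<Rightarrow> nat) \<Rightarrow> (nat \<Rightarrow> nat) \<Rightarrow> complex" where
  "link_form \<delta> n x y =
    (if \<forall>i<n. x i = i \<longrightarrow> (\<exists>j<n. (i, j) \<in> glued n x y \<and> y j = j)
     then \<delta> ^ card (closed_loops n x y) else 0)"

definition bilinear_form ::
    "complex \<Rightarrow> nat \<Rightarrow> (finite_link \<Rightarrow>\<^sub>0 complex) \<Rightarrow> (finite_link \<Rightarrow>\<^sub>0 complex) \<Rightarrow> complex" where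
  "bilinear_form \<delta> n x y =
    (\<Sum>a\<in>Poly_Mapping.keys x. \<Sum>b\<in>Poly_Mapping.keys y.
       Poly_Mapping.lookup x a * Poly_Mapping.lookup y b * link_form \<delta> n (snd a) (snd b))"

definition V_space :: "nat \<Rightarrow> nat \<Rightarrow> (finite_link \<Rightarrow>\<^sub>0 complex) set" where
  "V_space n p = {x. Poly_Mapping.keys x \<subseteq> link_states n p}"

definition form_kernel :: "complex \<Rightarrow> nat \<Rightarrow> nat \<Rightarrow> (finite_link \<Rightarrow>\<^sub>0 complex) set" where
  "form_kernel \<delta> n p = {x \<in> V_space n p. \<forall>y \<in> V_space n p. bilinear_form \<delta> n x y = 0}"


section \<open>The action on infinite link states\<close>

type_synonym link_vector = "(nat \<Rightarrow> nat) \<Rightarrow>\<^sub>0 complex"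

definition generator_on_link :: "complex \<Rightarrow> nat \<Rightarrow> (nat \<Rightarrow> nat) \<Rightarrow> link_vector" where
  "generator_on_link \<delta> i w =
    (if w i = i \<and> w (Suc i) = Suc i then 0
     else if w i = Suc i then Poly_Mapping.single w \<delta>
     else if w i = i then
       (let b = w (Suc i) in Poly_Mapping.single (w(i := Suc i, Suc i := i, b := b)) 1)
     else if w (Suc i) = Suc i then
       (let b = w i in Poly_Mapping.single (w(i := Suc i, Suc i := i, b := b)) 1)
     else
       (let a = w i; b = w (Suc i)
        in Poly_Mapping.single (w(i := Suc i, Suc i := i, a := b, b := a)) 1))"

fun word_action :: "complex \<Rightarrow> word \<Rightarrow> link_vector \<Rightarrow> link_vector" where
  "word_action \<delta> (Word u) x = foldr (\<lambda>i. linear_extension (generator_on_link \<delta> i)) u x"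

definition free_action :: "complex \<Rightarrow> free_algebra \<Rightarrow> link_vector \<Rightarrow> link_vector" where
  "free_action \<delta> a x = linear_extension (\<lambda>u. word_action \<delta> u x) a"

text \<open>
  Elements of \<^term>\<open>TL_infinity \<delta>\<close> are cosets of the ideal of relations and act through any representative;
  the choice is immaterial on link states, where the generators satisfy the relations.
\<close>

definition TL_action :: "complex \<Rightarrow> free_algebra set \<Rightarrow> link_vector \<Rightarrow> link_vector" where
  "TL_action \<delta> A x = free_action \<delta> (SOME a. a \<in> A) x"

definition link_module :: "complex \<Rightarrow> (free_algebra set, link_vector) module" where
  "link_module \<delta> =
    \<lparr>carrier = {x. Poly_Mapping.keys x \<subseteq> {w. infinite_link_state w}},
     monoid.mult = undefined, one = undefined, ring.zero = 0, add = (+), module.smult = TL_action \<delta>\<rparr>"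

definition X_module :: "complex \<Rightarrow> (nat \<Rightarrow> nat) \<Rightarrow> (free_algebra set, link_vector) module" where
  "X_module \<delta> w = (link_module \<delta>)
    \<lparr>carrier := generated_submodule (TL_infinity \<delta>) (link_module \<delta>) {Poly_Mapping.single w 1}\<rparr>"


section \<open>Restriction and the radical\<close>

text \<open>
  The condition on \<open>m\<close> says that no cup is cut between the first \<open>m\<close> points and the rest; the
  least such \<open>m \<ge> n\<close> is \<open>n\<close> itself if no cup is cut there.
\<close>

definition restriction_length :: "nat \<Rightarrow> (nat \<Rightarrow> nat) \<Rightarrow> nat" where
  "restriction_length n w = (LEAST m. n \<le> m \<and> (\<forall>i<m. w i < m))"

definition restrict_link :: "nat \<Rightarrow> (nat \<Rightarrow> nat) \<Rightarrow> finite_link" where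
  "restrict_link n w =
    (restriction_length n w, \<lambda>i. if i < restriction_length n w then w i else i)"

definition restrict_vector :: "nat \<Rightarrow> link_vector \<Rightarrow> (finite_link \<Rightarrow>\<^sub>0 complex)" where
  "restrict_vector n x = linear_extension (\<lambda>w. Poly_Mapping.single (restrict_link n w) 1) x"

text \<open>
  The length \<open>m\<close> of the restriction is at least \<open>n'\<close>, and larger when a cup would be cut at \<open>n'\<close>.
\<close>

definition X_radical :: "complex \<Rightarrow> (nat \<Rightarrow> nat) \<Rightarrow> link_vector set" where
  "X_radical \<delta> w = {x \<in> carrier (X_module \<delta> w).
     \<exists>n. \<forall>n'\<ge>n. \<exists>m p. restrict_vector n' x \<in> form_kernel \<delta> m p}"

end

theory Submission
  imports Defs
begin

text \<open>
  The link states reachable from \<open>w\<close> all have the tail of \<open>w\<close>: cut at a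
  length \<open>m\<close> at which no cup is cut, they are finite link states with a fixed number
  of strings, glued to the rest of \<open>w\<close>.  For finite link states the classical
  argument runs as follows.  The diagram \<open>|z\<rangle>\<langle>y|\<close> acts on
  \<open>x\<close> as \<open>\<langle>y,x\<rangle> z\<close>, so a vector outside the kernel of
  the form generates every link state.  Here this is applied at a length \<open>m\<close> that
  depends on the vector: a vector outside the radical is, for arbitrarily large \<open>m\<close>,
  outside the kernel, and so it generates \<open>w\<close>.

  Hence every proper submodule of \<open>X(w)\<close> lies in the radical
  (\<open>non_radical_generates\<close>).  The radical is a submodule because the form is
  invariant (\<open>form_invariant\<close>, \<open>TL_stable_radical\<close>), so if it does not
  contain \<open>w\<close> then it is the largest proper submodule.  The quotient by it is then
  irreducible, and two proper submodules cannot have sum \<open>X(w)\<close>, so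
  \<open>X(w)\<close> is indecomposable.  If \<open>\<delta> \<noteq> 0\<close>, then
  \<open>w\<close> is not in the radical because it pairs with itself to a power of
  \<open>\<delta>\<close>.  If \<open>w\<close> has a string, then two link states in suitable
  position glue to a single path without loops, and pair to \<open>1\<close>
  (\<open>single_not_radical\<close>).

  There remains \<open>\<delta> = 0\<close> and \<open>w\<close> without strings, where the form
  vanishes on \<open>X(w)\<close> and only indecomposability is claimed.  Deleting the first
  point turns its partner into a string, and intertwines each generator except the first with its
  predecessor (\<open>delete_first_vector_act\<close>).  The image of \<open>w\<close> has one
  string, so the previous argument applies to it: every proper submodule of \<open>X(w)\<close>
  lies in the preimage of the radical on the other side.  That preimage is closed under addition
  and does not contain \<open>w\<close>, which is all that indecomposability needs.

  Two facts carry the finite argument.  Invariance of the form comes from a contraction rule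
  (\<open>form_contract\<close>): a cup \<open>{i, j}\<close> of one argument can be removed from
  the glued diagram if the partners of \<open>i\<close> and \<open>j\<close> in the other
  argument are joined.  That join is also what the generator does, so applying the rule on both
  sides moves the generator across the form.  The operators \<open>|z\<rangle>\<langle>y|\<close>
  are replaced by words in the generators.  The link state of \<open>p\<close> adjacent pairs at
  the left is connected to every other one by generators acting with coefficient \<open>1\<close>
  (\<open>family_connected\<close>), and the generators along these pairs project onto it with
  coefficient given by the form (\<open>collapse_to_base\<close>).
\<close>

section \<open>Generators acting on link states\<close>

text \<open>
  The link state in the image of a generator, for an arbitrary pair of points in place of
  \<open>i\<close>, \<open>Suc i\<close>: the pair becomes a cup and the former partners are
  joined to each other.  The values \<open>a\<close>, \<open>b\<close> are chosen so that one
  formula covers all cases: if \<open>i\<close> is a string then \<open>a = b\<close> is the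
  partner of \<open>j\<close>, which is then fixed, and if \<open>i\<close> and \<open>j\<close>
  are already joined then nothing changes.
\<close>

definition link_join :: "nat \<Rightarrow> nat \<Rightarrow> (nat \<Rightarrow> nat) \<Rightarrow> nat \<Rightarrow> nat" where
  "link_join i j w =
    (let a = (if w i = i then w j else w i); b = (if w j = j then w i else w j)
     in w(a := b, b := a, i := j, j := i))"

definition join_coeff :: "complex \<Rightarrow> nat \<Rightarrow> nat \<Rightarrow> (nat \<Rightarrow> nat) \<Rightarrow> complex" where
  "join_coeff \<delta> i j w =
    (if w i = i \<and> w j = j then 0 else if w i = j then \<delta> else 1)"

definition involution :: "(nat \<Rightarrow> nat) \<Rightarrow> bool" where
  "involution w \<longleftrightarrow> (\<forall>k. w (w k) = k)"

lemma involutionD: "involution w \<Longrightarrow> w (w k) = k"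
  by (simp add: involution_def)

lemma involution_eq_iff: "involution w \<Longrightarrow> w k = w l \<longleftrightarrow> k = l"
  by (metis involution_def)

lemma link_join_left [simp]: "i \<noteq> j \<Longrightarrow> link_join i j w i = j"
  and link_join_right [simp]: "link_join i j w j = i"
  by (simp_all add: link_join_def Let_def)

lemma link_join_joined:
  assumes "involution w" "w i = j"
  shows "link_join i j w = w"
proof -
  have "w j = i" using assms by (metis involution_def)
  then show ?thesis using assms by (auto simp: link_join_def Let_def fun_eq_iff)
qed

lemma link_join_other:
  assumes "involution w" "i \<noteq> j" "k \<noteq> i" "k \<noteq> j" "k \<noteq> w i" "k \<noteq> w j"
  shows "link_join i j w k = w k"
  using assms by (simp add: link_join_def Let_def)

lemma link_join_partner:
  assumes "involution w" "i \<noteq> j" "w i \<noteq> i" "w i \<noteq> j"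
  shows "link_join i j w (w i) = (if w j = j then w i else w j)"
proof -
  have "w i \<noteq> w j" using assms by (simp add: involution_eq_iff)
  then show ?thesis using assms by (simp add: link_join_def Let_def)
qed

lemma link_join_commute:
  assumes "involution w" "i \<noteq> j"
  shows "link_join i j w = link_join j i w"
proof -
  have ij: "w i \<noteq> w j" using assms by (simp add: involution_eq_iff)
  then show ?thesis using assms by (auto simp: link_join_def Let_def fun_eq_iff)
qed

lemma join_coeff_commute:
  assumes "involution w"
  shows "join_coeff \<delta> i j w = join_coeff \<delta> j i w"
  using assms by (auto simp: join_coeff_def dest: involutionD[of w])

lemma involution_link_join:
  assumes "involution w" "i \<noteq> j"
  shows "involution (link_join i j w)"
proof -
  have inv: "w (w k) = k" for k using assms by (simp add: involution_def)
  define a where "a = (if w i = i then w j else w i)"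
  define b where "b = (if w j = j then w i else w j)"
  have v: "link_join i j w = w(a := b, b := a, i := j, j := i)"
    by (simp add: link_join_def Let_def a_def b_def)
  consider "w i = j" | "w i = i" "w j = j" | "w i \<noteq> j" "a \<notin> {i, j}" "b \<notin> {i, j}"
    using inv assms(2) unfolding a_def b_def by (metis insert_iff empty_iff)
  then show ?thesis
  proof cases
    case 1 then show ?thesis using assms link_join_joined by simp
  next
    case 2 then show ?thesis using assms inv
      by (auto simp: involution_def v a_def b_def)
  next
    case 3
    have out: "w k \<notin> {a, b, i, j}" if "k \<notin> {a, b, i, j}" for k
    proof -
      have "w a \<in> {i, j}" "w b \<in> {i, j}" using inv by (auto simp: a_def b_def)
      moreover have "w i \<in> {i, a, b}" "w j \<in> {j, a, b}" by (auto simp: a_def b_def)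
      ultimately show ?thesis using that inv by (metis insert_iff empty_iff)
    qed
    show ?thesis unfolding involution_def
    proof
      fix k show "link_join i j w (link_join i j w k) = k"
        using 3 out[of k] inv assms(2) by (cases "k \<in> {a, b, i, j}") (auto simp: v)
    qed
  qed
qed

text \<open>
  All case distinctions in the definition of the action go into this lemma; from here on a
  generator is the partial map \<open>link_join\<close> weighted by \<open>join_coeff\<close>.
\<close>

lemma generator_on_link_eq:
  assumes "involution w"
  shows "generator_on_link \<delta> i w =
    Poly_Mapping.single (link_join i (Suc i) w) (join_coeff \<delta> i (Suc i) w)"
proof (cases "w i = Suc i")
  case True
  then show ?thesis using link_join_joined[OF assms True]
    by (simp add: generator_on_link_def join_coeff_def)
next
  case False
  have inv: "w (w k) = k" for k using assms by (simp add: involution_def)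
  have ne: "w (Suc i) \<noteq> i" using False inv by metis
  have ij: "w i \<noteq> w (Suc i)" using assms by (simp add: involution_eq_iff)
  show ?thesis
    using False ne ij inv
    by (auto simp: generator_on_link_def join_coeff_def link_join_def Let_def fun_upd_twist fun_eq_iff
        intro!: arg_cong[where f = "\<lambda>u. Poly_Mapping.single u 1"])
qed

text \<open>
  The combinatorics behind \<open>e\<^sub>i e\<^sub>j e\<^sub>i = e\<^sub>i\<close>: sliding a
  cup one point to the side and back restores the link state.  The same fact later makes the
  sliding of cups reversible.
\<close>

lemma link_join_back:
  assumes "involution w" "w i = j" "i \<noteq> j" "k \<noteq> i" "k \<noteq> j"
  shows "link_join i j (link_join j k w) = w"
proof -
  have inv: "w (w k) = k" for k using assms by (simp add: involution_def)
  have ji: "w j = i" using assms inv by auto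
  have ki: "w k \<noteq> i" "w k \<noteq> j" using assms inv ji by metis+
  show ?thesis
  proof (cases "w k = k")
    case True
    then have "link_join j k w = w(i := i, j := k, k := j)"
      using assms ji by (simp add: link_join_def Let_def fun_eq_iff)
    then show ?thesis using assms ji True by (auto simp: link_join_def Let_def fun_eq_iff)
  next
    case False
    then have "link_join j k w = w(i := w k, w k := i, j := k, k := j)"
      using assms ji by (simp add: link_join_def Let_def fun_eq_iff)
    then show ?thesis using assms ji False ki inv by (auto simp: link_join_def Let_def fun_eq_iff)
  qed
qed

lemma join_coeff_overlap:
  assumes "involution w" "w i = j" "i \<noteq> j" "k \<noteq> i" "k \<noteq> j"
  shows "join_coeff \<delta> j k w = 1" "join_coeff \<delta> i j (link_join j k w) = 1"
proof -
  have ji: "w j = i" using assms by (metis involution_def)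
  then show "join_coeff \<delta> j k w = 1" using assms by (simp add: join_coeff_def)
  show "join_coeff \<delta> i j (link_join j k w) = 1"
    using assms ji involution_link_join[OF assms(1), of j k]
    by (simp add: join_coeff_def) (metis involution_def link_join_left)
qed

text \<open>
  If the coefficient of the product is zero, the two composite link states may differ: they are
  compared only if the coefficient is nonzero.
\<close>

definition joins_commute :: "(nat \<Rightarrow> nat) \<Rightarrow> nat \<Rightarrow> nat \<Rightarrow> nat \<Rightarrow> nat \<Rightarrow> bool" where
  "joins_commute w i j k l \<longleftrightarrow>
    (\<forall>\<delta>. join_coeff \<delta> i j w * join_coeff \<delta> k l (link_join i j w)
        = join_coeff \<delta> k l w * join_coeff \<delta> i j (link_join k l w) \<and>
      (join_coeff \<delta> i j w * join_coeff \<delta> k l (link_join i j w) \<noteq> 0 \<longrightarrow>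
        link_join i j (link_join k l w) = link_join k l (link_join i j w)))"

text \<open>
  The only interaction between two disjoint pairs is through a cup that joins them; by symmetry
  it joins \<open>i\<close> to \<open>k\<close>.  After either generator the other pair inherits
  the loose end of this cup, and both orders join what remains of the partners of
  \<open>j\<close> and \<open>l\<close>.
\<close>

lemma joins_commute_linked:
  assumes "involution w" "distinct [i, j, k, l]" "w i = k"
  shows "joins_commute w i j k l"
proof -
  have inv: "w (w k) = k" for k using assms by (simp add: involution_def)
  have ki: "w k = i" using assms inv by auto
  have nj: "w j \<noteq> i" "w j \<noteq> k" and nl: "w l \<noteq> i" "w l \<noteq> k"
    using inv ki assms by (metis distinct_length_2_or_more)+
  have ne: "i \<noteq> j" "i \<noteq> k" "i \<noteq> l" "j \<noteq> k" "j \<noteq> l" "k \<noteq> l" using assms(2) by auto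
  show ?thesis
  proof (cases "w j = l")
    case True
    then have lj: "w l = j" using inv by auto
    have 1: "link_join i j w = w(i := j, j := i, k := l, l := k)"
      using True ki assms(3) ne by (auto simp: link_join_def Let_def fun_eq_iff)
    have 2: "link_join k l w = w(i := j, j := i, k := l, l := k)"
      using True ki lj assms(3) ne by (auto simp: link_join_def Let_def fun_eq_iff)
    define v where "v = w(i := j, j := i, k := l, l := k)"
    have "involution v" using involution_link_join[OF assms(1) ne(1)] 1 v_def by simp
    moreover have "v i = j" "v k = l" using ne by (simp_all add: v_def)
    ultimately have "link_join i j v = v" "link_join k l v = v"
      by (simp_all add: link_join_joined)
    then show ?thesis
      using True ki lj ne assms(3) \<open>v i = j\<close> \<open>v k = l\<close>
      by (simp add: joins_commute_def 1 2 v_def[symmetric]) (simp add: join_coeff_def)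
  next
    case jl: False
    then have lj: "w l \<noteq> j" using inv by auto
    define b where "b = (if w j = j then k else w j)"
    define d' where "d' = (if w l = l then i else w l)"
    have bb: "b \<noteq> i" "b \<noteq> j" "b \<noteq> l" "d' \<noteq> j" "d' \<noteq> k" "d' \<noteq> l" "b \<noteq> d'"
      "b \<noteq> k \<Longrightarrow> w b = j" "d' \<noteq> i \<Longrightarrow> w d' = l"
      using jl lj nj nl ne inv involution_eq_iff[OF assms(1), of j l] by (auto simp: b_def d'_def)
    have J1: "link_join i j w = w(k := b, b := k, i := j, j := i)"
      using ki ne assms(3) by (auto simp: link_join_def Let_def fun_eq_iff b_def)
    have J2: "link_join k l w = w(i := d', d' := i, k := l, l := k)"
      using ki ne assms(3) by (auto simp: link_join_def Let_def fun_eq_iff d'_def)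
    show ?thesis
    proof (cases "w j = j \<and> w l = l")
      case True
      then show ?thesis using ne ki assms(3) nj nl
        by (auto simp: joins_commute_def join_coeff_def J1 J2 b_def d'_def)
    next
      case False
      have c1: "join_coeff \<delta> i j w = 1" "join_coeff \<delta> k l w = 1" for \<delta>
        using ne ki assms(3) by (auto simp: join_coeff_def)
      have bj: "b = k \<longleftrightarrow> w j = j" and dl: "d' = i \<longleftrightarrow> w l = l"
        using nj nl ne by (auto simp: b_def d'_def)
      have vl: "link_join i j w l = w l" and vk: "link_join i j w k = b"
        using bb ne ki by (auto simp: J1)
      have uj: "link_join k l w j = w j" and ui: "link_join k l w i = d'"
        using bb ne by (auto simp: J2)
      have c2: "join_coeff \<delta> k l (link_join i j w) = 1" "join_coeff \<delta> i j (link_join k l w) = 1" for \<delta>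
        using False bj dl vl vk uj ui bb by (auto simp: join_coeff_def)
      have "link_join k l (link_join i j w) = link_join i j (link_join k l w)"
      proof -
        consider "w j = j" "w l \<noteq> l" | "w j \<noteq> j" "w l = l" | "w j \<noteq> j" "w l \<noteq> l"
          using False by blast
        then show ?thesis
        proof cases
          case 1
          then have b: "b = k" "d' = w l" by (simp_all add: b_def d'_def)
          have "link_join k l (link_join i j w) = w(d' := d', i := j, j := i, k := l, l := k)"
            unfolding link_join_def[of k l] Let_def vk vl using 1 bb ne b nl
            by (simp add: J1 fun_eq_iff)
          moreover have "link_join i j (link_join k l w) = w(d' := d', i := j, j := i, k := l, l := k)"
            unfolding link_join_def[of i j] Let_def uj ui using 1 bb ne b nl
            by (simp add: J2 fun_eq_iff)
          ultimately show ?thesis by simp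
        next
          case 2
          then have b: "b = w j" "d' = i" by (simp_all add: b_def d'_def)
          have "link_join k l (link_join i j w) = w(b := b, i := j, j := i, k := l, l := k)"
            unfolding link_join_def[of k l] Let_def vk vl using 2 bb ne b nj
            by (simp add: J1 fun_eq_iff)
          moreover have "link_join i j (link_join k l w) = w(b := b, i := j, j := i, k := l, l := k)"
            unfolding link_join_def[of i j] Let_def uj ui using 2 bb ne b nj
            by (simp add: J2 fun_eq_iff)
          ultimately show ?thesis by simp
        next
          case 3
          then have b: "b = w j" "d' = w l" by (simp_all add: b_def d'_def)
          have "link_join k l (link_join i j w) = w(b := d', d' := b, i := j, j := i, k := l, l := k)"
            unfolding link_join_def[of k l] Let_def vk vl using 3 bb ne b nl nj
            by (simp add: J1 fun_eq_iff)
          moreover have "link_join i j (link_join k l w) = w(b := d', d' := b, i := j, j := i, k := l, l := k)"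
            unfolding link_join_def[of i j] Let_def uj ui using 3 bb ne b nl nj
            by (simp add: J2 fun_eq_iff)
          ultimately show ?thesis by simp
        qed
      qed
      then show ?thesis by (simp add: joins_commute_def c1 c2)
    qed
  qed
qed

text \<open>
  Without a cup between the pairs both generators change the involution on disjoint sets of
  points; with one, symmetry reduces to \<open>joins_commute_linked\<close>.
\<close>

lemma joins_commute_far:
  assumes "involution w" "distinct [i, j, k, l]"
  shows "joins_commute w i j k l"
proof -
  have inv: "w (w k) = k" for k using assms by (simp add: involution_def)
  have d: "i \<noteq> j" "i \<noteq> k" "i \<noteq> l" "j \<noteq> k" "j \<noteq> l" "k \<noteq> l" using assms(2) by auto
  have swap: "link_join j i v = link_join i j v" "join_coeff \<delta> j i v = join_coeff \<delta> i j v"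
      "link_join l k v = link_join k l v" "join_coeff \<delta> l k v = join_coeff \<delta> k l v"
      if "involution v" for v \<delta>
    using d that by (simp_all add: link_join_commute[of _ j i] link_join_commute[of _ l k]
        join_coeff_commute[of _ _ j i] join_coeff_commute[of _ _ l k])
  note invs = assms(1) involution_link_join[OF assms(1) d(1)] involution_link_join[OF assms(1) d(6)]
  have swap1: "joins_commute w j i k l = joins_commute w i j k l"
    by (simp add: joins_commute_def swap invs)
  have swap2: "joins_commute w i j l k = joins_commute w i j k l"
    by (simp add: joins_commute_def swap invs)
  have swap3: "joins_commute w j i l k = joins_commute w i j k l"
    by (simp add: joins_commute_def swap invs)
  consider "w i = k" | "w i = l" | "w j = k" | "w j = l" |
    "w i \<noteq> k" "w i \<noteq> l" "w j \<noteq> k" "w j \<noteq> l" by blast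
  then show ?thesis
  proof cases
    case 1 then show ?thesis using joins_commute_linked assms by blast
  next
    case 2
    then have "joins_commute w i j l k" using assms d by (intro joins_commute_linked) auto
    then show ?thesis using swap2 by simp
  next
    case 3
    then have "joins_commute w j i k l" using assms d by (intro joins_commute_linked) auto
    then show ?thesis using swap1 by simp
  next
    case 4
    then have "joins_commute w j i l k" using assms d by (intro joins_commute_linked) auto
    then show ?thesis using swap3 by simp
  next
    case 5
    have n: "w k \<noteq> i" "w k \<noteq> j" "w l \<noteq> i" "w l \<noteq> j" using 5 inv by metis+
    have ne: "w i \<noteq> w j" "w i \<noteq> w k" "w i \<noteq> w l" "w j \<noteq> w k" "w j \<noteq> w l" "w k \<noteq> w l"
      using d assms(1) by (simp_all add: involution_eq_iff)
    have v: "link_join i j w k = w k" "link_join i j w l = w l"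
            "link_join k l w i = w i" "link_join k l w j = w j"
      using 5 d n assms(1) by (auto intro!: link_join_other)
    have c: "join_coeff \<delta> k l (link_join i j w) = join_coeff \<delta> k l w"
            "join_coeff \<delta> i j (link_join k l w) = join_coeff \<delta> i j w" for \<delta>
      using v by (simp_all add: join_coeff_def)
    define a where "a = (if w i = i then w j else w i)"
    define b where "b = (if w j = j then w i else w j)"
    define a' where "a' = (if w k = k then w l else w k)"
    define b' where "b' = (if w l = l then w k else w l)"
    have dis: "{a, b, i, j} \<inter> {a', b', k, l} = {}"
      using 5 n ne d unfolding a_def b_def a'_def b'_def by auto
    have "link_join i j (link_join k l w) = w(a' := b', b' := a', k := l, l := k, a := b, b := a, i := j, j := i)"
      unfolding link_join_def[of i j] Let_def v a_def[symmetric] b_def[symmetric]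
      by (simp add: link_join_def Let_def a'_def b'_def)
    moreover have "link_join k l (link_join i j w) = w(a := b, b := a, i := j, j := i, a' := b', b' := a', k := l, l := k)"
      unfolding link_join_def[of k l] Let_def v a'_def[symmetric] b'_def[symmetric]
      by (simp add: link_join_def Let_def a_def b_def)
    moreover have "w(a' := b', b' := a', k := l, l := k, a := b, b := a, i := j, j := i)
        = w(a := b, b := a, i := j, j := i, a' := b', b' := a', k := l, l := k)"
      using dis by (auto simp: fun_eq_iff)
    ultimately show ?thesis by (simp add: joins_commute_def c)
  qed
qed

section \<open>The bilinear form and its contraction\<close>

text \<open>
  The form is generalised from \<open>{..<n}\<close> to arbitrary finite sets of points, so that
  points can be removed without renumbering the others.
\<close>

definition glued_on :: "nat set \<Rightarrow> (nat \<Rightarrow> nat) \<Rightarrow> (nat \<Rightarrow> nat) \<Rightarrow> (nat \<times> nat) set" where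
  "glued_on S x y = {(i, j). i \<in> S \<and> j \<in> S \<and> (j = x i \<or> j = y i)}\<^sup>*"

definition loops_on :: "nat set \<Rightarrow> (nat \<Rightarrow> nat) \<Rightarrow> (nat \<Rightarrow> nat) \<Rightarrow> nat set set" where
  "loops_on S x y = {C \<in> S // glued_on S x y. \<forall>i\<in>C. x i \<noteq> i \<and> y i \<noteq> i}"

definition strings_joined :: "nat set \<Rightarrow> (nat \<Rightarrow> nat) \<Rightarrow> (nat \<Rightarrow> nat) \<Rightarrow> bool" where
  "strings_joined S x y \<longleftrightarrow> (\<forall>i\<in>S. x i = i \<longrightarrow> (\<exists>j\<in>S. (i, j) \<in> glued_on S x y \<and> y j = j))"

definition form_on :: "complex \<Rightarrow> nat set \<Rightarrow> (nat \<Rightarrow> nat) \<Rightarrow> (nat \<Rightarrow> nat) \<Rightarrow> complex" where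
  "form_on \<delta> S x y = (if strings_joined S x y then \<delta> ^ card (loops_on S x y) else 0)"

lemma link_form_eq: "link_form \<delta> n x y = form_on \<delta> {..<n} x y"
proof -
  have "glued n x y = glued_on {..<n} x y" by (simp add: glued_def glued_on_def)
  then show ?thesis
    by (auto simp: link_form_def form_on_def strings_joined_def closed_loops_def loops_on_def)
qed

lemma glued_on_swap: "glued_on S x y = glued_on S y x"
  unfolding glued_on_def by (rule arg_cong[where f = rtrancl]) auto

lemma glued_on_refl [simp]: "(i, i) \<in> glued_on S x y"
  by (simp add: glued_on_def)

lemma glued_on_trans: "(i, j) \<in> glued_on S x y \<Longrightarrow> (j, k) \<in> glued_on S x y \<Longrightarrow> (i, k) \<in> glued_on S x y"
  by (simp add: glued_on_def)

lemma glued_on_edges: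
  assumes "i \<in> S"
  shows "x i \<in> S \<Longrightarrow> (i, x i) \<in> glued_on S x y" "y i \<in> S \<Longrightarrow> (i, y i) \<in> glued_on S x y"
  using assms by (auto simp: glued_on_def)

lemma glued_on_stays: "(i, j) \<in> glued_on S x y \<Longrightarrow> i \<in> S \<Longrightarrow> j \<in> S"
  unfolding glued_on_def by (induction rule: rtrancl_induct) auto

lemma glued_on_sym:
  assumes "involution x" "involution y"
  shows "(i, j) \<in> glued_on S x y \<Longrightarrow> (j, i) \<in> glued_on S x y"
proof -
  have "sym {(i, j). i \<in> S \<and> j \<in> S \<and> (j = x i \<or> j = y i)}"
    using assms by (auto simp: sym_def involution_def)
  then have "sym (glued_on S x y)" unfolding glued_on_def by (rule sym_rtrancl)
  then show "(i, j) \<in> glued_on S x y \<Longrightarrow> (j, i) \<in> glued_on S x y" by (rule symD)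
qed

lemma loops_on_swap: "loops_on S x y = loops_on S y x"
  by (auto simp: loops_on_def glued_on_swap[of S x y])

text \<open>
  The cup \<open>{i, j}\<close> of \<open>y\<close> is removed from the diagram glued from
  \<open>x\<close> and \<open>y\<close>.  In \<open>link_join i j x\<close> the partners of
  \<open>i\<close> and \<open>j\<close> are joined, which replaces the path through
  \<open>i\<close> and \<open>j\<close> by a single arc.
\<close>

locale contraction =
  fixes S :: "nat set" and i j :: nat and x y :: "nat \<Rightarrow> nat"
  assumes fin: "finite S" and ij: "i \<in> S" "j \<in> S" "i \<noteq> j"
    and invx: "involution x" and invy: "involution y"
    and closed_x: "k \<in> S \<Longrightarrow> x k \<in> S" and closed_y: "k \<in> S \<Longrightarrow> y k \<in> S"
    and cup: "y i = j" and not_strings: "\<not> (x i = i \<and> x j = j)"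
begin

abbreviation "S' \<equiv> S - {i, j}"
abbreviation "x' \<equiv> link_join i j x"

lemma cup': "y j = i" using cup invy by (metis involution_def)

lemma y_stays: "k \<in> S' \<Longrightarrow> y k \<in> S'"
  using closed_y cup cup' invy by (metis DiffD1 DiffD2 DiffI insert_iff empty_iff involution_def)

lemma x'_inv: "involution x'"
  using invx ij(3) by (rule involution_link_join)

lemma x'_stays: "k \<in> S \<Longrightarrow> x' k \<in> S"
  using closed_x ij by (auto simp: link_join_def Let_def)

lemma x'_stays': "k \<in> S' \<Longrightarrow> x' k \<in> S'"
proof -
  assume k: "k \<in> S'"
  then have "x' k \<in> S" using x'_stays by auto
  moreover have "x' k \<noteq> i" "x' k \<noteq> j"
    using k x'_inv ij(3) by (metis DiffD2 insertCI involution_def link_join_left link_join_right)+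
  ultimately show ?thesis by auto
qed

text \<open>
  How the arc at a remaining point changes: only the former partners of \<open>i\<close> and
  \<open>j\<close> see the contraction.
\<close>

lemma x'_cases:
  assumes "k \<in> S'" "x i \<noteq> j"
  obtains (same) "x' k = x k" "x k \<in> S'"
  | (to_i) "x k = i" "x' k = (if x j = j then k else x j)"
  | (to_j) "x k = j" "x' k = (if x i = i then k else x i)"
proof -
  have inv: "x (x k) = k" for k using invx by (simp add: involution_def)
  consider "x k = i" | "x k = j" | "x k \<noteq> i" "x k \<noteq> j" by blast
  then show ?thesis
  proof cases
    case 1
    then have "k = x i" "x i \<noteq> i" using inv[of k] assms by auto
    then show ?thesis using to_i link_join_partner[OF invx ij(3)] assms 1 by auto
  next
    case 2
    then have k: "k = x j" "x j \<noteq> j" "x j \<noteq> i" using inv[of k] assms by auto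
    have "link_join j i x (x j) = (if x i = i then x j else x i)"
      using k ij(3) by (intro link_join_partner[OF invx]) auto
    then have "x' k = (if x i = i then k else x i)"
      using k link_join_commute[OF invx ij(3)] by simp
    then show ?thesis using to_j 2 by blast
  next
    case 3
    then have "k \<noteq> x i" "k \<noteq> x j" using inv by metis+
    then show ?thesis using same 3 assms closed_x
      by (auto simp: link_join_other[OF invx ij(3)])
  qed
qed

text \<open>
  Contraction does not change connectedness of the remaining points.  An arc of the contracted
  diagram is a path of the original one.  Conversely, \<open>i\<close> and \<open>j\<close> are
  moved along their arcs in \<open>x\<close> onto remaining points (the map
  \<open>\<pi>\<close>), and this sends arcs to paths; if \<open>x\<close> joins \<open>i\<close>
  to \<open>j\<close>, no path leaves \<open>{i, j}\<close>.
\<close>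

lemma glued_contract:
  assumes "k \<in> S'" "l \<in> S'"
  shows "(k, l) \<in> glued_on S x y \<longleftrightarrow> (k, l) \<in> glued_on S' x' y"
proof
  assume "(k, l) \<in> glued_on S' x' y"
  then show "(k, l) \<in> glued_on S x y"
    unfolding glued_on_def[of S']
  proof (induction rule: rtrancl_induct)
    case (step m n)
    have m: "m \<in> S'" "n \<in> S'" "n = x' m \<or> n = y m" using step by auto
    have "(m, n) \<in> glued_on S x y"
    proof (cases "n = y m")
      case True then show ?thesis using m glued_on_edges[of m S] by auto
    next
      case False
      then have n: "n = x' m" using m by auto
      show ?thesis
      proof (cases "x i = j")
        case True then show ?thesis using n m link_join_joined[OF invx True] glued_on_edges[of m S] by auto
      next
        case F: False
        have e: "(p, x p) \<in> glued_on S x y" "(p, y p) \<in> glued_on S x y" if "p \<in> S" for p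
          using that closed_x closed_y by (auto intro: glued_on_edges)
        have mS: "m \<in> S" using m by auto
        from m(1) F show ?thesis
        proof (cases rule: x'_cases)
          case same then show ?thesis using n e(1)[OF mS] by simp
        next
          case to_i
          have "(m, i) \<in> glued_on S x y" using e(1)[OF mS] to_i by simp
          moreover have "(i, j) \<in> glued_on S x y" using e(2)[OF ij(1)] cup by simp
          moreover have "(j, x j) \<in> glued_on S x y" using e(1)[OF ij(2)] .
          ultimately show ?thesis using n to_i by (auto intro: glued_on_trans)
        next
          case to_j
          have "(m, j) \<in> glued_on S x y" using e(1)[OF mS] to_j by simp
          moreover have "(j, i) \<in> glued_on S x y" using e(2)[OF ij(2)] cup' by simp
          moreover have "(i, x i) \<in> glued_on S x y" using e(1)[OF ij(1)] .
          ultimately show ?thesis using n to_j by (auto intro: glued_on_trans)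
        qed
      qed
    qed
    with step.IH show ?case by (rule glued_on_trans)
  qed simp
next
  have inv: "x (x k) = k" for k using invx by (simp add: involution_def)
  assume kl: "(k, l) \<in> glued_on S x y"
  show "(k, l) \<in> glued_on S' x' y"
  proof (cases "x i = j")
    case True
    then have xj: "x j = i" using inv by metis
    have x': "x' = x" using link_join_joined[OF invx True] .
    have "(k, l) \<in> glued_on S' x y \<and> l \<in> S'"
      using kl unfolding glued_on_def[of S]
    proof (induction rule: rtrancl_induct)
      case (step m n)
      then have "n \<in> S'" using True xj inv y_stays by (metis (mono_tags, lifting) Diff_iff case_prodD insert_iff mem_Collect_eq x' x'_stays')
      moreover have "(m, n) \<in> glued_on S' x y"
        using step glued_on_edges(1)[of m S' x y] glued_on_edges(2)[of m S' y x] calculation by auto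
      ultimately show ?case using step.IH by (auto intro: glued_on_trans)
    qed (use assms in simp)
    then show ?thesis using x' by simp
  next
    case F: False
    then have F': "x j \<noteq> i" using inv by metis
    \<comment> \<open>Points \<open>i\<close>, \<open>j\<close> move to their partners in \<open>x\<close>, or, for a string, to the partner across the cup.\<close>
    define \<pi> where "\<pi> u = (if u = i then (if x i = i then x j else x i)
      else if u = j then (if x j = j then x i else x j) else u)" for u
    have pS: "\<pi> i \<in> S'" "\<pi> j \<in> S'"
      using F F' not_strings inv closed_x ij unfolding \<pi>_def by auto
    have edge: "(\<pi> m, \<pi> n) \<in> glued_on S' x' y" if "m \<in> S" "n \<in> S" "n = x m \<or> n = y m" for m n
    proof -
      have x'p: "x' (\<pi> i) = \<pi> j" "x' (\<pi> j) = \<pi> i"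
        using F F' not_strings x'_inv inv ij(3) unfolding \<pi>_def link_join_def Let_def by auto
      have pp: "(\<pi> i, \<pi> j) \<in> glued_on S' x' y" "(\<pi> j, \<pi> i) \<in> glued_on S' x' y"
        using glued_on_edges(1)[of "\<pi> i" S' x' y] glued_on_edges(1)[of "\<pi> j" S' x' y] pS x'p by auto
      show ?thesis
      proof (cases "m \<in> {i, j}")
        case True
        then show ?thesis
        proof (cases "n = y m")
          case ny: True then show ?thesis using True pp cup cup' by auto
        next
          case False
          then have "n = x m" using that by auto
          then show ?thesis using True F F' ij(3) pp unfolding \<pi>_def by auto
        qed
      next
        case mS: False
        then have m: "m \<in> S'" "\<pi> m = m" using that by (auto simp: \<pi>_def)
        show ?thesis
        proof (cases "n = y m")
          case True then show ?thesis using m y_stays[OF m(1)] glued_on_edges[of m S'] by (auto simp: \<pi>_def)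
        next
          case False
          then have n: "n = x m" using that by auto
          from m(1) F show ?thesis
          proof (cases rule: x'_cases)
            case same
            then show ?thesis using m n glued_on_edges(1)[of m S' x' y] by (auto simp: \<pi>_def)
          next
            case to_i
            then have "m = x i" "x i \<noteq> i" using inv[of m] mS by auto
            then show ?thesis using m n to_i by (auto simp: \<pi>_def)
          next
            case to_j
            then have "m = x j" "x j \<noteq> j" using inv[of m] mS by auto
            then show ?thesis using m n to_j by (auto simp: \<pi>_def)
          qed
        qed
      qed
    qed
    \<comment> \<open>Remaining points are fixed by \<open>\<pi>\<close>, so a path between them is sent to a path in the contracted diagram.\<close>
    have "(\<pi> k, \<pi> l) \<in> glued_on S' x' y"
      using kl unfolding glued_on_def[of S]
    proof (induction rule: rtrancl_induct)
      case (step m n)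
      then have "(\<pi> m, \<pi> n) \<in> glued_on S' x' y" using edge by auto
      with step.IH show ?case by (rule glued_on_trans)
    qed simp
    then show ?thesis using assms by (auto simp: \<pi>_def)
  qed
qed

lemma edges:
  assumes "k \<in> S"
  shows "(k, x k) \<in> glued_on S x y" "(k, y k) \<in> glued_on S x y"
  using assms closed_x closed_y by (auto intro: glued_on_edges)

lemma ij_glued: "(i, j) \<in> glued_on S x y" "(j, i) \<in> glued_on S x y"
  using edges(2)[OF ij(1)] edges(2)[OF ij(2)] cup cup' by auto

text \<open>
  If \<open>i\<close> is a string of \<open>x\<close>, then contraction moves this string to the
  partner of \<open>j\<close>, without leaving the connected component.
\<close>

lemma string_i:
  assumes "x i = i"
  shows "x j \<in> S'" "x' (x j) = x j" "(i, x j) \<in> glued_on S x y"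
proof -
  have xj: "x j \<noteq> j" "x j \<noteq> i" using assms not_strings invx ij(3) by (metis involution_def)+
  then show b: "x j \<in> S'" using closed_x ij by auto
  have "x (x j) = j" using invx by (simp add: involution_def)
  then show "x' (x j) = x j" using b assms ij(3) by (cases rule: x'_cases[OF b]) auto
  show "(i, x j) \<in> glued_on S x y" using ij_glued(1) edges(1)[OF ij(2)] by (rule glued_on_trans)
qed

lemma string_j:
  assumes "x j = j"
  shows "x i \<in> S'" "x' (x i) = x i" "(j, x i) \<in> glued_on S x y"
proof -
  have xj: "x i \<noteq> i" "x i \<noteq> j" using assms not_strings invx ij(3) by (metis involution_def)+
  then show b: "x i \<in> S'" using closed_x ij by auto
  have "x (x i) = i" using invx by (simp add: involution_def)
  then show "x' (x i) = x i" using b assms ij(3) xj by (cases rule: x'_cases[OF b]) auto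
  show "(j, x i) \<in> glued_on S x y" using ij_glued(2) edges(1)[OF ij(1)] by (rule glued_on_trans)
qed

lemma string_x': "m \<in> S' \<Longrightarrow> x m = m \<Longrightarrow> x' m = m"
proof -
  assume m: "m \<in> S'" "x m = m"
  show "x' m = m"
  proof (cases "x i = j")
    case True then show ?thesis using m by (simp add: link_join_joined[OF invx])
  next
    case False
    from m(1) this show ?thesis by (cases rule: x'_cases) (use m in auto)
  qed
qed

lemma x'_string_cases:
  assumes "m \<in> S'" "x' m = m"
  obtains (same) "x m = m" | (i) "x i = i" "m = x j" "x i \<noteq> j" | (j) "x j = j" "m = x i" "x i \<noteq> j"
proof (cases "x i = j")
  case True
  then show ?thesis using assms same by (simp add: link_join_joined[OF invx])
next
  case False
  have inv: "x (x k) = k" for k using invx by (simp add: involution_def)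
  from assms(1) False show ?thesis
  proof (cases rule: x'_cases)
    case same
    with assms that(1) show ?thesis by simp
  next
    case to_i
    then have "m = x i" using inv by metis
    then show ?thesis using to_i assms False that(3) ij(3) by (metis inv)
  next
    case to_j
    then have "m = x j" using inv by metis
    then show ?thesis using to_j assms False that(2) ij(3) by (metis inv)
  qed
qed

lemma strings_contract: "strings_joined S x y \<longleftrightarrow> strings_joined S' x' y"
proof
  assume L: "strings_joined S x y"
  show "strings_joined S' x' y"
    unfolding strings_joined_def
  proof (intro ballI impI)
    fix k assume k: "k \<in> S'" "x' k = k"
    have "\<exists>k'\<in>S. x k' = k' \<and> (k', k) \<in> glued_on S x y"
      using k
    proof (cases rule: x'_string_cases)
      case same then show ?thesis using k by auto
    next
      case i then show ?thesis using string_i ij by auto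
    next
      case j then show ?thesis using string_j ij by auto
    qed
    then obtain k' where k': "k' \<in> S" "x k' = k'" "(k', k) \<in> glued_on S x y" by blast
    with L obtain l where l: "l \<in> S" "y l = l" "(k', l) \<in> glued_on S x y"
      unfolding strings_joined_def by blast
    then have "(k, l) \<in> glued_on S x y" using k' glued_on_sym[OF invx invy] glued_on_trans by metis
    moreover have "l \<in> S'" using l cup cup' ij by auto
    ultimately show "\<exists>j\<in>S'. (k, j) \<in> glued_on S' x' y \<and> y j = j"
      using glued_contract k l by blast
  qed
next
  assume R: "strings_joined S' x' y"
  show "strings_joined S x y"
    unfolding strings_joined_def
  proof (intro ballI impI)
    fix k assume k: "k \<in> S" "x k = k"
    have "\<exists>k'\<in>S'. x' k' = k' \<and> (k, k') \<in> glued_on S x y"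
    proof (cases "k \<in> S'")
      case True then show ?thesis using string_x' k by (intro bexI[of _ k]) auto
    next
      case False then show ?thesis using k string_i string_j by auto
    qed
    then obtain k' where k': "k' \<in> S'" "x' k' = k'" "(k, k') \<in> glued_on S x y" by blast
    with R obtain l where l: "l \<in> S'" "y l = l" "(k', l) \<in> glued_on S' x' y"
      unfolding strings_joined_def by blast
    then show "\<exists>j\<in>S. (k, j) \<in> glued_on S x y \<and> y j = j"
      using glued_contract k' glued_on_trans by (metis DiffD1)
  qed
qed

lemma glued_ij_only:
  assumes "x i = j" "(i, k) \<in> glued_on S x y"
  shows "k \<in> {i, j}"
proof -
  have xj: "x j = i" using assms(1) invx by (metis involution_def)
  show ?thesis using assms(2) unfolding glued_on_def
  proof (induction rule: rtrancl_induct)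
    case (step m n) then show ?case using xj assms(1) cup cup' by auto
  qed simp
qed

lemma class_contract:
  assumes "k \<in> S'"
  shows "glued_on S x y `` {k} \<inter> S' = glued_on S' x' y `` {k}"
  using assms glued_contract glued_on_stays[of k _ S' x' y] by blast

lemma classes_eq:
  assumes "(k, l) \<in> glued_on S x y"
  shows "glued_on S x y `` {k} = glued_on S x y `` {l}"
  using assms glued_on_sym[OF invx invy] by (blast intro: glued_on_trans)

lemma loop_contract:
  assumes "k \<in> S'"
  shows "(\<forall>m\<in>glued_on S x y `` {k}. x m \<noteq> m \<and> y m \<noteq> m) \<longleftrightarrow>
         (\<forall>m\<in>glued_on S' x' y `` {k}. x' m \<noteq> m \<and> y m \<noteq> m)" (is "?L \<longleftrightarrow> ?R")
proof
  assume L: ?L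
  show ?R
  proof
    fix m assume "m \<in> glued_on S' x' y `` {k}"
    then have m: "m \<in> S'" "(k, m) \<in> glued_on S x y" using class_contract[OF assms] by auto
    have "x' m \<noteq> m"
    proof
      assume "x' m = m"
      with m(1) show False
      proof (cases rule: x'_string_cases)
        case same then show False using L m by auto
      next
        case i
        then have "(k, i) \<in> glued_on S x y"
          using m string_i(3) glued_on_sym[OF invx invy] glued_on_trans by metis
        then show False using L i by auto
      next
        case j
        then have "(k, j) \<in> glued_on S x y"
          using m string_j(3) glued_on_sym[OF invx invy] glued_on_trans by metis
        then show False using L j by auto
      qed
    qed
    then show "x' m \<noteq> m \<and> y m \<noteq> m" using L m by auto
  qed
next
  assume R: ?R
  show ?L
  proof
    fix m assume m: "m \<in> glued_on S x y `` {k}"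
    have mS: "m \<in> S" using m assms glued_on_stays by auto
    show "x m \<noteq> m \<and> y m \<noteq> m"
    proof (cases "m \<in> S'")
      case True
      then have "m \<in> glued_on S' x' y `` {k}" using m class_contract[OF assms] by auto
      then show ?thesis using R string_x'[OF True] by auto
    next
      case False
      then have "m = i \<or> m = j" using mS by auto
      moreover have "x m \<noteq> m"
      proof
        assume "x m = m"
        then obtain n where n: "n \<in> S'" "x' n = n" "(m, n) \<in> glued_on S x y"
          using calculation string_i string_j by auto
        then have "n \<in> glued_on S' x' y `` {k}"
          using m class_contract[OF assms] by (auto intro: glued_on_trans)
        then show False using R n by auto
      qed
      ultimately show ?thesis using cup cup' ij(3) by auto
    qed
  qed
qed

text \<open>
  Intersection with the remaining points is a bijection between loops, except that the component
  \<open>{i, j}\<close> is a loop that disappears if \<open>x\<close> joins \<open>i\<close> to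
  \<open>j\<close>.
\<close>

lemma loops_contract:
  "card (loops_on S x y) = card (loops_on S' x' y) + (if x i = j then 1 else 0)"
proof (cases "x i = j")
  case True
  have x': "x' = x" using link_join_joined[OF invx True] .
  have xj: "x j = i" using True invx by (metis involution_def)
  have ci: "glued_on S x y `` {i} = {i, j}" using glued_ij_only[OF True] ij_glued by auto
  have cj: "glued_on S x y `` {j} = {i, j}" using classes_eq[OF ij_glued(1)] ci by simp
  have ck: "glued_on S x y `` {k} = glued_on S' x y `` {k}" if "k \<in> S'" for k
  proof -
    have "m \<in> S'" if m: "(k, m) \<in> glued_on S x y" for m
    proof (rule ccontr)
      assume "m \<notin> S'"
      then have "m = i \<or> m = j" using m \<open>k \<in> S'\<close> glued_on_stays by blast
      then have "k \<in> {i, j}" using m ci cj glued_on_sym[OF invx invy m] by auto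
      then show False using \<open>k \<in> S'\<close> by simp
    qed
    then show ?thesis using class_contract[OF that] x' by auto
  qed
  have "S // glued_on S x y = insert {i, j} (S' // glued_on S' x y)"
  proof -
    have "S // glued_on S x y = (\<lambda>k. glued_on S x y `` {k}) ` S" by (auto simp: quotient_def)
    also have "\<dots> = insert {i, j} ((\<lambda>k. glued_on S x y `` {k}) ` S')"
    proof -
      have "S = {i, j} \<union> S'" using ij by auto
      from arg_cong[OF this, of "image (\<lambda>k. glued_on S x y `` {k})"]
      show ?thesis unfolding image_Un using ci cj by simp
    qed
    also have "(\<lambda>k. glued_on S x y `` {k}) ` S' = (\<lambda>k. glued_on S' x y `` {k}) ` S'"
      using ck by (intro image_cong) auto
    also have "\<dots> = S' // glued_on S' x y" by (auto simp: quotient_def)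
    finally show ?thesis .
  qed
  moreover have "\<forall>k\<in>{i, j}. x k \<noteq> k \<and> y k \<noteq> k"
    using True xj cup cup' ij(3) by simp
  ultimately have "loops_on S x y = insert {i, j} (loops_on S' x y)"
    unfolding loops_on_def by blast
  moreover have "{i, j} \<notin> loops_on S' x y"
  proof
    assume "{i, j} \<in> loops_on S' x y"
    then obtain k where "k \<in> S'" "{i, j} = glued_on S' x y `` {k}"
      by (auto simp: loops_on_def quotient_def)
    moreover have "k \<in> glued_on S' x y `` {k}" by simp
    ultimately have "k \<in> {i, j}" by blast
    then show False using \<open>k \<in> S'\<close> by blast
  qed
  moreover have "finite (loops_on S' x y)"
    using fin by (auto simp: loops_on_def quotient_def)
  ultimately show ?thesis using True x' by simp
next
  case False
  have q: "S // glued_on S x y = (\<lambda>k. glued_on S x y `` {k}) ` S'"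
  proof -
    have "\<exists>l\<in>S'. (k, l) \<in> glued_on S x y" if k: "k \<in> S" for k
    proof (cases "k \<in> S'")
      case False
      then have k: "k = i \<or> k = j" using k by auto
      have xj: "x j \<noteq> i" using \<open>x i \<noteq> j\<close> invx by (metis involution_def)
      show ?thesis
      proof (cases "x k = k")
        case True then show ?thesis using k string_i string_j by auto
      next
        case nk: False
        then have "x k \<in> S'" using k \<open>x i \<noteq> j\<close> xj ij closed_x by auto
        then show ?thesis using edges(1) k ij by auto
      qed
    next
      case True
      then show ?thesis by (intro bexI[of _ k]) auto
    qed
    then have "glued_on S x y `` {k} \<in> (\<lambda>k. glued_on S x y `` {k}) ` S'" if "k \<in> S" for k
      using that classes_eq by (metis image_eqI)
    then show ?thesis by (auto simp: quotient_def)
  qed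
  have q': "S' // glued_on S' x' y = (\<lambda>k. glued_on S' x' y `` {k}) ` S'"
    by (auto simp: quotient_def)
  have "bij_betw (\<lambda>C. C \<inter> S') (loops_on S x y) (loops_on S' x' y)"
    unfolding bij_betw_def
  proof
    show "inj_on (\<lambda>C. C \<inter> S') (loops_on S x y)"
    proof (rule inj_onI)
      fix C D assume CD: "C \<in> loops_on S x y" "D \<in> loops_on S x y" "C \<inter> S' = D \<inter> S'"
      then obtain k l where k: "k \<in> S'" "C = glued_on S x y `` {k}" and l: "l \<in> S'" "D = glued_on S x y `` {l}"
        unfolding loops_on_def q by blast
      have "k \<in> C \<inter> S'" using k by auto
      then have "(l, k) \<in> glued_on S x y" using CD(3) l by auto
      then show "C = D" using classes_eq k l by simp
    qed
    have 1: "loops_on S x y = (\<lambda>k. glued_on S x y `` {k}) ` {k \<in> S'. \<forall>m\<in>glued_on S x y `` {k}. x m \<noteq> m \<and> y m \<noteq> m}"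
      unfolding loops_on_def q by auto
    have 2: "loops_on S' x' y = (\<lambda>k. glued_on S' x' y `` {k}) ` {k \<in> S'. \<forall>m\<in>glued_on S' x' y `` {k}. x' m \<noteq> m \<and> y m \<noteq> m}"
      unfolding loops_on_def q' by auto
    have 3: "{k \<in> S'. \<forall>m\<in>glued_on S x y `` {k}. x m \<noteq> m \<and> y m \<noteq> m}
        = {k \<in> S'. \<forall>m\<in>glued_on S' x' y `` {k}. x' m \<noteq> m \<and> y m \<noteq> m}"
      by (rule Collect_cong, rule conj_cong[OF refl loop_contract])
    show "(\<lambda>C. C \<inter> S') ` loops_on S x y = loops_on S' x' y"
      unfolding 1 2 3 image_image using class_contract by (intro image_cong) auto
  qed
  then show ?thesis using False by (simp add: bij_betw_same_card)
qed

lemma card_strings_contract: "card {k \<in> S'. x' k = k} = card {k \<in> S. x k = k}"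
proof (cases "x i = i \<or> x j = j")
  case False
  have "{k \<in> S'. x' k = k} = {k \<in> S. x k = k}"
    using False string_x' by (auto elim!: x'_string_cases[rotated])
  then show ?thesis by simp
next
  case True
  have inv: "x (x k) = k" for k using invx by (simp add: involution_def)
  have *: "card (insert b (A - {a})) = card A" if "a \<in> A" "b \<notin> A" "finite A" for a b :: nat and A
    using that by (metis Diff_iff card_Suc_Diff1 card_insert_disjoint finite_Diff)
  from True show ?thesis
  proof
    assume xi: "x i = i"
    have "{k \<in> S'. x' k = k} = insert (x j) ({k \<in> S. x k = k} - {i})"
      using xi not_strings string_i[OF xi] string_x' by (auto elim!: x'_string_cases[rotated])
    moreover have "x (x j) \<noteq> x j" using inv xi not_strings by metis
    ultimately show ?thesis using *[of i "{k \<in> S. x k = k}" "x j"] xi ij(1) fin by simp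
  next
    assume xj: "x j = j"
    have "{k \<in> S'. x' k = k} = insert (x i) ({k \<in> S. x k = k} - {j})"
      using xj not_strings string_j[OF xj] string_x' by (auto elim!: x'_string_cases[rotated])
    moreover have "x (x i) \<noteq> x i" using inv xj not_strings by metis
    ultimately show ?thesis using *[of j "{k \<in> S. x k = k}" "x i"] xj ij(2) fin by simp
  qed
qed

end

lemma strings_not_joined:
  assumes "y i = j" "y j = i" "i \<noteq> j" "x i = i" "x j = j" "i \<in> S"
  shows "\<not> strings_joined S x y"
proof
  assume "strings_joined S x y"
  then obtain l where l: "(i, l) \<in> glued_on S x y" "y l = l"
    using assms unfolding strings_joined_def by blast
  from l(1) have "l \<in> {i, j}"
    unfolding glued_on_def
  proof (induction rule: rtrancl_induct)
    case (step m n) then show ?case using assms by auto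
  qed simp
  then show False using l assms by auto
qed

definition involution_on :: "nat set \<Rightarrow> (nat \<Rightarrow> nat) \<Rightarrow> bool" where
  "involution_on S x \<longleftrightarrow> involution x \<and> (\<forall>k\<in>S. x k \<in> S)"

lemma involution_on_link_join:
  assumes "involution_on S x" "i \<in> S" "j \<in> S" "i \<noteq> j"
  shows "involution_on S (link_join i j x)" "involution_on (S - {i, j}) (link_join i j x)"
proof -
  show 1: "involution_on S (link_join i j x)"
    using assms unfolding involution_on_def
    by (auto simp: involution_link_join) (auto simp: link_join_def Let_def)
  have "involution (link_join i j x)" using 1 by (simp add: involution_on_def)
  then have "link_join i j x k \<noteq> i" "link_join i j x k \<noteq> j" if "k \<notin> {i, j}" for k
    using that assms(4) by (metis insertCI involution_def link_join_left link_join_right)+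
  then show "involution_on (S - {i, j}) (link_join i j x)"
    using 1 by (auto simp: involution_on_def)
qed

lemma involution_on_remove_cup:
  assumes "involution_on S y" "y i = j"
  shows "involution_on (S - {i, j}) y"
  using assms unfolding involution_on_def involution_def by (metis Diff_iff insert_iff empty_iff)

text \<open>
  The factor \<open>join_coeff\<close> counts the loop lost in the contraction; it is zero if
  \<open>i\<close> and \<open>j\<close> are both strings of \<open>x\<close>, as is the form,
  because these strings are then joined to each other and not to a string of \<open>y\<close>.
\<close>

lemma form_contract:
  assumes "finite S" "involution_on S x" "involution_on S y" "i \<in> S" "j \<in> S" "i \<noteq> j" "y i = j"
  shows "form_on \<delta> S x y = join_coeff \<delta> i j x * form_on \<delta> (S - {i, j}) (link_join i j x) y"
proof (cases "x i = i \<and> x j = j")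
  case True
  have "y j = i" using assms by (metis involution_on_def involution_def)
  then show ?thesis using True assms strings_not_joined[of y i j x S]
    by (simp add: form_on_def join_coeff_def)
next
  case False
  interpret contraction S i j x y
    using assms False by unfold_locales (auto simp: involution_on_def)
  show ?thesis
    using False ij(3) by (auto simp: form_on_def strings_contract loops_contract join_coeff_def)
qed

text \<open>
  An instance of \<open>contraction\<close> in which the second argument is the single cup
  \<open>{i, j}\<close>; only its effect on \<open>x\<close> is of interest.
\<close>

lemma card_strings_link_join:
  assumes "finite S" "involution_on S x" "i \<in> S" "j \<in> S" "i \<noteq> j" "\<not> (x i = i \<and> x j = j)"
  shows "card {k \<in> S - {i, j}. link_join i j x k = k} = card {k \<in> S. x k = k}"
proof -
  have "involution (id(i := j, j := i))" by (auto simp: involution_def)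
  then interpret contraction S i j x "id(i := j, j := i)"
    using assms by unfold_locales (auto simp: involution_on_def)
  show ?thesis by (rule card_strings_contract)
qed

text \<open>
  A component has at most two string ends.  If every string of \<open>x\<close> ends at a string
  of \<open>y\<close>, and \<open>y\<close> has no more strings than \<open>x\<close>, then no
  string of \<open>y\<close> is left over.  Induction on the number of points replaces the
  analysis of components: contracting a cup of \<open>y\<close> changes neither number of
  strings, and when \<open>y\<close> has no cups the count forces \<open>x\<close> to consist of
  strings as well.
\<close>

lemma strings_joined_sym:
  assumes "finite S" "involution_on S x" "involution_on S y"
    and "card {k \<in> S. y k = k} \<le> card {k \<in> S. x k = k}" "strings_joined S x y"
  shows "strings_joined S y x"
  using assms
proof (induction "card S" arbitrary: S x rule: less_induct)
  case less
  show ?case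
  proof (cases "\<exists>i\<in>S. y i \<noteq> i")
    case False
    then have "{k \<in> S. y k = k} = S" by auto
    then have "card S \<le> card {k \<in> S. x k = k}" using less.prems(4) by simp
    then have "{k \<in> S. x k = k} = S" using less.prems(1) by (intro card_seteq) auto
    then have "x k = k" if "k \<in> S" for k using that by blast
    then show ?thesis unfolding strings_joined_def using glued_on_refl by blast
  next
    case True
    then obtain i where i: "i \<in> S" "y i \<noteq> i" by blast
    define j where "j = y i"
    have j: "j \<in> S" "i \<noteq> j" "y j = i" "y i = j"
      using i less.prems(3) by (auto simp: j_def involution_on_def involution_def)
    have ns: "\<not> (x i = i \<and> x j = j)"
      using strings_not_joined[OF j(4,3,2)] i less.prems(5) by blast
    interpret contraction S i j x y
      using less.prems i j ns by unfold_locales (auto simp: involution_on_def)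
    have "{k \<in> S'. y k = k} = {k \<in> S. y k = k}" using j by auto
    moreover have "card S' < card S" using i fin by (intro psubset_card_mono) auto
    ultimately have IH: "strings_joined S' y x'"
      using less.prems strings_contract card_strings_contract fin involution_on_link_join[OF less.prems(2) i(1) j(1,2)]
        involution_on_remove_cup[OF less.prems(3) j(4)]
      by (intro less.hyps) auto
    show ?thesis unfolding strings_joined_def
    proof (intro ballI impI)
      fix k assume k: "k \<in> S" "y k = k"
      then have kS: "k \<in> S'" using j by auto
      with IH k obtain l where l: "l \<in> S'" "(k, l) \<in> glued_on S' x' y" "x' l = l"
        unfolding strings_joined_def by (metis glued_on_swap)
      then have kl: "(k, l) \<in> glued_on S x y" using glued_contract kS by blast
      have "\<exists>l'\<in>S. x l' = l' \<and> (l', l) \<in> glued_on S x y"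
        using l(1,3)
      proof (cases rule: x'_string_cases)
        case same then show ?thesis using l by auto
      next
        case i then show ?thesis using string_i ij by auto
      next
        case j then show ?thesis using string_j ij by auto
      qed
      then show "\<exists>l\<in>S. (k, l) \<in> glued_on S y x \<and> x l = l"
        using kl glued_on_sym[OF invx invy] glued_on_trans glued_on_swap by metis
    qed
  qed
qed

lemma form_sym:
  assumes "finite S" "involution_on S x" "involution_on S y" "card {k \<in> S. y k = k} = card {k \<in> S. x k = k}"
  shows "form_on \<delta> S x y = form_on \<delta> S y x"
  using assms strings_joined_sym[of S x y] strings_joined_sym[of S y x]
  by (auto simp: form_on_def loops_on_swap[of S x y])

text \<open>
  Both sides reduce to the form of \<open>link_join i j x\<close> and \<open>link_join i j
  y\<close> on the points other than \<open>i\<close> and \<open>j\<close>: on the right by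
  contracting the cup of the second argument, on the left by contracting that of the first, which
  needs symmetry.
\<close>

lemma form_invariant:
  assumes "finite S" "involution_on S x" "involution_on S y" "card {k \<in> S. y k = k} = card {k \<in> S. x k = k}"
    and ij: "i \<in> S" "j \<in> S" "i \<noteq> j"
  shows "join_coeff \<delta> i j x * form_on \<delta> S (link_join i j x) y
       = join_coeff \<delta> i j y * form_on \<delta> S x (link_join i j y)"
proof (cases "x i = i \<and> x j = j")
  case True
  have "\<not> strings_joined S x (link_join i j y)"
    using True ij by (intro strings_not_joined[of _ i j]) auto
  then show ?thesis using True by (simp add: form_on_def join_coeff_def)
next
  case False
  let ?S = "S - {i, j}" and ?x = "link_join i j x" and ?y = "link_join i j y"
  have cx: "card {k \<in> S. ?x k = k} = card {k \<in> S. x k = k}"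
  proof -
    have "{k \<in> S. ?x k = k} = {k \<in> ?S. ?x k = k}" using ij by auto
    then show ?thesis using card_strings_link_join[OF assms(1,2) ij False] by simp
  qed
  note st = involution_on_link_join[OF assms(2) ij] involution_on_link_join[OF assms(3) ij]
  have "form_on \<delta> S ?x y = form_on \<delta> S y ?x"
    using assms st cx by (intro form_sym) auto
  also have "\<dots> = join_coeff \<delta> i j y * form_on \<delta> ?S ?y ?x"
    using assms st by (intro form_contract) auto
  also have "\<dots> = join_coeff \<delta> i j y * form_on \<delta> ?S ?x ?y"
  proof (cases "y i = i \<and> y j = j")
    case True then show ?thesis by (simp add: join_coeff_def)
  next
    case F: False
    have "form_on \<delta> ?S ?y ?x = form_on \<delta> ?S ?x ?y"
      using assms(1,4) st card_strings_link_join[OF assms(1,2) ij False]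
        card_strings_link_join[OF assms(1,3) ij F] by (intro form_sym) auto
    then show ?thesis by simp
  qed
  finally have 1: "form_on \<delta> S ?x y = join_coeff \<delta> i j y * form_on \<delta> ?S ?x ?y" .
  have 2: "form_on \<delta> S x ?y = join_coeff \<delta> i j x * form_on \<delta> ?S ?x ?y"
    using assms st by (intro form_contract) auto
  show ?thesis by (simp add: 1 2)
qed

section \<open>Planarity\<close>

text \<open>
  Planarity in the form in which it is used: the points below a cup are matched among themselves.
\<close>

definition nested :: "(nat \<Rightarrow> nat) \<Rightarrow> bool" where
  "nested u \<longleftrightarrow> (\<forall>c x. c < x \<and> x < u c \<longrightarrow> u x \<noteq> x \<and> c < u x \<and> u x < u c)"

lemma infinite_link_state_iff: "infinite_link_state u \<longleftrightarrow> involution u \<and> nested u"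
proof
  assume u: "infinite_link_state u"
  then have inv: "u (u k) = k" for k by (simp add: infinite_link_state_def link_on_def)
  have cross: "\<not> (a < b \<and> b < u a \<and> u a < u b)" and str: "\<not> (a < b \<and> b < u a \<and> u b = b)" for a b
    using u by (auto simp: infinite_link_state_def link_on_def)
  have "nested u" unfolding nested_def
  proof (intro allI impI)
    fix c x assume cx: "c < x \<and> x < u c"
    have "u x \<noteq> x" using str cx by blast
    moreover have "u x \<noteq> c" "u x \<noteq> u c" using cx inv by (metis less_irrefl)+
    moreover have "\<not> u c < u x" using cross cx by blast
    moreover have "\<not> u x < c" using cross[of "u x" c] cx inv[of x] by auto
    ultimately show "u x \<noteq> x \<and> c < u x \<and> u x < u c" by auto
  qed
  then show "involution u \<and> nested u" using inv by (simp add: involution_def)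
next
  assume u: "involution u \<and> nested u"
  then show "infinite_link_state u"
    unfolding infinite_link_state_def link_on_def involution_def nested_def
    by (metis UNIV_I less_asym)
qed

lemma link_join_apply:
  assumes "involution u" "i \<noteq> j" "u i \<noteq> j" "k \<noteq> i" "k \<noteq> j"
  shows "link_join i j u k =
    (if u k = i then (if u j = j then k else u j)
     else if u k = j then (if u i = i then k else u i) else u k)"
proof -
  have inv: "u (u k) = k" for k using assms by (simp add: involution_def)
  consider "u k = i" | "u k = j" | "u k \<noteq> i" "u k \<noteq> j" by blast
  then show ?thesis
  proof cases
    case 1
    then have k: "k = u i" using inv by metis
    show ?thesis using link_join_partner[OF assms(1,2)] assms k 1 by auto
  next
    case 2
    then have k: "k = u j" using inv by metis
    have "u j \<noteq> i" using inv assms by metis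
    moreover have "u j \<noteq> j" using k assms by simp
    ultimately have "link_join j i u (u j) = (if u i = i then u j else u i)"
      using assms by (intro link_join_partner) auto
    then show ?thesis using link_join_commute[OF assms(1,2)] 2 k assms by auto
  next
    case 3
    then have "k \<noteq> u i" "k \<noteq> u j" using inv by metis+
    then show ?thesis using assms 3 by (simp add: link_join_other)
  qed
qed

text \<open>
  The delicate part is the new arc that joins the partner of \<open>i\<close> to the partner of
  \<open>Suc i\<close>.  As \<open>i\<close> and \<open>Suc i\<close> are adjacent, no other cup
  separates them, so the two old cups are side by side or one lies directly inside the other.
  Below the new arc are then the points below either old cup and the two points in the middle, or
  the points below the larger cup that are outside the smaller one.
\<close>

lemma nested_link_join:
  assumes "involution u" "nested u"
  shows "nested (link_join i (Suc i) u)"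
proof (cases "u i = Suc i")
  case True
  then show ?thesis using assms by (simp add: link_join_joined)
next
  case False
  define v where "v = link_join i (Suc i) u"
  have invu: "u (u k) = k" for k using assms by (simp add: involution_def)
  have invv: "v (v k) = k" for k
    using involution_link_join[OF assms(1), of i "Suc i"] by (simp add: involution_def v_def)
  have N: "u q \<noteq> q" "p < u q" "u q < u p" if "p < q" "q < u p" for p q
    using assms(2) that unfolding nested_def by blast+
  have vi: "v i = Suc i" "v (Suc i) = i" by (simp_all add: v_def)
  have v: "v k = (if u k = i then (if u (Suc i) = Suc i then k else u (Suc i))
     else if u k = Suc i then (if u i = i then k else u i) else u k)" if "k \<noteq> i" "k \<noteq> Suc i" for k
    using link_join_apply[OF assms(1) _ False that] by (simp add: v_def)
  have "v x \<noteq> x \<and> c < v x \<and> v x < v c" if cx: "c < x" "x < v c" for c x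
  proof -
    have c: "c \<noteq> i" "c \<noteq> Suc i" using cx vi by auto
    have vxc: "v x \<noteq> c" "v x \<noteq> v c" using cx invv by (metis less_irrefl)+
    consider (a) "u c = i" | (b) "u c = Suc i" | (o) "u c \<noteq> i" "u c \<noteq> Suc i" by blast
    then show ?thesis
    proof cases
      case o
      then have vc: "v c = u c" using v c by simp
      \<comment> \<open>An old arc that survives has both of the adjacent points below it or neither.\<close>
      have both: "c < i \<and> i < u c \<longleftrightarrow> c < Suc i \<and> Suc i < u c" using c o by auto
      have ux: "u x \<noteq> x" "c < u x" "u x < u c" using N[of c x] cx vc by auto
      show ?thesis
      proof (cases "x = i \<or> x = Suc i")
        case True then show ?thesis using vi cx vc both by auto
      next
        case F: False
        consider "u x = i" | "u x = Suc i" | "u x \<noteq> i" "u x \<noteq> Suc i" by blast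
        then show ?thesis
        proof cases
          case 1
          then have "c < Suc i" "Suc i < u c" using ux both by auto
          note Nj = N[OF this]
          have "v x = u (Suc i)" using F v 1 Nj by simp
          moreover have "u (Suc i) \<noteq> x" using 1 invu[of "Suc i"] by auto
          ultimately show ?thesis using Nj vc by simp
        next
          case 2
          then have "c < i" "i < u c" using ux both by auto
          note Nj = N[OF this]
          have "v x = u i" using F v 2 Nj by simp
          moreover have "u i \<noteq> x" using 2 invu[of i] by auto
          ultimately show ?thesis using Nj vc by simp
        next
          case 3 then show ?thesis using F v ux vc by simp
        qed
      qed
    next
      case a
      then have nb: "u (Suc i) \<noteq> Suc i" and vc: "v c = u (Suc i)" using v[OF c] cx by (auto split: if_splits)
      define b where "b = u (Suc i)"
      have ub: "u b = Suc i" and uc: "u i = c" using invu a by (auto simp: b_def)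
      have cb: "c < b" using cx vc b_def by simp
      have b: "b \<noteq> i" "b \<noteq> Suc i" using nb ub uc c b_def by auto
      have ci: "c < i"
      proof (rule ccontr)
        assume "\<not> c < i"
        then have "i < Suc i" "Suc i < u i" using c uc by auto
        from N(3)[OF this] show False using cb uc b_def by simp
      qed
      have bi: "Suc i < b"
      proof (rule ccontr)
        assume "\<not> Suc i < b"
        then have "c < b" "b < u c" using b cb a by auto
        from N(3)[OF this] show False using ub a by simp
      qed
      consider "x < i" | "x = i \<or> x = Suc i" | "Suc i < x" by linarith
      then show ?thesis
      proof cases
        case 1
        then have "c < x" "x < u c" using cx a by auto
        note Nx = N[OF this]
        then show ?thesis using v[of x] 1 a vc bi b_def by auto
      next
        case 2 then show ?thesis using vi ci bi vc b_def by auto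
      next
        case 3
        then have "Suc i < x" "x < u (Suc i)" using cx vc by auto
        note Nx = N[OF this]
        then show ?thesis using v[of x] 3 ci vc by auto
      qed
    next
      case b
      then have nb: "u i \<noteq> i" and vc: "v c = u i" using v[OF c] cx by (auto split: if_splits)
      define a where "a = u i"
      have ua: "u a = i" and uc: "u (Suc i) = c" using invu[of i] invu[of c] b by (auto simp: a_def)
      have ca: "c < a" using cx vc a_def by simp
      have a: "a \<noteq> i" "a \<noteq> Suc i" using nb ua uc c a_def by auto
      have xa: "x < a" using cx vc a_def by simp
      show ?thesis
      proof (cases "c < i")
        case True
        then have "c < i" "i < u c" using b by auto
        from N[OF this] have ai: "a < i" using nb a_def b a by auto
        have "c < x" "x < u c" using cx b xa ai by auto
        note Nx = N[OF this]
        have x: "x \<noteq> i" "x \<noteq> Suc i" using xa ai by auto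
        have uxa: "u x \<noteq> a" using x ua invu[of x] by auto
        have uxi: "u x \<noteq> i" using xa a_def invu[of x] by auto
        have "\<not> (a < u x \<and> u x < u a)" using N[of a "u x"] xa invu[of x] by auto
        then have "u x < a" using Nx uxa uxi ua b by auto
        then show ?thesis using v[OF x] uxi Nx b vc a_def by auto
      next
        case False
        then have ic: "Suc i < c" using c by auto
        then have x: "x \<noteq> i" "x \<noteq> Suc i" using cx by auto
        have "i < x" "x < u i" using cx ic vc by auto
        note Nx = N[OF this]
        have "u x \<noteq> Suc i" using cx invu[of x] uc by auto
        moreover have "u x \<noteq> c" using x b invu[of x] by auto
        moreover have "\<not> (Suc i < u x \<and> u x < u (Suc i))" using N[of "Suc i" "u x"] cx uc invu[of x] by auto
        ultimately have "c < u x" using Nx uc by auto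
        then show ?thesis using v[OF x] Nx vc ic by auto
      qed
    qed
  qed
  then show ?thesis unfolding nested_def v_def[symmetric] by blast
qed

lemma infinite_link_state_join:
  "infinite_link_state u \<Longrightarrow> infinite_link_state (link_join i (Suc i) u)"
  by (simp add: infinite_link_state_iff involution_link_join nested_link_join)

section \<open>Link states with a common tail\<close>

definition num_strings_below :: "nat \<Rightarrow> (nat \<Rightarrow> nat) \<Rightarrow> nat" where
  "num_strings_below m u = card {k \<in> {..<m}. u k = k}"

text \<open>
  Generators on points below \<open>m\<close> stay inside this set: they do not touch the tail,
  and they preserve the number of strings unless they annihilate.
\<close>

definition link_family :: "nat \<Rightarrow> (nat \<Rightarrow> nat) \<Rightarrow> (nat \<Rightarrow> nat) set" where
  "link_family m w = {u. infinite_link_state u \<and> involution_on {..<m} u \<and> (\<forall>i\<ge>m. u i = w i) \<and>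
     num_strings_below m u = num_strings_below m w}"

lemma link_family_join:
  assumes "u \<in> link_family m w" "Suc i < m" "\<not> (u i = i \<and> u (Suc i) = Suc i)"
  shows "link_join i (Suc i) u \<in> link_family m w"
proof -
  let ?v = "link_join i (Suc i) u"
  have u: "infinite_link_state u" "involution_on {..<m} u" "\<And>i. i \<ge> m \<Longrightarrow> u i = w i"
    "num_strings_below m u = num_strings_below m w" using assms by (auto simp: link_family_def)
  have "involution u" using u by (simp add: infinite_link_state_iff)
  have "?v k = w k" if "k \<ge> m" for k
  proof -
    have "u i < m" "u (Suc i) < m" using u(2) assms(2) by (auto simp: involution_on_def)
    then have "?v k = u k" using that assms(2) \<open>involution u\<close> by (intro link_join_other) auto
    then show ?thesis using u that by simp
  qed
  moreover have "num_strings_below m ?v = num_strings_below m u"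
  proof -
    have "{k \<in> {..<m}. ?v k = k} = {k \<in> {..<m} - {i, Suc i}. ?v k = k}" by auto
    then show ?thesis unfolding num_strings_below_def
      using card_strings_link_join[of "{..<m}" u i "Suc i"] u assms by simp
  qed
  ultimately show ?thesis using u infinite_link_state_join involution_on_link_join(1)[OF u(2), of i "Suc i"] assms(2)
    by (auto simp: link_family_def)
qed

text \<open>
  The generator acts with coefficient \<open>1\<close>: no loop is closed and no two strings are
  joined.
\<close>

definition join_step :: "nat \<Rightarrow> (nat \<Rightarrow> nat) \<Rightarrow> (nat \<Rightarrow> nat) \<Rightarrow> bool" where
  "join_step m u v \<longleftrightarrow> (\<exists>i. Suc i < m \<and> u i \<noteq> Suc i \<and> \<not> (u i = i \<and> u (Suc i) = Suc i) \<and>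
      v = link_join i (Suc i) u)"

text \<open>
  The reference link state: \<open>p\<close> adjacent cups \<open>{0, 1}, {2, 3},
  \<dots>\<close>, then strings up to \<open>m\<close>, then the tail of \<open>w\<close>.
\<close>

definition paired_link :: "nat \<Rightarrow> nat \<Rightarrow> (nat \<Rightarrow> nat) \<Rightarrow> nat \<Rightarrow> nat" where
  "paired_link p m w k =
    (if k < 2 * p then (if even k then Suc k else k - 1) else if k < m then k else w k)"

lemma card_cups_strings:
  assumes "finite S" "involution_on S x"
  shows "card S = card {k \<in> S. x k = k} + 2 * card {k \<in> S. k < x k}"
proof -
  have inv: "x (x k) = k" for k using assms by (simp add: involution_on_def involution_def)
  have "bij_betw x {k \<in> S. k < x k} {k \<in> S. x k < k}"
    by (rule bij_betw_byWitness[where f' = x]) (use assms inv in \<open>auto simp: involution_on_def\<close>)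
  from bij_betw_same_card[OF this]
  have "card {k \<in> S. x k < k} = card {k \<in> S. k < x k}" by simp
  moreover have "card ({k \<in> S. x k = k} \<union> ({k \<in> S. k < x k} \<union> {k \<in> S. x k < k}))
      = card {k \<in> S. x k = k} + (card {k \<in> S. k < x k} + card {k \<in> S. x k < k})"
    (is "card (?A \<union> (?B \<union> ?C)) = _")
  proof -
    have "card (?B \<union> ?C) = card ?B + card ?C"
    proof (rule card_Un_disjoint)
      show "?B \<inter> ?C = {}" by (rule equals0I) (simp, linarith)
    qed (use assms(1) in simp_all)
    moreover have "card (?A \<union> (?B \<union> ?C)) = card ?A + card (?B \<union> ?C)"
    proof (rule card_Un_disjoint)
      show "?A \<inter> (?B \<union> ?C) = {}" by (rule equals0I) (simp, metis less_irrefl)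
    qed (use assms(1) in simp_all)
    ultimately show ?thesis by simp
  qed
  moreover have "{k \<in> S. x k = k} \<union> ({k \<in> S. k < x k} \<union> {k \<in> S. x k < k}) = S" by auto
  ultimately show ?thesis by simp
qed

locale link_family_base =
  fixes m p :: nat and w :: "nat \<Rightarrow> nat"
  assumes p: "m = num_strings_below m w + 2 * p"
begin

abbreviation "base \<equiv> paired_link p m w"

lemma strings_below: "u \<in> link_family m w \<Longrightarrow> card {k \<in> {..<m}. u k = k} = m - 2 * p"
  using p by (simp add: link_family_def num_strings_below_def)

lemma family_eq_base:
  assumes "u \<in> link_family m w" "\<And>l. l < 2 * p \<Longrightarrow> u l = base l"
  shows "u = base"
proof
  have nb: "base l \<noteq> l" if "l < 2 * p" for l
    using that by (cases "even l") (auto simp: paired_link_def elim!: oddE)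
  have "2 * p \<le> k" if "u k = k" for k
    using assms(2)[of k] that nb[of k] by (cases "k < 2 * p") simp_all
  then have "{k \<in> {..<m}. u k = k} \<subseteq> {2 * p..<m}" by auto
  then have "{k \<in> {..<m}. u k = k} = {2 * p..<m}"
    using strings_below[OF assms(1)] by (intro card_subset_eq) auto
  then have "u k = k" if "2 * p \<le> k" "k < m" for k
  proof -
    have "k \<in> {2 * p..<m}" using that by simp
    with \<open>_ = {2 * p..<m}\<close> have "k \<in> {k \<in> {..<m}. u k = k}" by blast
    then show ?thesis by simp
  qed
  then show "u k = base k" for k
    using assms by (auto simp: paired_link_def link_family_def)
qed

lemma agree_stays:
  assumes "u \<in> link_family m w" "\<And>l. l < 2 * k \<Longrightarrow> u l = base l" "k \<le> p" "2 * k \<le> l"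
  shows "2 * k \<le> u l"
proof (rule ccontr)
  assume "\<not> 2 * k \<le> u l"
  then have l: "u l < 2 * k" by simp
  then have "base (u l) < 2 * k" using assms(3) by (auto simp: paired_link_def)
  moreover have "u (u l) = l" using assms(1) by (auto simp: link_family_def involution_on_def involution_def)
  ultimately show False using assms(2)[OF l] assms(4) by simp
qed

text \<open>
  A shortest cup to the right of \<open>2 * k\<close> joins neighbours, since any point below it
  belongs to a shorter cup.
\<close>

lemma exists_adjacent_cup:
  assumes "u \<in> link_family m w" "\<And>l. l < 2 * k \<Longrightarrow> u l = base l" "k < p"
  obtains i where "2 * k \<le> i" "u i = Suc i" "Suc i < m"
proof -
  have u: "involution u" "nested u" "involution_on {..<m} u"
    using assms(1) by (auto simp: link_family_def infinite_link_state_iff)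
  have "\<exists>l. 2 * k \<le> l \<and> l < m \<and> u l \<noteq> l"
  proof (rule ccontr)
    assume "\<not> ?thesis"
    then have "{2 * k..<m} \<subseteq> {k \<in> {..<m}. u k = k}" by auto
    then have "card {2 * k..<m} \<le> card {k \<in> {..<m}. u k = k}" by (rule card_mono[rotated]) simp
    then have "m - 2 * k \<le> m - 2 * p" using strings_below[OF assms(1)] by simp
    then show False using assms(3) p by linarith
  qed
  then obtain l where l: "2 * k \<le> l" "l < m" "u l \<noteq> l" by blast
  define P where "P l \<longleftrightarrow> 2 * k \<le> l \<and> l < m \<and> l < u l" for l
  have "\<exists>l. P l"
  proof (cases "l < u l")
    case False
    then have "u l < u (u l)" using l u by (simp add: involution_def)
    moreover have "2 * k \<le> u l" using agree_stays assms l by auto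
    moreover have "u l < m" using l u by (auto simp: involution_on_def)
    ultimately show ?thesis unfolding P_def by blast
  next
    case True
    then show ?thesis using l(1,2) unfolding P_def by blast
  qed
  then obtain l0 where "P l0" by blast
  from ex_has_least_nat[of P l0 "\<lambda>l. u l - l", OF this]
  obtain l where "P l \<and> (\<forall>l'. P l' \<longrightarrow> u l - l \<le> u l' - l')" by (elim exE)
  then have "P l" and min: "\<And>l'. P l' \<Longrightarrow> u l - l \<le> u l' - l'" by simp_all
  from \<open>P l\<close> have l: "2 * k \<le> l" "l < m" "l < u l" by (simp_all add: P_def)
  have "u l = Suc l"
  proof (rule ccontr)
    assume "u l \<noteq> Suc l"
    then have "l < Suc l" "Suc l < u l" using l by auto
    from u(2)[unfolded nested_def, rule_format, OF conjI, OF this]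
    have x: "u (Suc l) \<noteq> Suc l" "l < u (Suc l)" "u (Suc l) < u l" by simp_all
    have "u l < m" using l u by (auto simp: involution_on_def)
    show False
    proof (cases "Suc l < u (Suc l)")
      case True
      then have "P (Suc l)" using l \<open>Suc l < u l\<close> \<open>u l < m\<close> by (simp add: P_def)
      from min[OF this] show False using x True \<open>Suc l < u l\<close> by simp
    next
      case False
      then show False using x by simp
    qed
  qed
  moreover have "u l < m" using l u by (auto simp: involution_on_def)
  ultimately show ?thesis using that l by auto
qed

text \<open>
  An adjacent cup is moved to the left one point at a time until it becomes the next pair of the
  reference link state.  Every move can be undone by a generator, again with coefficient
  \<open>1\<close>; this gives both directions, and holds for \<open>\<delta> = 0\<close> too.
\<close>

lemma connected_to_base:
  assumes "u \<in> link_family m w" "k \<le> p" "\<And>l. l < 2 * k \<Longrightarrow> u l = base l"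
  shows "(join_step m)\<^sup>*\<^sup>* u base \<and> (join_step m)\<^sup>*\<^sup>* base u"
  using assms
proof (induction "p - k" arbitrary: k u)
  case 0
  then have "u = base" by (intro family_eq_base) auto
  then show ?case by simp
next
  case (Suc n)
  then have kp: "k < p" by simp
  have move: "u' \<in> link_family m w \<Longrightarrow> (\<And>l. l < 2 * k \<Longrightarrow> u' l = base l) \<Longrightarrow>
      u' (2 * k + d) = Suc (2 * k + d) \<Longrightarrow> Suc (2 * k + d) < m \<Longrightarrow>
      (join_step m)\<^sup>*\<^sup>* u' base \<and> (join_step m)\<^sup>*\<^sup>* base u'" for u' d
  proof (induction d arbitrary: u')
    case 0
    have "u' (Suc (2 * k)) = 2 * k"
      using 0(1,3) involutionD[of u' "2 * k"] by (simp add: link_family_def infinite_link_state_iff)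
    then have "u' l = base l" if "l < 2 * Suc k" for l
    proof -
      have "l < 2 * k \<or> l = 2 * k \<or> l = Suc (2 * k)" using that by auto
      then consider "l < 2 * k" | "l = 2 * k" | "l = Suc (2 * k)" by blast
      then show ?thesis
        using 0 kp \<open>u' (Suc (2 * k)) = 2 * k\<close> by cases (auto simp: paired_link_def)
    qed
    then show ?case using Suc.hyps(1)[of "Suc k" u'] Suc.hyps(2) kp 0(1) by auto
  next
    case (Suc d)
    let ?i = "2 * k + d"
    let ?v = "link_join ?i (Suc ?i) u'"
    have inv: "involution u'" using Suc.prems by (simp add: link_family_def infinite_link_state_iff)
    have ui: "u' (Suc ?i) = Suc (Suc ?i)" using Suc.prems by simp
    have ui': "u' (Suc (Suc ?i)) = Suc ?i" using involutionD[OF inv, of "Suc ?i"] ui by simp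
    have ni: "u' ?i \<noteq> Suc ?i" using involutionD[OF inv, of ?i] ui by auto
    have fv: "?v \<in> link_family m w" using Suc.prems ui by (intro link_family_join) auto
    have step1: "join_step m u' ?v"
      unfolding join_step_def using ni ui Suc.prems by (intro exI[of _ ?i]) auto
    have rejoin: "link_join (Suc ?i) (Suc (Suc ?i)) ?v = u'"
    proof -
      have "link_join (Suc (Suc ?i)) (Suc ?i) (link_join (Suc ?i) ?i u') = u'"
        using inv ui' by (intro link_join_back) auto
      then show ?thesis using inv
        by (simp add: link_join_commute[of _ "Suc (Suc ?i)"] link_join_commute[of _ "Suc ?i" ?i] involution_link_join)
    qed
    have step2: "join_step m ?v u'"
      unfolding join_step_def using rejoin Suc.prems by (intro exI[of _ "Suc ?i"]) auto
    have agree: "?v l = base l" if l: "l < 2 * k" for l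
    proof -
      have "u' ?i \<ge> 2 * k" "u' (Suc ?i) \<ge> 2 * k"
        using agree_stays[OF Suc.prems(1,2)] kp by auto
      then have "?v l = u' l" using l inv by (intro link_join_other) auto
      then show ?thesis using Suc.prems l by simp
    qed
    have "(join_step m)\<^sup>*\<^sup>* ?v base \<and> (join_step m)\<^sup>*\<^sup>* base ?v"
      using fv agree Suc.prems by (intro Suc.IH) auto
    then show ?case using step1 step2
      by (blast intro: converse_rtranclp_into_rtranclp rtranclp.rtrancl_into_rtrancl)
  qed
  obtain i where i: "2 * k \<le> i" "u i = Suc i" "Suc i < m"
    using exists_adjacent_cup[OF Suc.prems(1,3) kp] by blast
  then show ?case using move[of u "i - 2 * k"] Suc.prems by simp
qed

lemma family_connected:
  assumes "u \<in> link_family m w"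
  shows "(join_step m)\<^sup>*\<^sup>* u base" "(join_step m)\<^sup>*\<^sup>* base u"
  using connected_to_base[OF assms, of 0] by auto

end

section \<open>Linear algebra\<close>

lemma lookup_scale [simp]: "Poly_Mapping.lookup (scale c x) k = c * Poly_Mapping.lookup x k"
  by (simp add: scale_def Poly_Mapping.map.rep_eq when_def)

lemma scale_one [simp]: "scale 1 x = x"
  and scale_zero_left [simp]: "scale 0 x = 0"
  and scale_zero [simp]: "scale c 0 = 0"
  and scale_scale [simp]: "scale c (scale d x) = scale (c * d) x"
  and scale_add: "scale c (x + y) = scale c x + scale c y"
  and scale_minus_one: "scale (- 1) x = - x"
  and scale_single [simp]: "scale c (Poly_Mapping.single u d) = Poly_Mapping.single u (c * d)"
  by (rule poly_mapping_eqI; simp add: lookup_add algebra_simps lookup_single when_def)+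

lemma keys_scale: "Poly_Mapping.keys (scale c x) \<subseteq> Poly_Mapping.keys x"
  by (auto simp: in_keys_iff)

text \<open>
  The linear functional with given values on the basis; coefficients, the form in one argument
  and compositions of linear extensions are all handled through it.
\<close>

definition pairing :: "('a \<Rightarrow> complex) \<Rightarrow> ('a \<Rightarrow>\<^sub>0 complex) \<Rightarrow> complex" where
  "pairing f x = (\<Sum>k\<in>Poly_Mapping.keys x. Poly_Mapping.lookup x k * f k)"

lemma pairing_superset:
  assumes "finite A" "Poly_Mapping.keys x \<subseteq> A"
  shows "pairing f x = (\<Sum>k\<in>A. Poly_Mapping.lookup x k * f k)"
  unfolding pairing_def using assms by (intro sum.mono_neutral_left) (auto simp: in_keys_iff)

lemma pairing_zero [simp]: "pairing f 0 = 0"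
  by (simp add: pairing_def)

lemma pairing_add: "pairing f (x + y) = pairing f x + pairing f y"
proof -
  let ?A = "Poly_Mapping.keys x \<union> Poly_Mapping.keys y"
  have A: "finite ?A" by simp
  have "pairing f z = (\<Sum>k\<in>?A. Poly_Mapping.lookup z k * f k)" if "z \<in> {x, y, x + y}" for z
    using that keys_add[of x y] by (intro pairing_superset) auto
  then show ?thesis by (simp add: lookup_add algebra_simps sum.distrib)
qed

lemma pairing_scale: "pairing f (scale c x) = c * pairing f x"
proof -
  have "pairing f (scale c x) = (\<Sum>k\<in>Poly_Mapping.keys x. Poly_Mapping.lookup (scale c x) k * f k)"
    by (rule pairing_superset[OF _ keys_scale]) simp
  then show ?thesis by (simp add: pairing_def sum_distrib_left mult.assoc)
qed

lemma pairing_sum: "pairing f (sum g A) = (\<Sum>k\<in>A. pairing f (g k))"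
  by (induction A rule: infinite_finite_induct) (simp_all add: pairing_add)

lemma pairing_single [simp]: "pairing f (Poly_Mapping.single u c) = c * f u"
  by (cases "c = 0") (simp_all add: pairing_def)

lemma pairing_cong:
  "(\<And>k. k \<in> Poly_Mapping.keys x \<Longrightarrow> f k = g k) \<Longrightarrow> pairing f x = pairing g x"
  by (simp add: pairing_def)

lemma pairing_mult: "pairing (\<lambda>k. c * f k) x = c * pairing f x"
  by (simp add: pairing_def sum_distrib_left mult.left_commute)

lemma lookup_linear_extension:
  "Poly_Mapping.lookup (linear_extension f x) b = pairing (\<lambda>k. Poly_Mapping.lookup (f k) b) x"
  by (simp add: linear_extension_def lookup_sum pairing_def)

lemma linear_extension_zero [simp]: "linear_extension f 0 = 0"
  and linear_extension_add: "linear_extension f (x + y) = linear_extension f x + linear_extension f y"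
  and linear_extension_scale: "linear_extension f (scale c x) = scale c (linear_extension f x)"
  and linear_extension_single [simp]:
    "linear_extension f (Poly_Mapping.single u c) = scale c (f u)"
  by (rule poly_mapping_eqI; simp add: lookup_linear_extension lookup_add pairing_add pairing_scale)+

lemma linear_extension_sum:
  "linear_extension f (sum g A) = (\<Sum>k\<in>A. linear_extension f (g k))"
  by (induction A rule: infinite_finite_induct) (simp_all add: linear_extension_add)

lemma pairing_linear_extension:
  "pairing f (linear_extension g x) = pairing (\<lambda>k. pairing f (g k)) x"
  by (simp add: linear_extension_def pairing_sum pairing_scale pairing_def[of "\<lambda>k. pairing f (g k)"])

lemma linear_extension_compose:
  "linear_extension f (linear_extension g x) = linear_extension (\<lambda>k. linear_extension f (g k)) x"
  by (rule poly_mapping_eqI) (simp add: lookup_linear_extension pairing_linear_extension)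

lemma linear_extension_cong:
  "(\<And>k. k \<in> Poly_Mapping.keys x \<Longrightarrow> f k = g k) \<Longrightarrow> linear_extension f x = linear_extension g x"
  by (simp add: linear_extension_def)

lemma linear_extension_id: "linear_extension (\<lambda>u. Poly_Mapping.single u 1) x = x"
proof (rule poly_mapping_eqI)
  fix b
  have "pairing (\<lambda>k. Poly_Mapping.lookup (Poly_Mapping.single k 1) b) x
      = (\<Sum>k\<in>insert b (Poly_Mapping.keys x). Poly_Mapping.lookup x k * (if k = b then 1 else 0))"
    by (subst pairing_superset[of "insert b (Poly_Mapping.keys x)"]) (auto simp: lookup_single when_def)
  also have "\<dots> = Poly_Mapping.lookup x b" by (simp add: sum.insert_remove)
  finally show "Poly_Mapping.lookup (linear_extension (\<lambda>u. Poly_Mapping.single u 1) x) b = Poly_Mapping.lookup x b"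
    by (simp add: lookup_linear_extension)
qed

lemma keys_linear_extension:
  assumes "\<And>k. k \<in> Poly_Mapping.keys x \<Longrightarrow> Poly_Mapping.keys (f k) \<subseteq> A"
  shows "Poly_Mapping.keys (linear_extension f x) \<subseteq> A"
proof
  fix b assume "b \<in> Poly_Mapping.keys (linear_extension f x)"
  then have "pairing (\<lambda>k. Poly_Mapping.lookup (f k) b) x \<noteq> 0"
    by (simp add: in_keys_iff lookup_linear_extension)
  then obtain k where k: "k \<in> Poly_Mapping.keys x" "Poly_Mapping.lookup (f k) b \<noteq> 0"
    unfolding pairing_def by (elim sum.not_neutral_contains_not_neutral) simp
  then have "b \<in> Poly_Mapping.keys (f k)" by (simp add: in_keys_iff)
  then show "b \<in> A" using assms[OF k(1)] by blast
qed

section \<open>Generation by vectors outside the kernel of the form\<close>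

definition act :: "complex \<Rightarrow> nat \<Rightarrow> link_vector \<Rightarrow> link_vector" where
  "act \<delta> i = linear_extension (generator_on_link \<delta> i)"

lemma act_single:
  "involution u \<Longrightarrow> act \<delta> i (Poly_Mapping.single u c) =
    Poly_Mapping.single (link_join i (Suc i) u) (c * join_coeff \<delta> i (Suc i) u)"
  by (simp add: act_def generator_on_link_eq)

lemma act_keys:
  assumes "Poly_Mapping.keys x \<subseteq> A"
    and "\<And>u. u \<in> A \<Longrightarrow> involution u"
    and "\<And>u. u \<in> A \<Longrightarrow> \<not> (u i = i \<and> u (Suc i) = Suc i) \<Longrightarrow> link_join i (Suc i) u \<in> A"
  shows "Poly_Mapping.keys (act \<delta> i x) \<subseteq> A"
  unfolding act_def
proof (rule keys_linear_extension)
  fix u assume "u \<in> Poly_Mapping.keys x"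
  then have u: "u \<in> A" using assms(1) by blast
  show "Poly_Mapping.keys (generator_on_link \<delta> i u) \<subseteq> A"
  proof (cases "u i = i \<and> u (Suc i) = Suc i")
    case True
    then show ?thesis using assms(2)[OF u] by (simp add: generator_on_link_eq join_coeff_def)
  next
    case False
    then show ?thesis
      using assms(2,3)[OF u] by (simp add: generator_on_link_eq)
  qed
qed

text \<open>
  For sets of link vectors these are the submodules, but the definition does not refer to the
  algebra and hence applies before its action is shown to be well defined.
\<close>

definition TL_stable :: "complex \<Rightarrow> link_vector set \<Rightarrow> bool" where
  "TL_stable \<delta> V \<longleftrightarrow> 0 \<in> V \<and> (\<forall>x\<in>V. \<forall>y\<in>V. x + y \<in> V) \<and> (\<forall>c. \<forall>x\<in>V. scale c x \<in> V) \<and>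
     (\<forall>i. \<forall>x\<in>V. act \<delta> i x \<in> V)"

lemma join_step_family:
  assumes "(join_step m)\<^sup>*\<^sup>* u v" "u \<in> link_family m w"
  shows "v \<in> link_family m w"
  using assms by (induction rule: rtranclp_induct) (auto simp: join_step_def intro: link_family_join)

lemma family_involution: "u \<in> link_family m w \<Longrightarrow> involution u"
  by (simp add: link_family_def infinite_link_state_iff)

lemma act_join_step:
  assumes "join_step m u v" "involution u"
  obtains i where "Suc i < m" "v = link_join i (Suc i) u" "\<And>\<delta>. join_coeff \<delta> i (Suc i) u = 1"
    "\<And>\<delta>. act \<delta> i (Poly_Mapping.single u 1) = Poly_Mapping.single v 1"
  using assms by (fastforce simp: join_step_def act_single join_coeff_def)

lemma TL_stable_reach:
  assumes "(join_step m)\<^sup>*\<^sup>* u v" "u \<in> link_family m w" "TL_stable \<delta> V" "Poly_Mapping.single u 1 \<in> V"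
  shows "Poly_Mapping.single v 1 \<in> V"
  using assms(1)
proof (induction rule: rtranclp_induct)
  case (step y z)
  then have "involution y" using join_step_family assms(2) family_involution by blast
  from act_join_step[OF step.hyps(2) this] obtain i
    where "act \<delta> i (Poly_Mapping.single y 1) = Poly_Mapping.single z 1" by metis
  then show ?case using step.IH assms(3) unfolding TL_stable_def by metis
qed (use assms in simp)

text \<open>
  The form against a basis vector; linear in the first argument.  Link states are not truncated,
  because \<open>form_on\<close> depends only on values below \<open>m\<close>.
\<close>

definition family_form :: "complex \<Rightarrow> nat \<Rightarrow> link_vector \<Rightarrow> (nat \<Rightarrow> nat) \<Rightarrow> complex" where
  "family_form \<delta> m x y = pairing (\<lambda>u. form_on \<delta> {..<m} u y) x"

lemma family_form_act:
  assumes "Poly_Mapping.keys x \<subseteq> link_family m w" "y \<in> link_family m w" "Suc i < m"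
  shows "family_form \<delta> m (act \<delta> i x) y = join_coeff \<delta> i (Suc i) y * family_form \<delta> m x (link_join i (Suc i) y)"
proof -
  have "family_form \<delta> m (act \<delta> i x) y
      = pairing (\<lambda>u. pairing (\<lambda>u. form_on \<delta> {..<m} u y) (generator_on_link \<delta> i u)) x"
    by (simp add: family_form_def act_def pairing_linear_extension)
  also have "\<dots> = pairing (\<lambda>u. join_coeff \<delta> i (Suc i) y * form_on \<delta> {..<m} u (link_join i (Suc i) y)) x"
  proof (rule pairing_cong)
    fix u assume "u \<in> Poly_Mapping.keys x"
    then have u: "u \<in> link_family m w" using assms by blast
    have "join_coeff \<delta> i (Suc i) u * form_on \<delta> {..<m} (link_join i (Suc i) u) y
       = join_coeff \<delta> i (Suc i) y * form_on \<delta> {..<m} u (link_join i (Suc i) y)"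
      using u assms by (intro form_invariant) (auto simp: link_family_def num_strings_below_def)
    then show "pairing (\<lambda>u. form_on \<delta> {..<m} u y) (generator_on_link \<delta> i u)
      = join_coeff \<delta> i (Suc i) y * form_on \<delta> {..<m} u (link_join i (Suc i) y)"
      using family_involution[OF u] by (simp add: generator_on_link_eq)
  qed
  finally show ?thesis by (simp add: pairing_mult family_form_def)
qed

lemma act_family_keys:
  assumes "Poly_Mapping.keys x \<subseteq> link_family m w" "Suc i < m"
  shows "Poly_Mapping.keys (act \<delta> i x) \<subseteq> link_family m w"
  using assms by (intro act_keys) (auto intro: link_family_join family_involution)

text \<open>
  The product \<open>e(2k-2) \<cdots> e(2) e(0)\<close> of commuting generators, which creates
  the first \<open>k\<close> pairs of the reference link state.
\<close>

fun collapse :: "complex \<Rightarrow> nat \<Rightarrow> link_vector \<Rightarrow> link_vector" where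
  "collapse \<delta> 0 x = x"
| "collapse \<delta> (Suc k) x = act \<delta> (2 * k) (collapse \<delta> k x)"

lemma collapse_stable: "TL_stable \<delta> V \<Longrightarrow> x \<in> V \<Longrightarrow> collapse \<delta> k x \<in> V"
  by (induction k) (auto simp: TL_stable_def)

lemma collapse_linear:
  "collapse \<delta> k x = linear_extension (\<lambda>u. collapse \<delta> k (Poly_Mapping.single u 1)) x"
  by (induction k) (simp_all add: linear_extension_id act_def linear_extension_compose[symmetric])

context link_family_base
begin

text \<open>
  Each generator applied contracts one pair of the reference link state in the form, and the same
  coefficient appears in the vector and in the form.
\<close>

lemma collapse_single:
  assumes "u \<in> link_family m w" "base \<in> link_family m w" "k \<le> p"
  shows "\<exists>v c. collapse \<delta> k (Poly_Mapping.single u 1) = Poly_Mapping.single v c \<and>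
     form_on \<delta> {..<m} u base = c * form_on \<delta> {2 * k..<m} v base \<and>
     (c \<noteq> 0 \<longrightarrow> v \<in> link_family m w \<and> (\<forall>l<2 * k. v l = base l))"
  using assms(3)
proof (induction k)
  case 0
  then show ?case using assms by (intro exI[of _ u] exI[of _ 1]) (auto simp: lessThan_atLeast0)
next
  case (Suc k)
  then obtain v c where v: "collapse \<delta> k (Poly_Mapping.single u 1) = Poly_Mapping.single v c"
    "form_on \<delta> {..<m} u base = c * form_on \<delta> {2 * k..<m} v base"
    "c \<noteq> 0 \<Longrightarrow> v \<in> link_family m w" "c \<noteq> 0 \<Longrightarrow> l<2 * k \<Longrightarrow> v l = base l" for l
    by auto
  show ?case
  proof (cases "c = 0")
    case True
    then show ?thesis using v by (intro exI[of _ v] exI[of _ 0]) (simp add: act_def)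
  next
    case False
    let ?i = "2 * k" and ?j = "Suc (2 * k)"
    let ?v = "link_join ?i ?j v"
    have vf: "v \<in> link_family m w" and agree: "\<And>l. l<2 * k \<Longrightarrow> v l = base l" using v False by auto
    have inv: "involution v" using vf by (rule family_involution)
    have kp: "k < p" using Suc.prems by simp
    have m: "2 * p \<le> m" using p by linarith
    have st: "involution_on {2 * k..<m} v"
      using vf agree_stays[OF vf agree] kp by (auto simp: link_family_def involution_on_def)
    have stb: "involution_on {2 * k..<m} base"
      using assms(2) agree_stays[OF assms(2), of k] kp by (auto simp: link_family_def involution_on_def)
    have S: "{2 * k..<m} - {?i, ?j} = {2 * Suc k..<m}" by auto
    have "form_on \<delta> {2 * k..<m} v base = join_coeff \<delta> ?i ?j v * form_on \<delta> ({2 * k..<m} - {?i, ?j}) ?v base"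
      using st stb kp m by (intro form_contract) (auto simp: paired_link_def)
    then have fe: "form_on \<delta> {..<m} u base = (c * join_coeff \<delta> ?i ?j v) * form_on \<delta> {2 * Suc k..<m} ?v base"
      using v(2) S by simp
    have ce: "collapse \<delta> (Suc k) (Poly_Mapping.single u 1) = Poly_Mapping.single ?v (c * join_coeff \<delta> ?i ?j v)"
      using v(1) inv by (simp add: act_single)
    have "?v \<in> link_family m w \<and> (\<forall>l<2 * Suc k. ?v l = base l)" if "c * join_coeff \<delta> ?i ?j v \<noteq> 0"
    proof
      have "\<not> (v ?i = ?i \<and> v ?j = ?j)" using that by (auto simp: join_coeff_def)
      then show "?v \<in> link_family m w" using vf kp m by (intro link_family_join) auto
      show "\<forall>l<2 * Suc k. ?v l = base l"
      proof (intro allI impI)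
        fix l assume "l < 2 * Suc k"
        then have "l < 2 * k \<or> l = ?i \<or> l = ?j" by auto
        then show "?v l = base l"
        proof (elim disjE)
          assume l: "l < 2 * k"
          have "2 * k \<le> v ?i" "2 * k \<le> v ?j" using agree_stays[OF vf agree] kp by auto
          then have "?v l = v l" using l inv by (intro link_join_other) auto
          then show ?thesis using agree l by simp
        qed (use kp in \<open>auto simp: paired_link_def\<close>)
      qed
    qed
    then show ?thesis using ce fe by blast
  qed
qed

text \<open>
  With \<open>p\<close> cups created, all remaining points are strings in both arguments, and the
  form on them is \<open>1\<close>.
\<close>

lemma collapse_to_base:
  assumes "Poly_Mapping.keys x \<subseteq> link_family m w" "base \<in> link_family m w"
  shows "collapse \<delta> p x = Poly_Mapping.single base (family_form \<delta> m x base)"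
proof -
  have strings: "form_on \<delta> {2 * p..<m} base base = 1"
  proof -
    have "False" if "C \<in> loops_on {2 * p..<m} base base" for C
    proof -
      have "C \<in> {2 * p..<m} // glued_on {2 * p..<m} base base"
        using that unfolding loops_on_def by blast
      then obtain k where k: "k \<in> {2 * p..<m}" "C = glued_on {2 * p..<m} base base `` {k}"
        by (rule quotientE)
      then have "k \<in> C" by simp
      moreover have "base k = k" using k(1) by (simp add: paired_link_def)
      ultimately show False using that unfolding loops_on_def by blast
    qed
    then have "loops_on {2 * p..<m} base base = {}" by blast
    moreover have "strings_joined {2 * p..<m} base base"
      unfolding strings_joined_def using glued_on_refl by blast
    ultimately show ?thesis by (simp add: form_on_def)
  qed
  have "collapse \<delta> p (Poly_Mapping.single u 1) = Poly_Mapping.single base (form_on \<delta> {..<m} u base)"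
    if u: "u \<in> link_family m w" for u
  proof -
    obtain v c where v: "collapse \<delta> p (Poly_Mapping.single u 1) = Poly_Mapping.single v c"
      "form_on \<delta> {..<m} u base = c * form_on \<delta> {2 * p..<m} v base"
      "c \<noteq> 0 \<longrightarrow> v \<in> link_family m w \<and> (\<forall>l<2 * p. v l = base l)"
      using collapse_single[OF u assms(2) order_refl] by blast
    show ?thesis
    proof (cases "c = 0")
      case False
      then have "v = base" using v(3) family_eq_base by blast
      then show ?thesis using v strings by simp
    qed (use v in simp)
  qed
  then have "collapse \<delta> p x = linear_extension (\<lambda>u. Poly_Mapping.single base (form_on \<delta> {..<m} u base)) x"
    using assms(1) by (subst collapse_linear) (auto intro: linear_extension_cong)
  also have "\<dots> = Poly_Mapping.single base (family_form \<delta> m x base)"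
    by (rule poly_mapping_eqI)
       (auto simp: lookup_linear_extension lookup_single when_def family_form_def pairing_def)
  finally show ?thesis .
qed

text \<open>
  This replaces the operator \<open>|u\<rangle>\<langle>y|\<close>.  The steps from the reference
  link state to \<open>y\<close> are moved to \<open>x\<close> by invariance until
  \<open>x\<close> pairs with the reference link state, then \<open>collapse\<close> isolates
  that link state, and the steps from it to \<open>u\<close> finish.
\<close>

lemma generates_family:
  assumes V: "TL_stable \<delta> V" "x \<in> V" "Poly_Mapping.keys x \<subseteq> link_family m w"
    and y: "y \<in> link_family m w" "family_form \<delta> m x y \<noteq> 0"
    and u: "u \<in> link_family m w"
  shows "Poly_Mapping.single u 1 \<in> V"
proof -
  have base: "base \<in> link_family m w"
    using join_step_family[OF family_connected(1)[OF u] u] .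
  have "(join_step m)\<^sup>*\<^sup>* base y" using family_connected(2)[OF y(1)] .
  then have "\<forall>x\<in>V. Poly_Mapping.keys x \<subseteq> link_family m w \<longrightarrow> family_form \<delta> m x y \<noteq> 0 \<longrightarrow>
      Poly_Mapping.single base 1 \<in> V"
  proof (induction rule: rtranclp_induct)
    case base
    show ?case
    proof (intro ballI impI)
      fix x assume x: "x \<in> V" "Poly_Mapping.keys x \<subseteq> link_family m w" "family_form \<delta> m x base \<noteq> 0"
      have "Poly_Mapping.single base (family_form \<delta> m x base) \<in> V"
        using collapse_to_base[OF x(2) \<open>base \<in> link_family m w\<close>] collapse_stable[OF V(1) x(1)] by metis
      then have "scale (1 / family_form \<delta> m x base) (Poly_Mapping.single base (family_form \<delta> m x base)) \<in> V"
        using V(1) unfolding TL_stable_def by blast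
      then show "Poly_Mapping.single base 1 \<in> V" using x(3) by simp
    qed
  next
    case (step y z)
    have yf: "y \<in> link_family m w" using join_step_family[OF step.hyps(1) base] .
    from act_join_step[OF step.hyps(2) family_involution[OF yf]] obtain i where
      i: "Suc i < m" "z = link_join i (Suc i) y" "join_coeff \<delta> i (Suc i) y = 1" by metis
    show ?case
    proof (intro ballI impI)
      fix x assume x: "x \<in> V" "Poly_Mapping.keys x \<subseteq> link_family m w" "family_form \<delta> m x z \<noteq> 0"
      then have "family_form \<delta> m (act \<delta> i x) y \<noteq> 0"
        using family_form_act[OF x(2) yf i(1), of \<delta>] i by simp
      moreover have "act \<delta> i x \<in> V" using V(1) x(1) unfolding TL_stable_def by blast
      ultimately show "Poly_Mapping.single base 1 \<in> V"
        using step.IH act_family_keys[OF x(2) i(1)] by blast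
    qed
  qed
  then have "Poly_Mapping.single base 1 \<in> V" using V y by blast
  then show ?thesis using TL_stable_reach[OF family_connected(2)[OF u] base V(1)] by blast
qed

end

section \<open>Restriction and the radical\<close>

definition closed_at :: "nat \<Rightarrow> (nat \<Rightarrow> nat) \<Rightarrow> bool" where
  "closed_at m w \<longleftrightarrow> (\<forall>i<m. w i < m)"

text \<open>
  The cups cut at \<open>n\<close> are nested, so the right end of the outermost one is a
  suitable length.
\<close>

lemma exists_closed_at:
  assumes "infinite_link_state w"
  obtains m where "n \<le> m" "closed_at m w"
proof (cases "closed_at n w")
  case False
  then have ex: "\<exists>a. a < n \<and> n \<le> w a" by (auto simp: closed_at_def not_less)
  define a where "a = (LEAST a. a < n \<and> n \<le> w a)"
  have a: "a < n" "n \<le> w a" using LeastI_ex[OF ex] by (simp_all add: a_def)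
  have min: "w i < n" if "i < a" for i
    using not_less_Least[of i "\<lambda>a. a < n \<and> n \<le> w a"] that a by (simp add: a_def[symmetric])
  have w: "involution w" "nested w" using assms by (simp_all add: infinite_link_state_iff)
  have "closed_at (Suc (w a)) w"
    unfolding closed_at_def
  proof (intro allI impI)
    fix i assume i: "i < Suc (w a)"
    consider "i < a" | "i = a" | "i = w a" | "a < i" "i < w a" using i by linarith
    then show "w i < Suc (w a)"
    proof cases
      case 1 then show ?thesis using min[of i] a by simp
    next
      case 3 then show ?thesis using a involutionD[OF w(1), of a] by simp
    next
      case 4
      then have "w i < w a" using w(2) unfolding nested_def by blast
      then show ?thesis by simp
    qed simp
  qed
  then show ?thesis using that[of "Suc (w a)"] a by simp
qed (use that in blast)

lemma restriction_length:
  assumes "infinite_link_state w"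
  shows "n \<le> restriction_length n w" "closed_at (restriction_length n w) w"
proof -
  obtain m where "n \<le> m \<and> (\<forall>i<m. w i < m)"
    using exists_closed_at[OF assms] unfolding closed_at_def by metis
  from LeastI[of "\<lambda>m. n \<le> m \<and> (\<forall>i<m. w i < m)", OF this]
  show "n \<le> restriction_length n w" "closed_at (restriction_length n w) w"
    by (simp_all add: restriction_length_def closed_at_def)
qed

lemma restriction_length_closed: "closed_at m w \<Longrightarrow> restriction_length m w = m"
  unfolding restriction_length_def closed_at_def by (rule Least_equality) auto

lemma self_in_family: "infinite_link_state w \<Longrightarrow> closed_at m w \<Longrightarrow> w \<in> link_family m w"
  by (auto simp: link_family_def closed_at_def involution_on_def infinite_link_state_iff)

lemma family_tail: "u \<in> link_family m w \<Longrightarrow> m \<le> i \<Longrightarrow> u i = w i"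
  by (simp add: link_family_def)

lemma family_below: "u \<in> link_family m w \<Longrightarrow> i < m \<Longrightarrow> u i < m"
  by (auto simp: link_family_def involution_on_def)

lemma card_filter_split:
  fixes m n :: nat
  assumes "m \<le> n"
  shows "card {k \<in> {..<n}. P k} = card {k \<in> {..<m}. P k} + card {k \<in> {m..<n}. P k}"
proof -
  have "{k \<in> {..<n}. P k} = {k \<in> {..<m}. P k} \<union> {k \<in> {m..<n}. P k}"
    using assms by auto
  moreover have "{k \<in> {..<m}. P k} \<inter> {k \<in> {m..<n}. P k} = {}" by auto
  moreover have "finite {k \<in> {..<m}. P k}" "finite {k \<in> {m..<n}. P k}" by auto
  ultimately show ?thesis by (metis card_Un_disjoint)
qed

lemma num_strings_below_split:
  "m \<le> n \<Longrightarrow> num_strings_below n u = num_strings_below m u + card {k \<in> {m..<n}. u k = k}"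
  unfolding num_strings_below_def by (rule card_filter_split)

text \<open>
  The families at lengths without cut cups increase, so finitely many link states reachable from
  \<open>w\<close> lie in a common one.
\<close>

lemma link_family_mono:
  assumes "m \<le> n" "closed_at n w"
  shows "link_family m w \<subseteq> link_family n w"
proof
  fix u assume u: "u \<in> link_family m w"
  have tail: "{k \<in> {m..<n}. u k = k} = {k \<in> {m..<n}. w k = k}"
    using family_tail[OF u] by auto
  have "u k < n" if "k < n" for k
    using family_tail[OF u, of k] family_below[OF u, of k] assms that
    by (cases "k < m") (auto simp: closed_at_def)
  moreover have "num_strings_below n u = num_strings_below n w"
    using u tail num_strings_below_split[OF assms(1)] by (simp add: link_family_def)
  ultimately show "u \<in> link_family n w"
    using u assms(1) by (auto simp: link_family_def involution_on_def)
qed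

text \<open>
  A cup that is cut at a point of the common tail has its right end in the tail, so whether a
  length is admissible depends only on the tail.
\<close>

lemma restriction_length_family:
  assumes "u \<in> link_family m w" "m \<le> n" "closed_at m w"
  shows "restriction_length n u = restriction_length n w"
proof -
  have "(n \<le> k \<and> (\<forall>i<k. u i < k)) \<longleftrightarrow> (n \<le> k \<and> (\<forall>i<k. w i < k))" for k
  proof -
    have "u i < k \<longleftrightarrow> w i < k" if "i < k" "n \<le> k" for i
    proof (cases "i < m")
      case True
      then have "u i < m" "w i < m" using family_below[OF assms(1)] assms(3) by (auto simp: closed_at_def)
      then show ?thesis using that assms(2) by simp
    next
      case False
      then show ?thesis using family_tail[OF assms(1)] by simp
    qed
    then show ?thesis by auto
  qed
  then show ?thesis unfolding restriction_length_def by simp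
qed

text \<open>
  With \<open>extend_by\<close>, the bijection between the family and the finite link states of
  the same length and number of cups.
\<close>

definition truncate :: "nat \<Rightarrow> (nat \<Rightarrow> nat) \<Rightarrow> nat \<Rightarrow> nat" where
  "truncate m u = (\<lambda>i. if i < m then u i else i)"

definition extend_by :: "nat \<Rightarrow> (nat \<Rightarrow> nat) \<Rightarrow> (nat \<Rightarrow> nat) \<Rightarrow> nat \<Rightarrow> nat" where
  "extend_by m w y = (\<lambda>i. if i < m then y i else w i)"

definition cups_below :: "nat \<Rightarrow> (nat \<Rightarrow> nat) \<Rightarrow> nat" where
  "cups_below m u = card {k \<in> {..<m}. k < u k}"

lemma strings_cups_below:
  "involution_on {..<m} u \<Longrightarrow> m = num_strings_below m u + 2 * cups_below m u"
  using card_cups_strings[of "{..<m}" u] by (simp add: num_strings_below_def cups_below_def)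

lemma family_base:
  assumes "infinite_link_state w" "closed_at m w"
  shows "link_family_base m (cups_below m w) w"
  by unfold_locales
     (rule strings_cups_below, use assms in \<open>auto simp: closed_at_def involution_on_def infinite_link_state_iff\<close>)

lemma cups_below_family:
  assumes "u \<in> link_family m w" "infinite_link_state w" "closed_at m w"
  shows "cups_below m u = cups_below m w"
  using strings_cups_below[of m u] strings_cups_below[of m w] assms self_in_family[OF assms(2,3)]
  by (simp add: link_family_def)

lemma truncate_in_link_states:
  assumes "u \<in> link_family m w" "infinite_link_state w" "closed_at m w"
  shows "(m, truncate m u) \<in> link_states m (cups_below m w)"
proof -
  have inf: "infinite_link_state u" using assms(1) by (simp add: link_family_def)
  then have inv: "u (u i) = i" for i by (simp add: infinite_link_state_iff involution_def)
  have below: "i < m \<Longrightarrow> u i < m" for i using family_below[OF assms(1)] .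
  have "link_on {..<m} (truncate m u)"
    unfolding link_on_def
  proof (intro conjI allI impI)
    show "truncate m u (truncate m u i) = i" for i using below inv by (simp add: truncate_def)
    show "truncate m u i = i" if "i \<notin> {..<m}" for i using that by (simp add: truncate_def)
    show "\<not> (a < b \<and> b < truncate m u a \<and> truncate m u a < truncate m u b)" for a b
    proof
      assume *: "a < b \<and> b < truncate m u a \<and> truncate m u a < truncate m u b"
      then have "a < m" by (auto simp: truncate_def split: if_splits)
      then have "b < m" using * below[of a] by (simp add: truncate_def)
      then show False using * \<open>a < m\<close> inf
        by (auto simp: truncate_def infinite_link_state_def link_on_def)
    qed
    show "\<not> (a < i \<and> i < truncate m u a \<and> truncate m u i = i)" for a i
    proof
      assume *: "a < i \<and> i < truncate m u a \<and> truncate m u i = i"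
      then have "a < m" by (auto simp: truncate_def split: if_splits)
      then have "i < m" using * below[of a] by (simp add: truncate_def)
      then show False using * \<open>a < m\<close> inf
        by (auto simp: truncate_def infinite_link_state_def link_on_def)
    qed
  qed
  moreover have "{i. i < m \<and> i < truncate m u i} = {k \<in> {..<m}. k < u k}"
    by (auto simp: truncate_def)
  then have "card {i. i < m \<and> i < truncate m u i} = cups_below m w"
    using cups_below_family[OF assms] by (simp add: cups_below_def)
  ultimately show ?thesis by (simp add: link_states_def)
qed

lemma extend_in_family:
  assumes "(m', y) \<in> link_states m (cups_below m w)" "infinite_link_state w" "closed_at m w"
  shows "extend_by m w y \<in> link_family m w"
proof -
  let ?y = "extend_by m w y"
  have y: "link_on {..<m} y" "card {i. i < m \<and> i < y i} = cups_below m w"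
    using assms(1) by (auto simp: link_states_def)
  have yinv: "y (y i) = i" for i using y by (simp add: link_on_def)
  have yout: "\<not> i < m \<Longrightarrow> y i = i" for i using y by (simp add: link_on_def)
  have yb: "y i < m" if "i < m" for i using yout yinv that by metis
  have winv: "w (w i) = i" and wb: "i < m \<Longrightarrow> w i < m" for i
    using assms by (auto simp: infinite_link_state_iff involution_def closed_at_def)
  have wo: "\<not> w i < m" if "\<not> i < m" for i using wb winv that by metis
  have "link_on UNIV ?y"
    unfolding link_on_def
  proof (intro conjI allI impI)
    show "?y (?y i) = i" for i using yb wo yinv winv by (simp add: extend_by_def)
    show "\<not> (a < b \<and> b < ?y a \<and> ?y a < ?y b)" for a b
    proof
      assume *: "a < b \<and> b < ?y a \<and> ?y a < ?y b"
      show False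
      proof (cases "a < m")
        case True
        then have "b < m" using * yb[of a] by (simp add: extend_by_def)
        then show False using * True y(1) by (auto simp: extend_by_def link_on_def)
      next
        case False
        then show False using * assms(2)
          by (auto simp: extend_by_def infinite_link_state_def link_on_def)
      qed
    qed
    show "\<not> (a < i \<and> i < ?y a \<and> ?y i = i)" for a i
    proof
      assume *: "a < i \<and> i < ?y a \<and> ?y i = i"
      show False
      proof (cases "a < m")
        case True
        then have "i < m" using * yb[of a] by (simp add: extend_by_def)
        then show False using * True y(1) by (auto simp: extend_by_def link_on_def)
      next
        case False
        then show False using * assms(2)
          by (auto simp: extend_by_def infinite_link_state_def link_on_def)
      qed
    qed
  qed simp
  then have inf: "infinite_link_state ?y" by (simp add: infinite_link_state_def)
  then have st: "involution_on {..<m} ?y"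
    using yb by (auto simp: involution_on_def extend_by_def infinite_link_state_iff)
  have "{k \<in> {..<m}. k < ?y k} = {i. i < m \<and> i < y i}" by (auto simp: extend_by_def)
  then have "cups_below m ?y = cups_below m w" using y(2) by (simp add: cups_below_def)
  moreover have "involution_on {..<m} w" using self_in_family[OF assms(2,3)] by (simp add: link_family_def)
  ultimately have "num_strings_below m ?y = num_strings_below m w"
    using strings_cups_below[OF st] strings_cups_below[of m w] by linarith
  then show ?thesis using inf st by (simp add: link_family_def extend_by_def)
qed

lemma form_on_cong:
  assumes "\<And>k. k \<in> S \<Longrightarrow> x k = x' k" "\<And>k. k \<in> S \<Longrightarrow> y k = y' k"
  shows "form_on \<delta> S x y = form_on \<delta> S x' y'"
proof -
  have g: "glued_on S x y = glued_on S x' y'"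
    unfolding glued_on_def using assms by (intro arg_cong[where f = rtrancl]) auto
  have "strings_joined S x y = strings_joined S x' y'"
    unfolding strings_joined_def g using assms by auto
  moreover have "loops_on S x y = loops_on S x' y'"
  proof -
    have "C \<subseteq> S" if "C \<in> S // glued_on S x' y'" for C
      using that glued_on_stays[of _ _ S x' y'] by (auto elim!: quotientE)
    then have eq: "x i = x' i \<and> y i = y' i" if "C \<in> S // glued_on S x' y'" "i \<in> C" for C i
      using that assms by blast
    then show ?thesis unfolding loops_on_def g by (intro Collect_cong conj_cong refl ball_cong) (simp_all add: eq)
  qed
  ultimately show ?thesis by (simp add: form_on_def)
qed

lemma bilinear_form_pairing:
  "bilinear_form \<delta> m x y = pairing (\<lambda>a. pairing (\<lambda>b. link_form \<delta> m (snd a) (snd b)) y) x"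
  by (simp add: bilinear_form_def pairing_def sum_distrib_left mult.assoc)

lemma pairing_swap: "pairing (\<lambda>a. pairing (f a) y) x = pairing (\<lambda>b. pairing (\<lambda>a. f a b) x) y"
  unfolding pairing_def sum_distrib_left
  by (subst sum.swap) (simp add: mult.left_commute)

lemma restrict_vector_family:
  assumes "Poly_Mapping.keys x \<subseteq> link_family M w" "M \<le> n" "closed_at M w"
  shows "restrict_vector n x =
    linear_extension (\<lambda>u. Poly_Mapping.single (restriction_length n w, truncate (restriction_length n w) u) 1) x"
  unfolding restrict_vector_def
proof (rule linear_extension_cong)
  fix u assume "u \<in> Poly_Mapping.keys x"
  then have "restriction_length n u = restriction_length n w"
    using assms restriction_length_family by blast
  then show "Poly_Mapping.single (restrict_link n u) 1 =
      Poly_Mapping.single (restriction_length n w, truncate (restriction_length n w) u) (1 :: complex)"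
    by (simp add: restrict_link_def truncate_def)
qed

lemma restrict_vector_keys:
  assumes "infinite_link_state w" "Poly_Mapping.keys x \<subseteq> link_family M w" "M \<le> n" "closed_at M w"
  shows "Poly_Mapping.keys (restrict_vector n x)
    \<subseteq> link_states (restriction_length n w) (cups_below (restriction_length n w) w)"
  unfolding restrict_vector_family[OF assms(2-4)]
proof (rule keys_linear_extension)
  let ?m = "restriction_length n w"
  fix u assume "u \<in> Poly_Mapping.keys x"
  moreover have "link_family M w \<subseteq> link_family ?m w"
    using restriction_length[OF assms(1), of n] assms(3) by (intro link_family_mono) auto
  ultimately have "u \<in> link_family ?m w" using assms(2) by blast
  then show "Poly_Mapping.keys (Poly_Mapping.single (?m, truncate ?m u) (1::complex)) \<subseteq> link_states ?m (cups_below ?m w)"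
    using truncate_in_link_states assms(1) restriction_length(2)[OF assms(1)] by simp
qed

lemma bilinear_form_restrict:
  assumes "Poly_Mapping.keys x \<subseteq> link_family M w" "M \<le> n" "closed_at M w" "restriction_length n w = m"
  shows "bilinear_form \<delta> m (restrict_vector n x) y = pairing (\<lambda>b. family_form \<delta> m x (snd b)) y"
proof -
  have "bilinear_form \<delta> m (restrict_vector n x) y =
      pairing (\<lambda>u. pairing (\<lambda>b. form_on \<delta> {..<m} (truncate m u) (snd b)) y) x"
    by (simp add: bilinear_form_pairing restrict_vector_family[OF assms(1-3)] assms(4)
        pairing_linear_extension link_form_eq)
  also have "\<dots> = pairing (\<lambda>u. pairing (\<lambda>b. form_on \<delta> {..<m} u (snd b)) y) x"
    by (intro pairing_cong form_on_cong) (auto simp: truncate_def)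
  also have "\<dots> = pairing (\<lambda>b. family_form \<delta> m x (snd b)) y"
    unfolding family_form_def by (rule pairing_swap)
  finally show ?thesis .
qed

text \<open>
  The radical, with the form on infinite link states in place of restrictions.
\<close>

definition family_radical :: "complex \<Rightarrow> (nat \<Rightarrow> nat) \<Rightarrow> link_vector set" where
  "family_radical \<delta> w = {x. \<exists>n. \<forall>m\<ge>n. closed_at m w \<longrightarrow>
     (\<forall>y\<in>link_family m w. family_form \<delta> m x y = 0)}"

text \<open>
  At a length without cut cups the restriction has that length, and pairing it with a finite link
  state is pairing the vector with its extension by the tail of \<open>w\<close>.  If the
  restriction is zero, its length and number of cups cannot be read off from it, but then the
  form vanishes anyway.
\<close>

lemma restrict_radical_iff:
  assumes w: "infinite_link_state w"
    and x: "Poly_Mapping.keys x \<subseteq> link_family M w" "closed_at M w"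
  shows "(\<exists>n. \<forall>n'\<ge>n. \<exists>m p. restrict_vector n' x \<in> form_kernel \<delta> m p) \<longleftrightarrow> x \<in> family_radical \<delta> w"
proof
  assume "\<exists>n. \<forall>n'\<ge>n. \<exists>m p. restrict_vector n' x \<in> form_kernel \<delta> m p"
  then obtain n where n: "\<And>n'. n' \<ge> n \<Longrightarrow> \<exists>m p. restrict_vector n' x \<in> form_kernel \<delta> m p" by blast
  have "family_form \<delta> m x y = 0" if m: "m \<ge> max n M" "closed_at m w" and y: "y \<in> link_family m w" for m y
  proof -
    have len: "restriction_length m w = m" using m(2) by (rule restriction_length_closed)
    let ?r = "restrict_vector m x"
    obtain m' p where k: "?r \<in> form_kernel \<delta> m' p" using n[of m] m by auto
    have "bilinear_form \<delta> m ?r (Poly_Mapping.single (m, truncate m y) 1) = 0"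
    proof (cases "?r = 0")
      case True
      then show ?thesis by (simp add: bilinear_form_def)
    next
      case False
      then have "Poly_Mapping.keys ?r \<noteq> {}" by simp
      then obtain a where a: "a \<in> Poly_Mapping.keys ?r" by blast
      have "Poly_Mapping.keys ?r \<subseteq> link_states m (cups_below m w)"
        using restrict_vector_keys[OF w x(1) _ x(2), of m] m(1) len by simp
      then have "a \<in> link_states m (cups_below m w)" using a by blast
      moreover have "a \<in> link_states m' p"
        using a k by (auto simp: form_kernel_def V_space_def)
      ultimately have "m' = m" "p = cups_below m w" by (auto simp: link_states_def)
      moreover have "(m, truncate m y) \<in> link_states m (cups_below m w)"
        using truncate_in_link_states[OF y w m(2)] .
      ultimately show ?thesis using k by (auto simp: form_kernel_def V_space_def)
    qed
    moreover have "bilinear_form \<delta> m ?r (Poly_Mapping.single (m, truncate m y) 1) = family_form \<delta> m x (truncate m y)"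
      using bilinear_form_restrict[OF x(1) _ x(2) len] m(1) by simp
    moreover have "family_form \<delta> m x (truncate m y) = family_form \<delta> m x y"
      unfolding family_form_def by (intro pairing_cong form_on_cong) (auto simp: truncate_def)
    ultimately show ?thesis by simp
  qed
  then show "x \<in> family_radical \<delta> w" unfolding family_radical_def by blast
next
  assume "x \<in> family_radical \<delta> w"
  then obtain n where n: "\<And>m y. m \<ge> n \<Longrightarrow> closed_at m w \<Longrightarrow> y \<in> link_family m w \<Longrightarrow> family_form \<delta> m x y = 0"
    unfolding family_radical_def by blast
  have "restrict_vector n' x \<in> form_kernel \<delta> (restriction_length n' w) (cups_below (restriction_length n' w) w)"
    if n': "n' \<ge> max n M" for n'
  proof -
    define m where "m = restriction_length n' w"
    have m: "n' \<le> m" "closed_at m w" using restriction_length[OF w] by (auto simp: m_def)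
    have "restrict_vector n' x \<in> V_space m (cups_below m w)"
      using restrict_vector_keys[OF w x(1) _ x(2), of n'] n' by (simp add: V_space_def m_def)
    moreover have "bilinear_form \<delta> m (restrict_vector n' x) y = 0" if "y \<in> V_space m (cups_below m w)" for y
    proof -
      have "bilinear_form \<delta> m (restrict_vector n' x) y = pairing (\<lambda>b. family_form \<delta> m x (snd b)) y"
        using bilinear_form_restrict[OF x(1) _ x(2)] n' by (simp add: m_def)
      also have "\<dots> = pairing (\<lambda>b. 0) y"
      proof (rule pairing_cong)
        fix b assume "b \<in> Poly_Mapping.keys y"
        then have "b \<in> link_states m (cups_below m w)" using that by (auto simp: V_space_def)
        then have "extend_by m w (snd b) \<in> link_family m w"
          by (intro extend_in_family[OF _ w m(2), of "fst b"]) simp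
        then have "family_form \<delta> m x (extend_by m w (snd b)) = 0" using n m n' by simp
        moreover have "family_form \<delta> m x (extend_by m w (snd b)) = family_form \<delta> m x (snd b)"
          unfolding family_form_def by (intro pairing_cong form_on_cong) (auto simp: extend_by_def)
        ultimately show "family_form \<delta> m x (snd b) = 0" by simp
      qed
      finally show ?thesis by (simp add: pairing_def)
    qed
    ultimately show ?thesis by (simp add: form_kernel_def m_def)
  qed
  then show "\<exists>n. \<forall>n'\<ge>n. \<exists>m p. restrict_vector n' x \<in> form_kernel \<delta> m p" by blast
qed


text \<open>
  The span of the link states that agree with \<open>w\<close> beyond some point and have as many
  strings before it.
\<close>

definition link_span :: "(nat \<Rightarrow> nat) \<Rightarrow> link_vector set" where
  "link_span w = {x. \<exists>m. closed_at m w \<and> Poly_Mapping.keys x \<subseteq> link_family m w}"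

lemma link_span_level:
  assumes "x \<in> link_span w" "infinite_link_state w"
  obtains m where "n \<le> m" "closed_at m w" "Poly_Mapping.keys x \<subseteq> link_family m w"
proof -
  obtain k where k: "closed_at k w" "Poly_Mapping.keys x \<subseteq> link_family k w"
    using assms(1) by (auto simp: link_span_def)
  obtain m where m: "max n k \<le> m" "closed_at m w" by (rule exists_closed_at[OF assms(2)])
  then have "link_family k w \<subseteq> link_family m w" by (intro link_family_mono) auto
  then show ?thesis using that[of m] m k by auto
qed

lemma TL_stable_link_span:
  assumes "infinite_link_state w"
  shows "TL_stable \<delta> (link_span w)"
  unfolding TL_stable_def
proof (intro conjI ballI allI)
  show "0 \<in> link_span w"
    by (rule exists_closed_at[OF assms]) (auto simp: link_span_def)
next
  fix x y assume xy: "x \<in> link_span w" "y \<in> link_span w"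
  obtain k where k: "closed_at k w" "Poly_Mapping.keys x \<subseteq> link_family k w"
    using xy(1) by (auto simp: link_span_def)
  obtain m where m: "k \<le> m" "closed_at m w" "Poly_Mapping.keys y \<subseteq> link_family m w"
    by (rule link_span_level[OF xy(2) assms])
  have "Poly_Mapping.keys (x + y) \<subseteq> link_family m w"
    using keys_add[of x y] k(2) m(3) link_family_mono[OF m(1,2)] by blast
  then show "x + y \<in> link_span w" using m(2) by (auto simp: link_span_def)
next
  fix c x assume "x \<in> link_span w"
  then show "scale c x \<in> link_span w" using keys_scale[of c x] unfolding link_span_def by blast
next
  fix i x assume x: "x \<in> link_span w"
  obtain m where m: "Suc (Suc i) \<le> m" "closed_at m w" "Poly_Mapping.keys x \<subseteq> link_family m w"
    by (rule link_span_level[OF x assms])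
  then have "Poly_Mapping.keys (act \<delta> i x) \<subseteq> link_family m w" by (intro act_family_keys) auto
  then show "act \<delta> i x \<in> link_span w" using m by (auto simp: link_span_def)
qed

lemma single_in_link_span: "infinite_link_state w \<Longrightarrow> Poly_Mapping.single w 1 \<in> link_span w"
proof -
  assume w: "infinite_link_state w"
  obtain m where "closed_at m w" by (rule exists_closed_at[OF w])
  then show ?thesis using self_in_family[OF w] by (auto simp: link_span_def)
qed

lemma family_radical_add:
  assumes "x \<in> family_radical \<delta> w" "y \<in> family_radical \<delta> w"
  shows "x + y \<in> family_radical \<delta> w"
proof -
  obtain n1 n2 where n: "\<And>m u. m \<ge> n1 \<Longrightarrow> closed_at m w \<Longrightarrow> u \<in> link_family m w \<Longrightarrow> family_form \<delta> m x u = 0"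
    "\<And>m u. m \<ge> n2 \<Longrightarrow> closed_at m w \<Longrightarrow> u \<in> link_family m w \<Longrightarrow> family_form \<delta> m y u = 0"
    using assms unfolding family_radical_def by blast
  then have "\<forall>m\<ge>max n1 n2. closed_at m w \<longrightarrow> (\<forall>u\<in>link_family m w. family_form \<delta> m (x + y) u = 0)"
    by (simp add: family_form_def pairing_add)
  then show ?thesis unfolding family_radical_def by blast
qed

text \<open>
  A generator inside the first \<open>m\<close> points moves to the other argument by invariance;
  \<open>m\<close> is taken large enough for the vector and for the generator.
\<close>

lemma TL_stable_radical:
  assumes "infinite_link_state w"
  shows "TL_stable \<delta> (link_span w \<inter> family_radical \<delta> w)"
  unfolding TL_stable_def
proof (intro conjI ballI allI)
  have span: "0 \<in> link_span w" "x \<in> link_span w \<Longrightarrow> y \<in> link_span w \<Longrightarrow> x + y \<in> link_span w"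
    "x \<in> link_span w \<Longrightarrow> scale c x \<in> link_span w" "x \<in> link_span w \<Longrightarrow> act \<delta> i x \<in> link_span w" for x y c i
    using TL_stable_link_span[OF assms, of \<delta>] unfolding TL_stable_def by blast+
  show "0 \<in> link_span w \<inter> family_radical \<delta> w"
    using span by (simp add: family_radical_def family_form_def)
  show "x + y \<in> link_span w \<inter> family_radical \<delta> w"
    if "x \<in> link_span w \<inter> family_radical \<delta> w" "y \<in> link_span w \<inter> family_radical \<delta> w" for x y
    using that span family_radical_add by blast
  show "scale c x \<in> link_span w \<inter> family_radical \<delta> w" if x: "x \<in> link_span w \<inter> family_radical \<delta> w" for c x
  proof -
    obtain n where "\<And>m u. m \<ge> n \<Longrightarrow> closed_at m w \<Longrightarrow> u \<in> link_family m w \<Longrightarrow> family_form \<delta> m x u = 0"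
      using x unfolding family_radical_def by blast
    then have "scale c x \<in> family_radical \<delta> w"
      by (auto simp: family_radical_def family_form_def pairing_scale intro!: exI[of _ n])
    then show ?thesis using x span by blast
  qed
  show "act \<delta> i x \<in> link_span w \<inter> family_radical \<delta> w" if x: "x \<in> link_span w \<inter> family_radical \<delta> w" for i x
  proof -
    obtain n where n: "\<And>m u. m \<ge> n \<Longrightarrow> closed_at m w \<Longrightarrow> u \<in> link_family m w \<Longrightarrow> family_form \<delta> m x u = 0"
      using x unfolding family_radical_def by blast
    obtain k where k: "closed_at k w" "Poly_Mapping.keys x \<subseteq> link_family k w"
      using x by (auto simp: link_span_def)
    have "family_form \<delta> m (act \<delta> i x) u = 0"
      if m: "m \<ge> max n (max k (Suc (Suc i)))" "closed_at m w" and u: "u \<in> link_family m w" for m u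
    proof -
      have keys: "Poly_Mapping.keys x \<subseteq> link_family m w"
        using k link_family_mono[of k m w] m by auto
      have i: "Suc i < m" using m by simp
      show ?thesis
      proof (cases "u i = i \<and> u (Suc i) = Suc i")
        case True
        then show ?thesis using family_form_act[OF keys u i] by (simp add: join_coeff_def)
      next
        case False
        then have "link_join i (Suc i) u \<in> link_family m w" using u i by (intro link_family_join)
        then show ?thesis using n m family_form_act[OF keys u i] by simp
      qed
    qed
    then have "act \<delta> i x \<in> family_radical \<delta> w" unfolding family_radical_def by blast
    then show ?thesis using x span by blast
  qed
qed

text \<open>
  This makes the radical maximal: some length witnesses that \<open>x\<close> lies outside it, and at that
  length the family of \<open>w\<close> contains all link states of \<open>x\<close>.
\<close>

lemma non_radical_generates:
  assumes w: "infinite_link_state w" and x: "x \<in> link_span w" "x \<notin> family_radical \<delta> w"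
    and V: "TL_stable \<delta> V" "x \<in> V"
  shows "Poly_Mapping.single w 1 \<in> V"
proof -
  obtain k where k: "closed_at k w" "Poly_Mapping.keys x \<subseteq> link_family k w"
    using x by (auto simp: link_span_def)
  obtain m y where m: "m \<ge> k" "closed_at m w" "y \<in> link_family m w" "family_form \<delta> m x y \<noteq> 0"
    using x(2) unfolding family_radical_def by blast
  interpret link_family_base m "cups_below m w" w using w m(2) by (rule family_base)
  have "Poly_Mapping.keys x \<subseteq> link_family m w" using k link_family_mono[OF m(1,2)] by blast
  then show ?thesis using generates_family[OF V _ m(3,4) self_in_family[OF w m(2)]] by blast
qed

text \<open>
  The reference link state shifted by one: the string comes first, then cups \<open>{1, 2}, {3,
  4}, \<dots>\<close>.  Glued to the reference link state, it gives the path \<open>0, 1,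
  \<dots>, 2 * p\<close> with a string at each end.
\<close>

definition offset_link :: "nat \<Rightarrow> nat \<Rightarrow> (nat \<Rightarrow> nat) \<Rightarrow> nat \<Rightarrow> nat" where
  "offset_link p m w k =
    (if k = 0 then 0 else if k \<le> 2 * p then (if odd k then Suc k else k - 1) else if k < m then k else w k)"

context link_family_base
begin

abbreviation "offset \<equiv> offset_link p m w"

lemma offset_in_family:
  assumes "infinite_link_state w" "closed_at m w" "2 * p < m"
  shows "offset \<in> link_family m w"
proof -
  have w: "w (w k) = k" "nested w" for k
    using assms(1) by (auto simp: infinite_link_state_iff involution_def)
  have wm: "\<not> w k < m" if "\<not> k < m" for k
    using assms(2) w(1) that unfolding closed_at_def by metis
  have low: "offset k \<le> Suc k \<and> offset k < m" if "k < m" for k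
    using that assms(3) by (auto simp: offset_link_def elim!: oddE; presburger)
  have inv: "offset (offset k) = k" for k
  proof -
    consider "k = 0" | "0 < k" "k \<le> 2 * p" "odd k" | "0 < k" "k \<le> 2 * p" "even k" | "2 * p < k" "k < m" | "m \<le> k"
      by linarith
    then show ?thesis
    proof cases
      case 2
      then obtain b where b: "k = Suc (2 * b)" by (auto elim: oddE)
      then have "Suc k \<le> 2 * p" using 2 by presburger
      then show ?thesis using b by (simp add: offset_link_def)
    next
      case 5 then show ?thesis using wm[of k] w(1)[of k] assms(3) by (simp add: offset_link_def)
    qed (auto simp: offset_link_def elim!: oddE evenE)
  qed
  have nested: "nested offset"
    unfolding nested_def
  proof (intro allI impI)
    fix c x assume cx: "c < x \<and> x < offset c"
    then have c: "m \<le> c" using low[of c] by (cases "c < m") auto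
    then have "offset c = w c" "offset x = w x" using cx assms(3) by (simp_all add: offset_link_def)
    then show "offset x \<noteq> x \<and> c < offset x \<and> offset x < offset c"
      using cx w(2) unfolding nested_def by simp
  qed
  have fixed: "offset k = k \<longleftrightarrow> k = 0 \<or> 2 * p < k" if "k < m" for k
    using that by (auto simp: offset_link_def elim!: oddE)
  have "{k \<in> {..<m}. offset k = k} = insert 0 {Suc (2 * p)..<m}"
  proof (rule Set.set_eqI)
    fix k show "k \<in> {k \<in> {..<m}. offset k = k} \<longleftrightarrow> k \<in> insert 0 {Suc (2 * p)..<m}"
      using fixed[of k] assms(3) by (cases "k < m") (simp_all add: Suc_le_eq)
  qed
  then have "num_strings_below m offset = num_strings_below m w"
    using p assms(3) by (simp add: num_strings_below_def[of m offset])
  moreover have "offset k = w k" if "m \<le> k" for k using that assms(3) by (simp add: offset_link_def)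
  ultimately show ?thesis
    using inv nested low by (simp add: link_family_def infinite_link_state_iff involution_def involution_on_def)
qed

lemma form_base_offset:
  assumes "2 * p < m" "infinite_link_state w" "closed_at m w" "base \<in> link_family m w"
  shows "form_on \<delta> {..<m} base offset = 1"
proof -
  let ?G = "glued_on {..<m} base offset"
  have path: "k \<le> 2 * p \<Longrightarrow> (0, k) \<in> ?G" for k
  proof (induction k)
    case (Suc k)
    have "(k, Suc k) \<in> ?G"
    proof (cases "even k")
      case True
      then have "base k = Suc k" using Suc.prems by (simp add: paired_link_def)
      then show ?thesis using glued_on_edges(1)[of k "{..<m}" base offset] Suc.prems assms(1) by simp
    next
      case False
      then have "offset k = Suc k" using Suc.prems by (auto simp: offset_link_def elim: oddE)
      then show ?thesis using glued_on_edges(2)[of k "{..<m}" offset base] Suc.prems assms(1) by simp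
    qed
    then show ?case using Suc by (auto intro: glued_on_trans)
  qed simp
  have inv: "involution base" "involution offset"
    using assms offset_in_family family_involution by blast+
  have to_zero: "(k, 0) \<in> ?G" if "k \<le> 2 * p" for k
    using glued_on_sym[OF inv path[OF that]] .
  have off0: "offset 0 = 0" by (simp add: offset_link_def)
  have "strings_joined {..<m} base offset"
    unfolding strings_joined_def
  proof (intro ballI impI)
    fix i assume i: "i \<in> {..<m}" "base i = i"
    show "\<exists>j\<in>{..<m}. (i, j) \<in> ?G \<and> offset j = j"
    proof (cases "i \<le> 2 * p")
      case True
      then show ?thesis using to_zero off0 assms(1) by (intro bexI[of _ 0]) auto
    next
      case False
      then show ?thesis using i by (intro bexI[of _ i]) (auto simp: offset_link_def)
    qed
  qed
  moreover have "loops_on {..<m} base offset = {}"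
  proof (rule equals0I)
    fix C assume C: "C \<in> loops_on {..<m} base offset"
    then have "C \<in> {..<m} // ?G" unfolding loops_on_def by blast
    then obtain k where k: "k \<in> {..<m}" "C = ?G `` {k}" by (rule quotientE)
    show False
    proof (cases "k \<le> 2 * p")
      case True
      then have "0 \<in> C" using to_zero k by simp
      then show False using C off0 unfolding loops_on_def by blast
    next
      case False
      then have "base k = k" using k(1) by (simp add: paired_link_def)
      moreover have "k \<in> C" using k by simp
      ultimately show False using C unfolding loops_on_def by blast
    qed
  qed
  ultimately show ?thesis by (simp add: form_on_def)
qed

end

text \<open>
  If \<open>\<delta> \<noteq> 0\<close>, \<open>w\<close> pairs with itself to a power of
  \<open>\<delta>\<close>.  If \<open>w\<close> has a string and lies in the kernel at length
  \<open>m\<close>, then so does the reference link state, because it is reached from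
  \<open>w\<close> and the form is invariant; but it pairs with \<open>offset\<close> to
  \<open>1\<close>.
\<close>

lemma single_not_radical:
  assumes w: "infinite_link_state w" and "\<delta> \<noteq> 0 \<or> w s = s"
  shows "Poly_Mapping.single w 1 \<notin> family_radical \<delta> w"
proof
  assume "Poly_Mapping.single w 1 \<in> family_radical \<delta> w"
  then obtain n where n: "\<And>m y. m \<ge> n \<Longrightarrow> closed_at m w \<Longrightarrow> y \<in> link_family m w \<Longrightarrow>
      family_form \<delta> m (Poly_Mapping.single w 1) y = 0"
    unfolding family_radical_def by blast
  obtain m where m: "max n (Suc s) \<le> m" "closed_at m w" by (rule exists_closed_at[OF w])
  have wf: "w \<in> link_family m w" using self_in_family[OF w m(2)] .
  have ker: "family_form \<delta> m (Poly_Mapping.single w 1) y = 0" if "y \<in> link_family m w" for y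
    using n[of m y] m that by simp
  show False
  proof (cases "\<delta> = 0")
    case False
    have "strings_joined {..<m} w w" unfolding strings_joined_def using glued_on_refl by blast
    then have "form_on \<delta> {..<m} w w \<noteq> 0" using False by (simp add: form_on_def)
    then show False using ker[OF wf] by (simp add: family_form_def)
  next
    case True
    then have s: "w s = s" using assms(2) by blast
    interpret link_family_base m "cups_below m w" w using w m(2) by (rule family_base)
    have "0 < num_strings_below m w"
      unfolding num_strings_below_def using s m(1) by (auto simp: card_gt_0_iff intro!: exI[of _ s])
    then have pm: "2 * cups_below m w < m" using p by linarith
    have "u \<in> link_family m w \<and> (\<forall>y\<in>link_family m w. family_form \<delta> m (Poly_Mapping.single u 1) y = 0)"
      if "(join_step m)\<^sup>*\<^sup>* w u" for u
      using that
    proof (induction rule: rtranclp_induct)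
      case base
      then show ?case using wf ker by blast
    next
      case (step u v)
      have uf: "u \<in> link_family m w" using step.IH by blast
      from act_join_step[OF step.hyps(2) family_involution[OF uf]] obtain i where
        i: "Suc i < m" "act \<delta> i (Poly_Mapping.single u 1) = Poly_Mapping.single v 1" by metis
      have keys: "Poly_Mapping.keys (Poly_Mapping.single u (1::complex)) \<subseteq> link_family m w" using uf by simp
      have "family_form \<delta> m (Poly_Mapping.single v 1) y = 0" if y: "y \<in> link_family m w" for y
      proof (cases "y i = i \<and> y (Suc i) = Suc i")
        case True
        then show ?thesis using family_form_act[OF keys y i(1), of \<delta>] i(2) by (simp add: join_coeff_def)
      next
        case False
        then have "link_join i (Suc i) y \<in> link_family m w" using y i by (intro link_family_join)
        then show ?thesis using family_form_act[OF keys y i(1), of \<delta>] i(2) step.IH by simp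
      qed
      moreover have "v \<in> link_family m w" using join_step_family[of m u v w] step.hyps(2) uf by blast
      ultimately show ?case by blast
    qed
    from this[OF family_connected(1)[OF wf]]
    have "base \<in> link_family m w" "family_form \<delta> m (Poly_Mapping.single base 1) offset = 0"
      using offset_in_family[OF w m(2) pm] by auto
    then show False using form_base_offset[OF pm w m(2)] by (simp add: family_form_def)
  qed
qed

section \<open>Modules over a noncommutative ring\<close>

context left_module
begin

lemma smult_zero_left:
  assumes "x \<in> carrier M"
  shows "\<zero>\<^bsub>R\<^esub> \<odot>\<^bsub>M\<^esub> x = \<zero>\<^bsub>M\<^esub>"
proof -
  let ?z = "\<zero>\<^bsub>R\<^esub> \<odot>\<^bsub>M\<^esub> x"
  have z: "?z \<in> carrier M" using assms by (simp add: smult_closed)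
  have "?z \<oplus>\<^bsub>M\<^esub> ?z = ?z" using smult_l_distr[of "\<zero>\<^bsub>R\<^esub>" "\<zero>\<^bsub>R\<^esub>" x] assms by simp
  then have "?z \<oplus>\<^bsub>M\<^esub> ?z = ?z \<oplus>\<^bsub>M\<^esub> \<zero>\<^bsub>M\<^esub>" using z by simp
  then show ?thesis using z by (simp only: M.add.l_cancel M.zero_closed)
qed

lemma smult_minus_one:
  assumes "x \<in> carrier M"
  shows "(\<ominus>\<^bsub>R\<^esub> \<one>\<^bsub>R\<^esub>) \<odot>\<^bsub>M\<^esub> x = \<ominus>\<^bsub>M\<^esub> x"
proof -
  have "(\<ominus>\<^bsub>R\<^esub> \<one>\<^bsub>R\<^esub>) \<odot>\<^bsub>M\<^esub> x \<oplus>\<^bsub>M\<^esub> x = (\<ominus>\<^bsub>R\<^esub> \<one>\<^bsub>R\<^esub> \<oplus>\<^bsub>R\<^esub> \<one>\<^bsub>R\<^esub>) \<odot>\<^bsub>M\<^esub> x"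
    using assms smult_one by (simp add: smult_l_distr)
  also have "\<dots> = \<zero>\<^bsub>M\<^esub>" using assms by (simp add: R.l_neg smult_zero_left)
  finally have "(\<ominus>\<^bsub>R\<^esub> \<one>\<^bsub>R\<^esub>) \<odot>\<^bsub>M\<^esub> x \<oplus>\<^bsub>M\<^esub> x = \<zero>\<^bsub>M\<^esub>" .
  then show ?thesis using M.minus_equality assms by (simp add: smult_closed)
qed

lemma submodule_criterion:
  assumes "P \<subseteq> carrier M" "\<zero>\<^bsub>M\<^esub> \<in> P"
    and add: "\<And>x y. x \<in> P \<Longrightarrow> y \<in> P \<Longrightarrow> x \<oplus>\<^bsub>M\<^esub> y \<in> P"
    and smult: "\<And>a x. a \<in> carrier R \<Longrightarrow> x \<in> P \<Longrightarrow> a \<odot>\<^bsub>M\<^esub> x \<in> P"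
  shows "submodule P R M"
proof -
  have "\<ominus>\<^bsub>M\<^esub> x \<in> P" if "x \<in> P" for x
    using smult[OF _ that, of "\<ominus>\<^bsub>R\<^esub> \<one>\<^bsub>R\<^esub>"] smult_minus_one[of x] assms(1) that by auto
  then have "subgroup P (add_monoid M)"
    using assms by (intro subgroup.intro) (simp_all add: a_inv_def)
  then show ?thesis by (intro submodule.intro submodule_axioms.intro) (use smult in auto)
qed

end

lemma submoduleD:
  assumes "submodule N R M"
  shows "N \<subseteq> carrier M" "\<zero>\<^bsub>M\<^esub> \<in> N" "x \<in> N \<Longrightarrow> y \<in> N \<Longrightarrow> x \<oplus>\<^bsub>M\<^esub> y \<in> N"
    "a \<in> carrier R \<Longrightarrow> x \<in> N \<Longrightarrow> a \<odot>\<^bsub>M\<^esub> x \<in> N"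
proof -
  interpret submodule N R M by (rule assms)
  show "N \<subseteq> carrier M" "\<zero>\<^bsub>M\<^esub> \<in> N" "x \<in> N \<Longrightarrow> y \<in> N \<Longrightarrow> x \<oplus>\<^bsub>M\<^esub> y \<in> N"
    "a \<in> carrier R \<Longrightarrow> x \<in> N \<Longrightarrow> a \<odot>\<^bsub>M\<^esub> x \<in> N"
    using subset one_closed m_closed smult_closed by auto
qed

locale left_module_quotient = left_module R M for R (structure) and M :: "('b, 'c) module" (structure) +
  fixes N assumes N: "submodule N R M"
begin

abbreviation "Q \<equiv> quotient_module M N"

lemma N_subgroup: "subgroup N (add_monoid M)"
  using N by (rule submodule.axioms)

lemma N_abelian: "abelian_subgroup N M"
  using N_subgroup M.a_comm_group by (intro abelian_subgroupI2)

sublocale abelian_subgroup N M by (rule N_abelian)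

lemma carrier_Q: "carrier Q = {N +>\<^bsub>M\<^esub> x | x. x \<in> carrier M}"
  by (auto simp: quotient_module_def A_RCOSETS_def' a_r_coset_def)

lemma zero_Q: "\<zero>\<^bsub>Q\<^esub> = N"
  by (simp add: quotient_module_def)

lemma add_Q: "x \<in> carrier M \<Longrightarrow> y \<in> carrier M \<Longrightarrow> (N +>\<^bsub>M\<^esub> x) \<oplus>\<^bsub>Q\<^esub> (N +>\<^bsub>M\<^esub> y) = N +>\<^bsub>M\<^esub> (x \<oplus>\<^bsub>M\<^esub> y)"
  by (simp add: quotient_module_def a_rcos_sum)

lemma coset_eq_N: "x \<in> carrier M \<Longrightarrow> N +>\<^bsub>M\<^esub> x = N \<longleftrightarrow> x \<in> N"
  using M.a_coset_join2[OF _ N_subgroup] a_rcos_self by blast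

lemma smult_Q:
  assumes "a \<in> carrier R" "x \<in> carrier M"
  shows "a \<odot>\<^bsub>Q\<^esub> (N +>\<^bsub>M\<^esub> x) = N +>\<^bsub>M\<^esub> (a \<odot>\<^bsub>M\<^esub> x)"
proof -
  have "N +>\<^bsub>M\<^esub> (a \<odot>\<^bsub>M\<^esub> y) = N +>\<^bsub>M\<^esub> (a \<odot>\<^bsub>M\<^esub> x)" if y: "y \<in> N +>\<^bsub>M\<^esub> x" for y
  proof -
    obtain h where h: "h \<in> N" "y = h \<oplus>\<^bsub>M\<^esub> x" using y by (auto simp: a_r_coset_def')
    have hc: "h \<in> carrier M" using h(1) submoduleD(1)[OF N] by blast
    have "a \<odot>\<^bsub>M\<^esub> y = a \<odot>\<^bsub>M\<^esub> h \<oplus>\<^bsub>M\<^esub> a \<odot>\<^bsub>M\<^esub> x"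
      using h hc assms by (simp add: smult_r_distr)
    moreover have "a \<odot>\<^bsub>M\<^esub> h \<in> N" using submoduleD(4)[OF N assms(1) h(1)] .
    ultimately have "a \<odot>\<^bsub>M\<^esub> y \<in> N +>\<^bsub>M\<^esub> (a \<odot>\<^bsub>M\<^esub> x)" by (auto simp: a_r_coset_def')
    then show ?thesis
      using M.a_repr_independence[OF _ _ N_subgroup] assms smult_closed by metis
  qed
  moreover have "x \<in> N +>\<^bsub>M\<^esub> x" using a_rcos_self assms by blast
  ultimately have "(\<Union>y\<in>N +>\<^bsub>M\<^esub> x. N +>\<^bsub>M\<^esub> (a \<odot>\<^bsub>M\<^esub> y)) = N +>\<^bsub>M\<^esub> (a \<odot>\<^bsub>M\<^esub> x)"
    by blast
  then show ?thesis by (simp add: quotient_module_def)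
qed

lemma abelian_group_Q: "abelian_group Q"
proof (rule abelian_groupI)
  have N0: "N +>\<^bsub>M\<^esub> \<zero>\<^bsub>M\<^esub> = N" using coset_eq_N[of "\<zero>\<^bsub>M\<^esub>"] submoduleD(2)[OF N] by simp
  show "\<zero>\<^bsub>Q\<^esub> \<in> carrier Q" unfolding carrier_Q zero_Q using N0[symmetric] by blast
  fix x assume x: "x \<in> carrier Q"
  then obtain c where c: "c \<in> carrier M" "x = N +>\<^bsub>M\<^esub> c" by (auto simp: carrier_Q)
  show "\<zero>\<^bsub>Q\<^esub> \<oplus>\<^bsub>Q\<^esub> x = x"
    using add_Q[of "\<zero>\<^bsub>M\<^esub>" c] c N0 by (simp add: zero_Q)
  have "(N +>\<^bsub>M\<^esub> (\<ominus>\<^bsub>M\<^esub> c)) \<oplus>\<^bsub>Q\<^esub> x = \<zero>\<^bsub>Q\<^esub>"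
    using add_Q[of "\<ominus>\<^bsub>M\<^esub> c" c] c N0 by (simp add: zero_Q M.l_neg)
  then show "\<exists>y\<in>carrier Q. y \<oplus>\<^bsub>Q\<^esub> x = \<zero>\<^bsub>Q\<^esub>"
    using c by (intro bexI[of _ "N +>\<^bsub>M\<^esub> (\<ominus>\<^bsub>M\<^esub> c)"]) (auto simp: carrier_Q)
next
  fix x y assume "x \<in> carrier Q" "y \<in> carrier Q"
  then obtain c d where c: "c \<in> carrier M" "x = N +>\<^bsub>M\<^esub> c" "d \<in> carrier M" "y = N +>\<^bsub>M\<^esub> d"
    by (auto simp: carrier_Q)
  show "x \<oplus>\<^bsub>Q\<^esub> y \<in> carrier Q" using c add_Q by (auto simp: carrier_Q)
  show "x \<oplus>\<^bsub>Q\<^esub> y = y \<oplus>\<^bsub>Q\<^esub> x" using c add_Q M.a_comm by simp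
  fix z assume "z \<in> carrier Q"
  then obtain e where "e \<in> carrier M" "z = N +>\<^bsub>M\<^esub> e" by (auto simp: carrier_Q)
  then show "x \<oplus>\<^bsub>Q\<^esub> y \<oplus>\<^bsub>Q\<^esub> z = x \<oplus>\<^bsub>Q\<^esub> (y \<oplus>\<^bsub>Q\<^esub> z)"
    using c add_Q M.a_assoc by simp
qed

lemma left_module_Q: "left_module R Q"
proof -
  interpret Q: abelian_group Q by (rule abelian_group_Q)
  show ?thesis
  proof unfold_locales
    fix a x assume a: "a \<in> carrier R" and x: "x \<in> carrier Q"
    then show "a \<odot>\<^bsub>Q\<^esub> x \<in> carrier Q"
      by (auto simp: carrier_Q smult_Q) (use smult_closed in blast)
  next
    fix a b x assume ab: "a \<in> carrier R" "b \<in> carrier R" and x: "x \<in> carrier Q"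
    show "(a \<oplus>\<^bsub>R\<^esub> b) \<odot>\<^bsub>Q\<^esub> x = a \<odot>\<^bsub>Q\<^esub> x \<oplus>\<^bsub>Q\<^esub> b \<odot>\<^bsub>Q\<^esub> x"
      using x ab by (auto simp: carrier_Q smult_Q add_Q smult_closed smult_l_distr)
    show "(a \<otimes>\<^bsub>R\<^esub> b) \<odot>\<^bsub>Q\<^esub> x = a \<odot>\<^bsub>Q\<^esub> (b \<odot>\<^bsub>Q\<^esub> x)"
      using x ab by (auto simp: carrier_Q smult_Q smult_closed smult_assoc1)
  next
    fix a x y assume "a \<in> carrier R" "x \<in> carrier Q" "y \<in> carrier Q"
    then show "a \<odot>\<^bsub>Q\<^esub> (x \<oplus>\<^bsub>Q\<^esub> y) = a \<odot>\<^bsub>Q\<^esub> x \<oplus>\<^bsub>Q\<^esub> a \<odot>\<^bsub>Q\<^esub> y"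
      by (auto simp: carrier_Q smult_Q add_Q smult_closed smult_r_distr)
  next
    fix x assume "x \<in> carrier Q"
    then show "\<one>\<^bsub>R\<^esub> \<odot>\<^bsub>Q\<^esub> x = x" by (auto simp: carrier_Q smult_Q smult_one)
  qed
qed

text \<open>
  Submodules of the quotient are compared with their preimages.
\<close>

lemma irreducible_quotient:
  assumes "N \<noteq> carrier M"
    and max: "\<And>P. submodule P R M \<Longrightarrow> N \<subseteq> P \<Longrightarrow> P = N \<or> P = carrier M"
  shows "irreducible_module R Q"
  unfolding irreducible_module_def
proof (intro conjI allI impI)
  show "left_module R Q" by (rule left_module_Q)
  have "N \<subseteq> carrier M" using submoduleD(1)[OF N] .
  then obtain x where x: "x \<in> carrier M" "x \<notin> N" using assms(1) by blast
  then have "N +>\<^bsub>M\<^esub> x \<in> carrier Q" "N +>\<^bsub>M\<^esub> x \<noteq> N" unfolding carrier_Q using coset_eq_N by blast+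
  then show "carrier Q \<noteq> {\<zero>\<^bsub>Q\<^esub>}" unfolding zero_Q by blast
  fix P' assume P': "submodule P' R Q"
  define P where "P = {x \<in> carrier M. N +>\<^bsub>M\<^esub> x \<in> P'}"
  have "submodule P R M"
  proof (rule submodule_criterion)
    show "\<zero>\<^bsub>M\<^esub> \<in> P" using submoduleD(2)[OF P'] coset_eq_N[of "\<zero>\<^bsub>M\<^esub>"] submoduleD(2)[OF N]
      by (simp add: P_def zero_Q)
    show "x \<oplus>\<^bsub>M\<^esub> y \<in> P" if "x \<in> P" "y \<in> P" for x y
    proof -
      have xy: "x \<in> carrier M" "y \<in> carrier M" using that by (simp_all add: P_def)
      have "(N +>\<^bsub>M\<^esub> x) \<oplus>\<^bsub>Q\<^esub> (N +>\<^bsub>M\<^esub> y) \<in> P'"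
        using that by (intro submoduleD(3)[OF P']) (simp_all add: P_def)
      then show ?thesis using xy by (simp add: P_def add_Q)
    qed
    show "a \<odot>\<^bsub>M\<^esub> x \<in> P" if "a \<in> carrier R" "x \<in> P" for a x
    proof -
      have x: "x \<in> carrier M" using that by (simp add: P_def)
      have "a \<odot>\<^bsub>Q\<^esub> (N +>\<^bsub>M\<^esub> x) \<in> P'"
        using that by (intro submoduleD(4)[OF P']) (simp_all add: P_def)
      then show ?thesis using x that(1) by (simp add: P_def smult_Q smult_closed)
    qed
  qed (auto simp: P_def)
  moreover have "N \<subseteq> P"
  proof
    fix x assume "x \<in> N"
    then have "x \<in> carrier M" "N +>\<^bsub>M\<^esub> x = N" using coset_eq_N \<open>N \<subseteq> carrier M\<close> by blast+
    then show "x \<in> P" using submoduleD(2)[OF P'] by (simp add: P_def zero_Q)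
  qed
  ultimately consider "P = N" | "P = carrier M" using max by blast
  then show "P' = {\<zero>\<^bsub>Q\<^esub>} \<or> P' = carrier Q"
    unfolding zero_Q
  proof cases
    case 1
    have "C = N" if C: "C \<in> P'" for C
    proof -
      obtain x where x: "x \<in> carrier M" "C = N +>\<^bsub>M\<^esub> x"
        using C submoduleD(1)[OF P'] by (auto simp: carrier_Q)
      then have "x \<in> P" using C by (simp add: P_def)
      then show ?thesis using 1 x coset_eq_N by simp
    qed
    moreover have "N \<in> P'" using submoduleD(2)[OF P'] by (simp add: zero_Q)
    ultimately have "P' = {N}" by blast
    then show "P' = {N} \<or> P' = carrier Q" ..
  next
    case 2
    have "carrier Q \<subseteq> P'" using 2 by (auto simp: carrier_Q P_def)
    then have "P' = carrier Q" using submoduleD(1)[OF P'] by blast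
    then show "P' = {N} \<or> P' = carrier Q" ..
  qed
qed

end

text \<open>
  Two proper submodules have their sum inside \<open>P\<close>.  Asking only for closure under
  addition allows \<open>P\<close> to be the preimage of a submodule under a map that intertwines
  only some of the generators.
\<close>

lemma indecomposableI:
  assumes M: "left_module R M" and v: "v \<in> carrier M" "v \<notin> P" and z: "carrier M \<noteq> {\<zero>\<^bsub>M\<^esub>}"
    and add: "\<And>x y. x \<in> P \<Longrightarrow> y \<in> P \<Longrightarrow> x \<oplus>\<^bsub>M\<^esub> y \<in> P"
    and proper: "\<And>A. submodule A R M \<Longrightarrow> A = carrier M \<or> A \<subseteq> P"
  shows "indecomposable_module R M"
  unfolding indecomposable_module_def
proof (intro conjI)
  show "left_module R M" "carrier M \<noteq> {\<zero>\<^bsub>M\<^esub>}" by (rule M z)+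
  show "\<not> (\<exists>A B. submodule A R M \<and> submodule B R M \<and> A \<noteq> {\<zero>\<^bsub>M\<^esub>} \<and> B \<noteq> {\<zero>\<^bsub>M\<^esub>} \<and>
             A \<inter> B = {\<zero>\<^bsub>M\<^esub>} \<and> A <+>\<^bsub>M\<^esub> B = carrier M)"
  proof
    assume "\<exists>A B. submodule A R M \<and> submodule B R M \<and> A \<noteq> {\<zero>\<^bsub>M\<^esub>} \<and> B \<noteq> {\<zero>\<^bsub>M\<^esub>} \<and>
               A \<inter> B = {\<zero>\<^bsub>M\<^esub>} \<and> A <+>\<^bsub>M\<^esub> B = carrier M"
    then obtain A B where AB: "submodule A R M" "submodule B R M" "A \<noteq> {\<zero>\<^bsub>M\<^esub>}" "B \<noteq> {\<zero>\<^bsub>M\<^esub>}"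
      "A \<inter> B = {\<zero>\<^bsub>M\<^esub>}" "A <+>\<^bsub>M\<^esub> B = carrier M" by blast
    have "A \<subseteq> carrier M" "B \<subseteq> carrier M" using submoduleD(1) AB(1,2) by blast+
    then have "A \<noteq> carrier M" "B \<noteq> carrier M" using AB(3-5) by blast+
    then have "A \<subseteq> P" "B \<subseteq> P" using proper AB(1,2) by blast+
    moreover have "v \<in> A <+>\<^bsub>M\<^esub> B" using v AB(6) by simp
    then obtain a b where "a \<in> A" "b \<in> B" "v = a \<oplus>\<^bsub>M\<^esub> b" by (auto simp: set_add_def')
    ultimately show False using add v(2) by blast
  qed
qed

section \<open>The action of the Temperley-Lieb algebra\<close>

definition link_vectors :: "link_vector set" where
  "link_vectors = {x. Poly_Mapping.keys x \<subseteq> {u. infinite_link_state u}}"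

lemma word_action_Cons: "word_action \<delta> (Word (i # u)) x = act \<delta> i (word_action \<delta> (Word u) x)"
  by (simp add: act_def)

lemma word_action_plus: "word_action \<delta> (u + v) x = word_action \<delta> u (word_action \<delta> v x)"
  by (cases u; cases v) simp

lemma word_action_linear:
  "word_action \<delta> u x = linear_extension (\<lambda>w. word_action \<delta> u (Poly_Mapping.single w 1)) x"
proof (cases u)
  case (Word us)
  show ?thesis unfolding Word
  proof (induction us)
    case Nil
    then show ?case by (simp add: linear_extension_id)
  next
    case (Cons i us)
    then show ?case
      by (simp only: word_action_Cons act_def linear_extension_compose[symmetric])
  qed
qed

lemma free_action_eq:
  "free_action \<delta> a x = (\<Sum>u\<in>Poly_Mapping.keys a. scale (Poly_Mapping.lookup a u) (word_action \<delta> u x))"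
  by (simp add: free_action_def linear_extension_def)

lemma word_action_add: "word_action \<delta> u (x + y) = word_action \<delta> u x + word_action \<delta> u y"
  and word_action_scale: "word_action \<delta> u (scale c x) = scale c (word_action \<delta> u x)"
  and word_action_zero: "word_action \<delta> u 0 = 0"
  by (simp_all add: word_action_linear[of _ _ "x + y"] word_action_linear[of _ _ "scale c x"]
      word_action_linear[of _ _ 0] linear_extension_add linear_extension_scale
      word_action_linear[of _ _ x, symmetric] word_action_linear[of _ _ y, symmetric])

lemma word_action_sum: "word_action \<delta> u (sum f A) = (\<Sum>k\<in>A. word_action \<delta> u (f k))"
  by (induction A rule: infinite_finite_induct) (simp_all add: word_action_add word_action_zero)

lemma scale_sum: "scale c (sum f A) = (\<Sum>k\<in>A. scale c (f k))"
  by (induction A rule: infinite_finite_induct) (simp_all add: scale_add)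

lemma free_action_add_left: "free_action \<delta> (a + b) x = free_action \<delta> a x + free_action \<delta> b x"
  and free_action_scale_left: "free_action \<delta> (scale c a) x = scale c (free_action \<delta> a x)"
  and free_action_zero_left: "free_action \<delta> 0 x = 0"
  and free_action_single: "free_action \<delta> (Poly_Mapping.single u c) x = scale c (word_action \<delta> u x)"
  by (simp_all add: free_action_def linear_extension_add linear_extension_scale)

lemma free_action_sum_left: "free_action \<delta> (sum f A) x = (\<Sum>k\<in>A. free_action \<delta> (f k) x)"
  by (simp add: free_action_def linear_extension_sum)

lemma free_action_add: "free_action \<delta> a (x + y) = free_action \<delta> a x + free_action \<delta> a y"
  by (simp add: free_action_eq word_action_add scale_add sum.distrib)

lemma free_action_zero: "free_action \<delta> a 0 = 0"
  by (simp add: free_action_eq word_action_zero)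

lemma poly_mapping_sum_single:
  "x = (\<Sum>u\<in>Poly_Mapping.keys x. Poly_Mapping.single u (Poly_Mapping.lookup x u :: complex))"
  using linear_extension_id[of x] by (simp add: linear_extension_def)

lemma free_action_mult: "free_action \<delta> (a * b) x = free_action \<delta> a (free_action \<delta> b x)"
proof -
  have "a * b = (\<Sum>u\<in>Poly_Mapping.keys a. \<Sum>v\<in>Poly_Mapping.keys b.
      Poly_Mapping.single (u + v) (Poly_Mapping.lookup a u * Poly_Mapping.lookup b v))"
    by (subst (1) poly_mapping_sum_single[of a], subst (1) poly_mapping_sum_single[of b])
       (simp add: sum_product mult_single)
  then have "free_action \<delta> (a * b) x = (\<Sum>u\<in>Poly_Mapping.keys a. \<Sum>v\<in>Poly_Mapping.keys b.
      scale (Poly_Mapping.lookup a u * Poly_Mapping.lookup b v) (word_action \<delta> u (word_action \<delta> v x)))"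
    by (simp add: free_action_sum_left free_action_single word_action_plus)
  also have "\<dots> = free_action \<delta> a (free_action \<delta> b x)"
    by (simp add: free_action_eq word_action_sum word_action_scale scale_sum)
  finally show ?thesis .
qed

lemma free_action_letter [simp]: "free_action \<delta> (letter i) x = act \<delta> i x"
  by (simp add: letter_def free_action_single act_def)

lemma free_action_one: "free_action \<delta> 1 x = x"
proof -
  have "free_action \<delta> (Poly_Mapping.single 0 1) x = x"
    unfolding free_action_single by (simp add: zero_word_def)
  then show ?thesis by simp
qed

lemma free_action_minus_left: "free_action \<delta> (a - b) x = free_action \<delta> a x - free_action \<delta> b x"
  using free_action_add_left[of \<delta> "a - b" b x] by simp

lemma TL_stable_free_action:
  assumes "TL_stable \<delta> V" "x \<in> V"
  shows "free_action \<delta> a x \<in> V"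
proof -
  have word: "word_action \<delta> (Word u) x \<in> V" for u
    using assms by (induction u) (simp_all add: TL_stable_def act_def[symmetric])
  have "scale (Poly_Mapping.lookup a u) (word_action \<delta> u x) \<in> V" for u
    using assms(1) word by (cases u) (simp add: TL_stable_def)
  moreover have "0 \<in> V" "\<And>x y. x \<in> V \<Longrightarrow> y \<in> V \<Longrightarrow> x + y \<in> V"
    using assms(1) by (simp_all add: TL_stable_def)
  ultimately have "(\<Sum>u\<in>A. scale (Poly_Mapping.lookup a u) (word_action \<delta> u x)) \<in> V" for A
    by (induction A rule: infinite_finite_induct) simp_all
  then show ?thesis by (simp add: free_action_eq)
qed

lemma TL_stable_link_vectors: "TL_stable \<delta> link_vectors"
  unfolding TL_stable_def
proof (intro conjI ballI allI)
  show "x + y \<in> link_vectors" if "x \<in> link_vectors" "y \<in> link_vectors" for x y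
    using that keys_add[of x y] by (auto simp: link_vectors_def)
  show "scale c x \<in> link_vectors" if "x \<in> link_vectors" for c x
    using that keys_scale[of c x] by (auto simp: link_vectors_def)
  show "act \<delta> i x \<in> link_vectors" if "x \<in> link_vectors" for i x
    using that unfolding link_vectors_def mem_Collect_eq
    by (intro act_keys) (auto intro: infinite_link_state_join simp: infinite_link_state_iff[THEN iffD1])
qed (simp add: link_vectors_def)

lemma act_act: "act \<delta> i (act \<delta> j x) = linear_extension (\<lambda>u. act \<delta> i (act \<delta> j (Poly_Mapping.single u 1))) x"
  by (simp add: act_def linear_extension_compose[symmetric])

lemma act_extension: "act \<delta> i x = linear_extension (\<lambda>u. act \<delta> i (Poly_Mapping.single u 1)) x"
  by (simp add: act_def)

lemma link_vector_cong:
  assumes "\<And>u. involution u \<Longrightarrow> f u = g u" "x \<in> link_vectors"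
  shows "linear_extension f x = linear_extension g x"
  by (rule linear_extension_cong) (use assms in \<open>auto simp: link_vectors_def infinite_link_state_iff\<close>)

lemma act_square:
  assumes "x \<in> link_vectors"
  shows "act \<delta> i (act \<delta> i x) = scale \<delta> (act \<delta> i x)"
proof -
  have "act \<delta> i (act \<delta> i (Poly_Mapping.single u 1)) = scale \<delta> (act \<delta> i (Poly_Mapping.single u 1))"
    if u: "involution u" for u
  proof -
    let ?v = "link_join i (Suc i) u"
    have v: "involution ?v" using u by (simp add: involution_link_join)
    then have "link_join i (Suc i) ?v = ?v" by (rule link_join_joined) simp
    moreover have "join_coeff \<delta> i (Suc i) ?v = \<delta>" by (simp add: join_coeff_def)
    ultimately show ?thesis using u v by (simp add: act_single mult.commute)
  qed
  then have "linear_extension (\<lambda>u. act \<delta> i (act \<delta> i (Poly_Mapping.single u 1))) x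
      = linear_extension (\<lambda>u. scale \<delta> (act \<delta> i (Poly_Mapping.single u 1))) x"
    using assms by (rule link_vector_cong)
  also have "\<dots> = scale \<delta> (linear_extension (\<lambda>u. act \<delta> i (Poly_Mapping.single u 1)) x)"
    by (simp add: linear_extension_def scale_sum mult.commute)
  finally show ?thesis by (simp only: act_act[symmetric] act_extension[symmetric])
qed

lemma act_commute:
  assumes "x \<in> link_vectors" "Suc i < j \<or> Suc j < i"
  shows "act \<delta> i (act \<delta> j x) = act \<delta> j (act \<delta> i x)"
proof -
  have "act \<delta> i (act \<delta> j (Poly_Mapping.single u 1)) = act \<delta> j (act \<delta> i (Poly_Mapping.single u 1))"
    if u: "involution u" for u
  proof -
    have "joins_commute u i (Suc i) j (Suc j)"
      using u assms(2) by (intro joins_commute_far) auto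
    then show ?thesis
      using u unfolding joins_commute_def
      by (auto simp: act_single involution_link_join)
         (metis mult_eq_0_iff single_zero mult.commute)
  qed
  then have "linear_extension (\<lambda>u. act \<delta> i (act \<delta> j (Poly_Mapping.single u 1))) x
      = linear_extension (\<lambda>u. act \<delta> j (act \<delta> i (Poly_Mapping.single u 1))) x"
    using assms(1) by (rule link_vector_cong)
  then show ?thesis by (simp only: act_act[symmetric])
qed

lemma act_braid:
  assumes "x \<in> link_vectors" "j = Suc i \<or> i = Suc j"
  shows "act \<delta> i (act \<delta> j (act \<delta> i x)) = act \<delta> i x"
proof -
  have "act \<delta> i (act \<delta> j (act \<delta> i (Poly_Mapping.single u 1))) = act \<delta> i (Poly_Mapping.single u 1)"
    if u: "involution u" for u
  proof -
    let ?v = "link_join i (Suc i) u"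
    have v: "involution ?v" using u by (simp add: involution_link_join)
    let ?z = "link_join j (Suc j) ?v"
    have z: "involution ?z" using v by (simp add: involution_link_join)
    have "link_join i (Suc i) ?z = ?v \<and> join_coeff \<delta> j (Suc j) ?v = 1 \<and> join_coeff \<delta> i (Suc i) ?z = 1"
      using assms(2)
    proof
      assume j: "j = Suc i"
      show ?thesis unfolding j
        using link_join_back[OF v, of i "Suc i" "Suc (Suc i)"]
          join_coeff_overlap[OF v, of i "Suc i" "Suc (Suc i)"] by simp
    next
      assume i: "i = Suc j"
      have "link_join (Suc i) i (link_join i j ?v) = ?v" "join_coeff \<delta> i j ?v = 1"
        "join_coeff \<delta> (Suc i) i (link_join i j ?v) = 1"
        using link_join_back[OF v, of "Suc i" i j] join_coeff_overlap[OF v, of "Suc i" i j] i by simp_all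
      then show ?thesis unfolding i
        using v z link_join_commute[OF v, of "Suc j" j] join_coeff_commute[OF v, of \<delta> "Suc j" j]
          link_join_commute[OF z, of "Suc (Suc j)" "Suc j"] join_coeff_commute[OF z, of \<delta> "Suc (Suc j)" "Suc j"] i
        by simp
    qed
    then show ?thesis using u v z by (simp add: act_single)
  qed
  then have "linear_extension (\<lambda>u. act \<delta> i (act \<delta> j (act \<delta> i (Poly_Mapping.single u 1)))) x
      = linear_extension (\<lambda>u. act \<delta> i (Poly_Mapping.single u 1)) x"
    using assms(1) by (rule link_vector_cong)
  then show ?thesis by (simp add: act_def linear_extension_compose[symmetric])
qed

abbreviation "free_ring \<equiv> (ring_of_type_algebra :: free_algebra ring)"

lemma free_ring_simps [simp]:
  "carrier free_ring = UNIV" "a \<otimes>\<^bsub>free_ring\<^esub> b = a * b" "\<one>\<^bsub>free_ring\<^esub> = 1"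
  "\<zero>\<^bsub>free_ring\<^esub> = 0" "a \<oplus>\<^bsub>free_ring\<^esub> b = a + b"
  by (simp_all add: ring_of_type_algebra_def)

lemma ring_free_ring: "ring free_ring"
proof (rule ringI)
  show "abelian_group free_ring"
  proof (rule abelian_groupI)
    fix x assume "x \<in> carrier free_ring"
    show "\<exists>y\<in>carrier free_ring. y \<oplus>\<^bsub>free_ring\<^esub> x = \<zero>\<^bsub>free_ring\<^esub>" by (auto intro!: exI[of _ "- x"])
  qed (simp_all add: add.assoc add.commute)
  show "Group.monoid free_ring" by (rule monoidI) (simp_all add: mult.assoc)
qed (simp_all add: distrib_left distrib_right)

interpretation free_ring: ring free_ring by (rule ring_free_ring)

definition TL_ideal :: "complex \<Rightarrow> free_algebra set" where
  "TL_ideal \<delta> = Idl\<^bsub>free_ring\<^esub> (TL_relations \<delta>)"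

lemma ideal_TL_ideal: "ideal (TL_ideal \<delta>) free_ring"
  unfolding TL_ideal_def by (rule free_ring.genideal_ideal) simp

lemma TL_infinity_eq: "TL_infinity \<delta> = free_ring Quot TL_ideal \<delta>"
  by (simp add: TL_infinity_def TL_ideal_def)

lemma ring_TL_infinity: "ring (TL_infinity \<delta>)"
  unfolding TL_infinity_eq by (rule ideal.quotient_is_ring[OF ideal_TL_ideal])

text \<open>
  The annihilator of all link vectors is a two-sided ideal, and the three kinds of relations hold
  by \<open>act_square\<close>, \<open>act_braid\<close> and \<open>act_commute\<close>.
\<close>

lemma TL_ideal_annihilates:
  assumes "a \<in> TL_ideal \<delta>" "x \<in> link_vectors"
  shows "free_action \<delta> a x = 0"
proof -
  define K where "K = {a. \<forall>x\<in>link_vectors. free_action \<delta> a x = 0}"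
  have "ideal K free_ring"
  proof (rule idealI[OF ring_free_ring])
    have "(inv\<^bsub>add_monoid free_ring\<^esub> a) = - a" for a
    proof -
      have "\<ominus>\<^bsub>free_ring\<^esub> a = - a" by (rule free_ring.minus_equality) simp_all
      then show ?thesis by (simp add: a_inv_def)
    qed
    moreover have "free_action \<delta> (- a) x = - free_action \<delta> a x" for a x
      using free_action_minus_left[of \<delta> 0 a x] by (simp add: free_action_zero_left)
    ultimately show "subgroup K (add_monoid free_ring)"
      by (intro subgroup.intro) (auto simp: K_def free_action_add_left free_action_zero_left)
    show "x \<otimes>\<^bsub>free_ring\<^esub> a \<in> K" if "a \<in> K" for a x
      using that by (simp add: K_def free_action_mult free_action_zero)
    show "a \<otimes>\<^bsub>free_ring\<^esub> x \<in> K" if "a \<in> K" for a x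
      using that TL_stable_free_action[OF TL_stable_link_vectors] by (simp add: K_def free_action_mult)
  qed
  moreover have "TL_relations \<delta> \<subseteq> K"
    unfolding TL_relations_def
    by (auto simp: K_def free_action_minus_left free_action_mult free_action_scale_left
        act_square act_commute act_braid)
  ultimately have "TL_ideal \<delta> \<subseteq> K" unfolding TL_ideal_def by (rule free_ring.genideal_minimal)
  then show ?thesis using assms by (auto simp: K_def)
qed

abbreviation TL_class :: "complex \<Rightarrow> free_algebra \<Rightarrow> free_algebra set" where
  "TL_class \<delta> a \<equiv> TL_ideal \<delta> +>\<^bsub>free_ring\<^esub> a"

lemma carrier_TL_infinity: "carrier (TL_infinity \<delta>) = range (TL_class \<delta>)"
  by (auto simp: TL_infinity_eq FactRing_def A_RCOSETS_def' a_r_coset_def)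

lemma TL_infinity_ops:
  "TL_class \<delta> a \<oplus>\<^bsub>TL_infinity \<delta>\<^esub> TL_class \<delta> b = TL_class \<delta> (a + b)"
  "TL_class \<delta> a \<otimes>\<^bsub>TL_infinity \<delta>\<^esub> TL_class \<delta> b = TL_class \<delta> (a * b)"
  "\<one>\<^bsub>TL_infinity \<delta>\<^esub> = TL_class \<delta> 1"
proof -
  interpret ideal "TL_ideal \<delta>" free_ring by (rule ideal_TL_ideal)
  show "TL_class \<delta> a \<oplus>\<^bsub>TL_infinity \<delta>\<^esub> TL_class \<delta> b = TL_class \<delta> (a + b)"
    using a_rcos_sum[of a b] by (simp add: TL_infinity_eq FactRing_def)
  show "TL_class \<delta> a \<otimes>\<^bsub>TL_infinity \<delta>\<^esub> TL_class \<delta> b = TL_class \<delta> (a * b)"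
    using rcoset_mult_add[of a b] by (simp add: TL_infinity_eq FactRing_def)
  show "\<one>\<^bsub>TL_infinity \<delta>\<^esub> = TL_class \<delta> 1" by (simp add: TL_infinity_eq FactRing_def)
qed

text \<open>
  Two representatives of a class differ by an element of the ideal, which annihilates link vectors.
\<close>

lemma TL_action_class:
  assumes "x \<in> link_vectors"
  shows "TL_action \<delta> (TL_class \<delta> a) x = free_action \<delta> a x"
proof -
  interpret ideal "TL_ideal \<delta>" free_ring by (rule ideal_TL_ideal)
  have "a \<in> TL_class \<delta> a" using a_rcos_self by simp
  then have "(SOME b. b \<in> TL_class \<delta> a) \<in> TL_class \<delta> a" by (rule someI)
  then obtain h where "h \<in> TL_ideal \<delta>" "(SOME b. b \<in> TL_class \<delta> a) = h + a"
    by (auto simp: a_r_coset_def')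
  then show ?thesis
    using TL_ideal_annihilates assms by (simp add: TL_action_def free_action_add_left)
qed

definition link_submodule :: "complex \<Rightarrow> link_vector set \<Rightarrow> (free_algebra set, link_vector) module" where
  "link_submodule \<delta> V =
    \<lparr>carrier = V, monoid.mult = undefined, one = undefined, ring.zero = 0, add = (+), module.smult = TL_action \<delta>\<rparr>"

lemma link_submodule_simps [simp]:
  "carrier (link_submodule \<delta> V) = V" "\<zero>\<^bsub>link_submodule \<delta> V\<^esub> = 0"
  "x \<oplus>\<^bsub>link_submodule \<delta> V\<^esub> y = x + y" "A \<odot>\<^bsub>link_submodule \<delta> V\<^esub> x = TL_action \<delta> A x"
  by (simp_all add: link_submodule_def)

lemma link_module_eq: "link_module \<delta> = link_submodule \<delta> link_vectors"
  by (simp add: link_module_def link_submodule_def link_vectors_def)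

lemma left_module_link_submodule:
  assumes V: "TL_stable \<delta> V" "V \<subseteq> link_vectors"
  shows "left_module (TL_infinity \<delta>) (link_submodule \<delta> V)"
proof -
  interpret T: ring "TL_infinity \<delta>" by (rule ring_TL_infinity)
  have "abelian_group (link_submodule \<delta> V)"
  proof (rule abelian_groupI)
    fix x assume "x \<in> carrier (link_submodule \<delta> V)"
    then have "- x \<in> V" using V(1) by (metis TL_stable_def scale_minus_one link_submodule_simps(1))
    then show "\<exists>y\<in>carrier (link_submodule \<delta> V). y \<oplus>\<^bsub>link_submodule \<delta> V\<^esub> x = \<zero>\<^bsub>link_submodule \<delta> V\<^esub>"
      by (intro bexI[of _ "- x"]) simp_all
  qed (use V in \<open>auto simp: TL_stable_def add.assoc add.commute\<close>)
  then interpret M: abelian_group "link_submodule \<delta> V" .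
  have L: "x \<in> V \<Longrightarrow> x \<in> link_vectors" for x using V by blast
  have act: "x \<in> V \<Longrightarrow> free_action \<delta> a x \<in> V" for a x using TL_stable_free_action[OF V(1)] .
  have sum: "x \<in> V \<Longrightarrow> y \<in> V \<Longrightarrow> x + y \<in> V" for x y using V(1) by (simp add: TL_stable_def)
  show ?thesis
    by unfold_locales
       (auto simp: carrier_TL_infinity TL_infinity_ops TL_action_class L act sum
         free_action_add_left free_action_add free_action_mult free_action_one)
qed

lemma submodule_link_submodule_iff:
  assumes V: "TL_stable \<delta> V" "V \<subseteq> link_vectors"
  shows "submodule N (TL_infinity \<delta>) (link_submodule \<delta> V) \<longleftrightarrow> N \<subseteq> V \<and> TL_stable \<delta> N"
proof
  assume N: "submodule N (TL_infinity \<delta>) (link_submodule \<delta> V)"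
  note D = submoduleD[OF N, simplified]
  have cl: "free_action \<delta> a x \<in> N" if "x \<in> N" for a x
    using D(4)[of "TL_class \<delta> a" x] that D(1) V(2) by (auto simp: carrier_TL_infinity TL_action_class)
  have "scale c x \<in> N" if "x \<in> N" for c x
    using cl[OF that, of "scale c 1"] by (simp add: free_action_scale_left free_action_one)
  moreover have "act \<delta> i x \<in> N" if "x \<in> N" for i x
    using cl[OF that, of "letter i"] by simp
  ultimately show "N \<subseteq> V \<and> TL_stable \<delta> N" using D by (simp add: TL_stable_def)
next
  assume N: "N \<subseteq> V \<and> TL_stable \<delta> N"
  interpret left_module "TL_infinity \<delta>" "link_submodule \<delta> V"
    using V by (rule left_module_link_submodule)
  show "submodule N (TL_infinity \<delta>) (link_submodule \<delta> V)"
  proof (rule submodule_criterion)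
    show "A \<odot>\<^bsub>link_submodule \<delta> V\<^esub> x \<in> N" if "A \<in> carrier (TL_infinity \<delta>)" "x \<in> N" for A x
    proof -
      have "x \<in> link_vectors" using that N V by blast
      then show ?thesis
        using that TL_stable_free_action[of \<delta> N x] N by (auto simp: carrier_TL_infinity TL_action_class)
    qed
  qed (use N in \<open>auto simp: TL_stable_def\<close>)
qed

section \<open>Removing the first point\<close>

definition stringless :: "(nat \<Rightarrow> nat) set" where
  "stringless = {u. infinite_link_state u \<and> (\<forall>k. u k \<noteq> k)}"

text \<open>
  The first point is removed and the others are renumbered, so the former partner of the first
  point becomes a string, a fixed point of the involution.
\<close>

definition delete_first :: "(nat \<Rightarrow> nat) \<Rightarrow> nat \<Rightarrow> nat" where
  "delete_first u j = (if u (Suc j) = 0 then j else u (Suc j) - 1)"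

lemma delete_first_Suc: "u (Suc j) \<noteq> 0 \<Longrightarrow> Suc (delete_first u j) = u (Suc j)"
  by (simp add: delete_first_def)

lemma stringlessD:
  assumes "u \<in> stringless"
  shows "involution u" "nested u" "u k \<noteq> k" "u (u k) = k"
  using assms by (auto simp: stringless_def infinite_link_state_iff involution_def)

lemma delete_first_string:
  assumes "u \<in> stringless"
  shows "delete_first u k = k \<longleftrightarrow> u (Suc k) = 0"
  using stringlessD(3)[OF assms, of "Suc k"] by (auto simp: delete_first_def)

text \<open>
  The string created is not below a cup, since such a cup would have crossed the cup at the first
  point.
\<close>

lemma infinite_link_state_delete_first:
  assumes "u \<in> stringless"
  shows "infinite_link_state (delete_first u)"
proof -
  let ?d = "delete_first u"
  have "?d (?d j) = j" for j
  proof (cases "u (Suc j) = 0")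
    case True
    then show ?thesis by (simp add: delete_first_def)
  next
    case False
    then have "u (Suc (?d j)) = Suc j" using delete_first_Suc[of u j] False stringlessD(4)[OF assms] by simp
    then show ?thesis by (simp add: delete_first_def)
  qed
  moreover have "nested ?d"
    unfolding nested_def
  proof (intro allI impI)
    fix c x assume cx: "c < x \<and> x < ?d c"
    then have "u (Suc c) \<noteq> 0" by (intro notI) (auto simp: delete_first_def)
    then have c: "Suc (?d c) = u (Suc c)" by (rule delete_first_Suc)
    then have "Suc c < Suc x" "Suc x < u (Suc c)" using cx by auto
    then have x: "Suc c < u (Suc x)" "u (Suc x) < u (Suc c)" "u (Suc x) \<noteq> Suc x"
      using stringlessD(2)[OF assms] unfolding nested_def by blast+
    then have "Suc (?d x) = u (Suc x)" by (intro delete_first_Suc) simp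
    then show "?d x \<noteq> x \<and> c < ?d x \<and> ?d x < ?d c" using x c by auto
  qed
  ultimately show ?thesis by (simp add: infinite_link_state_iff involution_def)
qed

text \<open>
  The image has exactly one string, which shows where the first point was attached.
\<close>

lemma inj_on_delete_first: "inj_on delete_first stringless"
proof (rule inj_onI)
  fix u v assume u: "u \<in> stringless" and v: "v \<in> stringless" and eq: "delete_first u = delete_first v"
  have zero: "u (Suc j) = 0 \<longleftrightarrow> v (Suc j) = 0" for j
    using delete_first_string[OF u, of j] delete_first_string[OF v, of j] eq by simp
  have Suc: "u (Suc j) = v (Suc j)" for j
    using zero[of j] delete_first_Suc[of u j] delete_first_Suc[of v j] eq by (cases "u (Suc j) = 0") auto
  obtain j where j: "u 0 = Suc j" using stringlessD(3)[OF u, of 0] by (cases "u 0") auto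
  then have "u (Suc j) = 0" using stringlessD(4)[OF u, of 0] by simp
  then have "v 0 = Suc j" using zero[of j] stringlessD(4)[OF v, of "Suc j"] by simp
  then have "u k = v k" for k using Suc j by (cases k) auto
  then show "u = v" by blast
qed

text \<open>
  The coefficients agree as well: without strings in \<open>u\<close>, the image has only one
  string, so a generator never meets two.
\<close>

lemma delete_first_join:
  assumes "u \<in> stringless"
  shows "link_join i (Suc i) (delete_first u) = delete_first (link_join (Suc i) (Suc (Suc i)) u)"
    and "join_coeff \<delta> i (Suc i) (delete_first u) = join_coeff \<delta> (Suc i) (Suc (Suc i)) u"
proof -
  let ?d = "delete_first u" and ?v = "link_join (Suc i) (Suc (Suc i)) u"
  note ns = stringlessD(3)[OF assms]
  have inv: "involution u" "involution ?d"
    using assms infinite_link_state_delete_first[OF assms] by (auto simp: stringlessD infinite_link_state_iff)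
  have ne: "u (Suc i) \<noteq> u (Suc (Suc i))" using involution_eq_iff[OF inv(1)] by simp
  have di: "?d i = Suc i \<longleftrightarrow> u (Suc i) = Suc (Suc i)" by (auto simp: delete_first_def)
  show "join_coeff \<delta> i (Suc i) ?d = join_coeff \<delta> (Suc i) (Suc (Suc i)) u"
    using delete_first_string[OF assms] ns ne di by (auto simp: join_coeff_def)
  show "link_join i (Suc i) ?d = delete_first ?v"
  proof (cases "u (Suc i) = Suc (Suc i)")
    case True
    then show ?thesis using link_join_joined[OF inv(1) True] link_join_joined[OF inv(2), of i "Suc i"] di by simp
  next
    case False
    then have False': "?d i \<noteq> Suc i" using di by simp
    show ?thesis
    proof
      fix j
      consider "j = i" | "j = Suc i" | "j \<noteq> i" "j \<noteq> Suc i" by blast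
      then show "link_join i (Suc i) ?d j = delete_first ?v j"
      proof cases
        case 1 then show ?thesis by (simp add: delete_first_def)
      next
        case 2 then show ?thesis by (simp add: delete_first_def)
      next
        case 3
        have v: "?v (Suc j) = (if u (Suc j) = Suc i then u (Suc (Suc i))
            else if u (Suc j) = Suc (Suc i) then u (Suc i) else u (Suc j))"
          using 3 ns by (subst link_join_apply[OF inv(1) _ False]) auto
        have d: "link_join i (Suc i) ?d j = (if ?d j = i then (if ?d (Suc i) = Suc i then j else ?d (Suc i))
            else if ?d j = Suc i then (if ?d i = i then j else ?d i) else ?d j)"
          using 3 by (intro link_join_apply[OF inv(2) _ False']) auto
        have e: "?d j = i \<longleftrightarrow> u (Suc j) = Suc i" "?d j = Suc i \<longleftrightarrow> u (Suc j) = Suc (Suc i)"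
          using 3 by (auto simp: delete_first_def)
        show ?thesis
          unfolding d e delete_first_string[OF assms] delete_first_def[of ?v] v
          by (auto simp: delete_first_def)
      qed
    qed
  qed
qed

lemma family_stringless:
  assumes "w \<in> stringless" "u \<in> link_family m w"
  shows "u \<in> stringless"
proof -
  have "num_strings_below m w = 0"
    using stringlessD(3)[OF assms(1)] by (simp add: num_strings_below_def)
  then have "num_strings_below m u = 0" using assms(2) by (simp add: link_family_def)
  then have "\<forall>k<m. u k \<noteq> k" by (simp add: num_strings_below_def)
  then have "u k \<noteq> k" for k
    using family_tail[OF assms(2), of k] stringlessD(3)[OF assms(1), of k] by (cases "k < m") auto
  then show ?thesis using assms(2) by (simp add: stringless_def link_family_def)
qed

lemma delete_first_family:
  assumes w: "w \<in> stringless" and m: "closed_at (Suc m) w" and u: "u \<in> link_family (Suc m) w"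
  shows "delete_first u \<in> link_family m (delete_first w)"
proof -
  have us: "u \<in> stringless" using family_stringless[OF w u] .
  have below: "delete_first u j < m" if "j < m" for j
    using family_below[OF u, of "Suc j"] that by (auto simp: delete_first_def)
  have one: "num_strings_below m (delete_first v) = 1" if v: "v \<in> link_family (Suc m) w" for v
  proof -
    have vs: "v \<in> stringless" using family_stringless[OF w v] .
    obtain a where a: "v 0 = Suc a" using stringlessD(3)[OF vs, of 0] by (cases "v 0") auto
    have va: "v (Suc a) = 0" using stringlessD(4)[OF vs, of 0] a by simp
    have "v (Suc k) = 0 \<longleftrightarrow> k = a" for k
    proof
      assume "v (Suc k) = 0"
      then show "k = a" using stringlessD(4)[OF vs, of "Suc k"] a by simp
    qed (use va in simp)
    moreover have "a < m" using family_below[OF v, of 0] a by simp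
    ultimately have "{k \<in> {..<m}. delete_first v k = k} = {a}"
      using delete_first_string[OF vs] by auto
    then show ?thesis by (simp add: num_strings_below_def)
  qed
  have winf: "infinite_link_state w" using w by (simp add: stringless_def)
  have "delete_first u j = delete_first w j" if "m \<le> j" for j
    using family_tail[OF u, of "Suc j"] that by (simp add: delete_first_def)
  then show ?thesis
    using infinite_link_state_delete_first[OF us] below one[OF u] one[OF self_in_family[OF winf m]]
    by (simp add: link_family_def involution_on_def infinite_link_state_iff)
qed

definition delete_first_vector :: "link_vector \<Rightarrow> link_vector" where
  "delete_first_vector = linear_extension (\<lambda>u. Poly_Mapping.single (delete_first u) 1)"

lemma delete_first_vector_act:
  assumes "Poly_Mapping.keys x \<subseteq> stringless"
  shows "delete_first_vector (act \<delta> (Suc i) x) = act \<delta> i (delete_first_vector x)"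
proof -
  have "linear_extension (\<lambda>u. Poly_Mapping.single (delete_first u) 1) (generator_on_link \<delta> (Suc i) u)
      = linear_extension (generator_on_link \<delta> i) (Poly_Mapping.single (delete_first u) 1)"
    if u: "u \<in> stringless" for u
  proof -
    have "involution u" "involution (delete_first u)"
      using u infinite_link_state_delete_first[OF u] by (auto simp: stringlessD infinite_link_state_iff)
    then show ?thesis by (simp add: generator_on_link_eq delete_first_join[OF u])
  qed
  then show ?thesis
    unfolding delete_first_vector_def act_def linear_extension_compose
    using assms by (intro linear_extension_cong) blast
qed

lemma link_span_stringless:
  assumes "w \<in> stringless" "x \<in> link_span w"
  shows "Poly_Mapping.keys x \<subseteq> stringless"
  using assms family_stringless unfolding link_span_def by blast

lemma delete_first_vector_span:
  assumes "w \<in> stringless" "x \<in> link_span w"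
  shows "delete_first_vector x \<in> link_span (delete_first w)"
proof -
  have w: "infinite_link_state w" using assms(1) by (simp add: stringless_def)
  obtain m where m: "1 \<le> m" "closed_at m w" "Poly_Mapping.keys x \<subseteq> link_family m w"
    by (rule link_span_level[OF assms(2) w])
  \<comment> \<open>Length \<open>m\<close> for \<open>w\<close> is length \<open>m - 1\<close> after deletion, so \<open>m\<close> must be positive.\<close>
  then obtain k where k: "m = Suc k" by (cases m) auto
  have "Poly_Mapping.keys (delete_first_vector x) \<subseteq> link_family k (delete_first w)"
    unfolding delete_first_vector_def
    using delete_first_family[OF assms(1)] m k by (intro keys_linear_extension) auto
  moreover have "closed_at k (delete_first w)"
    using delete_first_family[OF assms(1) _ self_in_family[OF w]] m k
    by (auto simp: closed_at_def dest: family_below)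
  ultimately show ?thesis by (auto simp: link_span_def)
qed

lemma lookup_delete_first_vector:
  assumes "Poly_Mapping.keys x \<subseteq> stringless" "u \<in> stringless"
  shows "Poly_Mapping.lookup (delete_first_vector x) (delete_first u) = Poly_Mapping.lookup x u"
proof -
  have "Poly_Mapping.lookup (delete_first_vector x) (delete_first u)
      = pairing (\<lambda>v. Poly_Mapping.lookup (Poly_Mapping.single v 1) u) x"
    unfolding delete_first_vector_def lookup_linear_extension
  proof (rule pairing_cong)
    fix v assume "v \<in> Poly_Mapping.keys x"
    then have "delete_first v = delete_first u \<longleftrightarrow> v = u"
      using assms inj_on_delete_first by (auto simp: inj_on_def)
    then show "Poly_Mapping.lookup (Poly_Mapping.single (delete_first v) 1) (delete_first u)
      = Poly_Mapping.lookup (Poly_Mapping.single v (1::complex)) u"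
      by (simp add: lookup_single when_def)
  qed
  also have "\<dots> = Poly_Mapping.lookup x u"
    using linear_extension_id[of x] lookup_linear_extension by metis
  finally show ?thesis .
qed

lemma delete_first_vector_eq_single:
  assumes "w \<in> stringless" "Poly_Mapping.keys x \<subseteq> stringless"
    and "delete_first_vector x = Poly_Mapping.single (delete_first w) 1"
  shows "x = Poly_Mapping.single w 1"
proof (rule poly_mapping_eqI)
  fix u
  show "Poly_Mapping.lookup x u = Poly_Mapping.lookup (Poly_Mapping.single w 1) u"
  proof (cases "u \<in> stringless")
    case True
    then have "delete_first w = delete_first u \<longleftrightarrow> w = u"
      using assms(1) inj_on_delete_first by (auto simp: inj_on_def)
    then show ?thesis
      using lookup_delete_first_vector[OF assms(2) True] assms(3) by (simp add: lookup_single when_def)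
  next
    case False
    then have "u \<notin> Poly_Mapping.keys x" "w \<noteq> u" using assms by auto
    then show ?thesis by (simp add: in_keys_iff lookup_single)
  qed
qed

text \<open>
  The image of \<open>A\<close> under deletion is again stable under all generators, so it
  contains the image of \<open>w\<close> as soon as it has an element outside the radical;
  injectivity brings \<open>w\<close> back into \<open>A\<close>.
\<close>

lemma generates_stringless:
  assumes w: "w \<in> stringless" and A: "TL_stable \<delta> A" "A \<subseteq> link_span w"
    and x: "x \<in> A" "delete_first_vector x \<notin> family_radical \<delta> (delete_first w)"
  shows "Poly_Mapping.single w 1 \<in> A"
proof -
  let ?D = delete_first_vector
  have keys: "Poly_Mapping.keys y \<subseteq> stringless" if "y \<in> A" for y
    using link_span_stringless[OF w] A(2) that by blast
  \<comment> \<open>Stability of the image under the generator \<open>i\<close> comes from stability of \<open>A\<close> under \<open>Suc i\<close>.\<close>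
  have "TL_stable \<delta> (?D ` A)"
    unfolding TL_stable_def
  proof (intro conjI ballI allI)
    show "0 \<in> ?D ` A"
      using A(1) by (intro image_eqI[of _ _ 0]) (simp_all add: TL_stable_def delete_first_vector_def)
    show "y + z \<in> ?D ` A" if "y \<in> ?D ` A" "z \<in> ?D ` A" for y z
      using that A(1) by (auto simp: TL_stable_def delete_first_vector_def linear_extension_add[symmetric])
    show "scale c y \<in> ?D ` A" if "y \<in> ?D ` A" for c y
      using that A(1) by (auto simp: TL_stable_def delete_first_vector_def linear_extension_scale[symmetric])
    show "act \<delta> i y \<in> ?D ` A" if "y \<in> ?D ` A" for i y
      using that A(1) keys by (auto simp: TL_stable_def delete_first_vector_act[symmetric])
  qed
  then have "Poly_Mapping.single (delete_first w) 1 \<in> ?D ` A"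
    using x A(2) by (intro non_radical_generates[OF infinite_link_state_delete_first[OF w] _ x(2)])
      (auto intro: delete_first_vector_span[OF w])
  then obtain y where "y \<in> A" "?D y = Poly_Mapping.single (delete_first w) 1" by (metis imageE)
  then show ?thesis using delete_first_vector_eq_single[OF w keys] by metis
qed

section \<open>The representation generated by a link state\<close>

definition cyclic_span :: "complex \<Rightarrow> (nat \<Rightarrow> nat) \<Rightarrow> link_vector set" where
  "cyclic_span \<delta> w = generated_submodule (TL_infinity \<delta>) (link_module \<delta>) {Poly_Mapping.single w 1}"

lemma X_module_eq: "X_module \<delta> w = link_submodule \<delta> (cyclic_span \<delta> w)"
  by (simp add: X_module_def cyclic_span_def link_module_def link_submodule_def)

lemma link_span_vectors: "link_span w \<subseteq> link_vectors"
  by (auto simp: link_span_def link_vectors_def link_family_def)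

lemma TL_stable_Int: "TL_stable \<delta> V \<Longrightarrow> TL_stable \<delta> W \<Longrightarrow> TL_stable \<delta> (V \<inter> W)"
  by (simp add: TL_stable_def)

lemma TL_stable_Inter: "(\<And>V. V \<in> F \<Longrightarrow> TL_stable \<delta> V) \<Longrightarrow> TL_stable \<delta> (\<Inter>F)"
  by (auto simp: TL_stable_def)

lemma generated_submodule_eq:
  assumes "TL_stable \<delta> V" "V \<subseteq> link_vectors"
  shows "generated_submodule (TL_infinity \<delta>) (link_submodule \<delta> V) S = \<Inter>{N. N \<subseteq> V \<and> TL_stable \<delta> N \<and> S \<subseteq> N}"
  using submodule_link_submodule_iff[OF assms] by (simp add: generated_submodule_def conj_assoc)

lemma cyclic_span_eq:
  "cyclic_span \<delta> w = \<Inter>{N. N \<subseteq> link_vectors \<and> TL_stable \<delta> N \<and> {Poly_Mapping.single w 1} \<subseteq> N}"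
  unfolding cyclic_span_def link_module_eq by (rule generated_submodule_eq[OF TL_stable_link_vectors order_refl])

lemma cyclic_span:
  assumes "infinite_link_state w"
  shows "TL_stable \<delta> (cyclic_span \<delta> w)" "Poly_Mapping.single w 1 \<in> cyclic_span \<delta> w"
    "cyclic_span \<delta> w \<subseteq> link_span w"
  unfolding cyclic_span_eq
  using TL_stable_link_span[OF assms] link_span_vectors[of w] single_in_link_span[OF assms]
  by (blast intro: TL_stable_Inter)+

lemma cyclic_span_minimal:
  assumes "TL_stable \<delta> N" "N \<subseteq> link_vectors" "Poly_Mapping.single w 1 \<in> N"
  shows "cyclic_span \<delta> w \<subseteq> N"
  unfolding cyclic_span_eq using assms by blast

lemma X_radical_eq:
  assumes "infinite_link_state w"
  shows "X_radical \<delta> w = cyclic_span \<delta> w \<inter> family_radical \<delta> w"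
proof -
  have "(\<exists>n. \<forall>n'\<ge>n. \<exists>m p. restrict_vector n' x \<in> form_kernel \<delta> m p) \<longleftrightarrow> x \<in> family_radical \<delta> w"
    if "x \<in> cyclic_span \<delta> w" for x
  proof -
    have "x \<in> link_span w" using that cyclic_span(3)[OF assms] by blast
    then obtain m where "closed_at m w" "Poly_Mapping.keys x \<subseteq> link_family m w"
      unfolding link_span_def by blast
    then show ?thesis using restrict_radical_iff[OF assms] by blast
  qed
  then show ?thesis unfolding X_radical_def X_module_eq by auto
qed

lemma num_strings_eq_0: "num_strings w = 0 \<longleftrightarrow> (\<forall>k. w k \<noteq> k)"
proof (cases "finite {i. w i = i}")
  case False
  then have "{i. w i = i} \<noteq> {}" by (metis finite.emptyI)
  then show ?thesis using False by (auto simp: num_strings_def)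
qed (auto simp: num_strings_def zero_enat_def)

theorem proposition3p2:
  fixes q \<delta> :: complex and w :: "nat \<Rightarrow> nat"
  assumes "q \<noteq> 0"
    and "\<delta> = q + inverse q"
    and "infinite_link_state w"
  shows "cyclic_module (TL_infinity \<delta>) (X_module \<delta> w) \<and>
         indecomposable_module (TL_infinity \<delta>) (X_module \<delta> w) \<and>
         (\<not> (\<delta> = 0 \<and> num_strings w = 0) \<longrightarrow>
            irreducible_module (TL_infinity \<delta>) (quotient_module (X_module \<delta> w) (X_radical \<delta> w)))"
proof -
  note w = assms(3)
  let ?X = "cyclic_span \<delta> w" and ?w = "Poly_Mapping.single w 1 :: link_vector"
  note X = cyclic_span[OF w, of \<delta>]
  have XL: "?X \<subseteq> link_vectors" using X(3) link_span_vectors by blast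
  interpret left_module "TL_infinity \<delta>" "X_module \<delta> w"
    unfolding X_module_eq using X(1) XL by (rule left_module_link_submodule)
  have sub: "submodule N (TL_infinity \<delta>) (X_module \<delta> w) \<longleftrightarrow> N \<subseteq> ?X \<and> TL_stable \<delta> N" for N
    unfolding X_module_eq by (rule submodule_link_submodule_iff[OF X(1) XL])
  have whole: "N = ?X" if "N \<subseteq> ?X" "TL_stable \<delta> N" "?w \<in> N" for N
    using cyclic_span_minimal[OF that(2) _ that(3)] that(1) XL by blast
  have carrier: "carrier (X_module \<delta> w) = ?X" by (simp add: X_module_eq)
  have ops: "\<zero>\<^bsub>X_module \<delta> w\<^esub> = 0" "x \<oplus>\<^bsub>X_module \<delta> w\<^esub> y = x + y" for x y
    by (simp_all add: X_module_eq)
  have nonzero: "carrier (X_module \<delta> w) \<noteq> {\<zero>\<^bsub>X_module \<delta> w\<^esub>}"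
  proof -
    have "?w \<noteq> 0" by (metis keys_single keys_zero insert_not_empty one_neq_zero)
    then show ?thesis using X(2) carrier ops(1) by auto
  qed
  have lm: "left_module (TL_infinity \<delta>) (X_module \<delta> w)" by (rule left_module_axioms)
  have cyclic: "cyclic_module (TL_infinity \<delta>) (X_module \<delta> w)"
  proof -
    have "generated_submodule (TL_infinity \<delta>) (X_module \<delta> w) {?w} = ?X"
      unfolding generated_submodule_def sub using whole X(1,2) by blast
    then show ?thesis unfolding cyclic_module_def using lm X(2) carrier by blast
  qed
  have radical_proper: "N = ?X \<or> N \<subseteq> family_radical \<delta> w" if "N \<subseteq> ?X" "TL_stable \<delta> N" for N
    using non_radical_generates[OF w _ _ that(2)] whole[OF that] that(1) X(3) by blast
  have irreducible: "irreducible_module (TL_infinity \<delta>) (quotient_module (X_module \<delta> w) (X_radical \<delta> w))"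
    if notin: "?w \<notin> family_radical \<delta> w"
  proof -
    have "?X \<inter> (link_span w \<inter> family_radical \<delta> w) = X_radical \<delta> w"
      unfolding X_radical_eq[OF w] using X(3) by blast
    moreover have "TL_stable \<delta> (?X \<inter> (link_span w \<inter> family_radical \<delta> w))"
      using X(1) TL_stable_radical[OF w, of \<delta>] by (rule TL_stable_Int)
    ultimately have stable: "TL_stable \<delta> (X_radical \<delta> w)" by simp
    have radical_sub: "submodule (X_radical \<delta> w) (TL_infinity \<delta>) (X_module \<delta> w)"
      unfolding sub using stable X_radical_eq[OF w, of \<delta>] by simp
    interpret left_module_quotient "TL_infinity \<delta>" "X_module \<delta> w" "X_radical \<delta> w"
      by (intro left_module_quotient.intro left_module_quotient_axioms.intro lm radical_sub)
    show ?thesis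
    proof (rule irreducible_quotient)
      show "X_radical \<delta> w \<noteq> carrier (X_module \<delta> w)"
        unfolding carrier X_radical_eq[OF w] using notin X(2) by blast
      show "P = X_radical \<delta> w \<or> P = carrier (X_module \<delta> w)"
        if "submodule P (TL_infinity \<delta>) (X_module \<delta> w)" "X_radical \<delta> w \<subseteq> P" for P
      proof -
        have P: "P \<subseteq> ?X" "TL_stable \<delta> P" using that(1) unfolding sub by simp_all
        have "P = ?X \<or> P = X_radical \<delta> w"
          using radical_proper[OF P] P(1) that(2) unfolding X_radical_eq[OF w] by blast
        then show ?thesis unfolding carrier by blast
      qed
    qed
  qed
  show ?thesis
  proof (cases "\<delta> = 0 \<and> num_strings w = 0")
    case False
    then have "\<exists>s. \<delta> \<noteq> 0 \<or> w s = s" using num_strings_eq_0 by blast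
    then have notin: "?w \<notin> family_radical \<delta> w" using single_not_radical[OF w] by blast
    have "indecomposable_module (TL_infinity \<delta>) (X_module \<delta> w)"
    proof (rule indecomposableI[OF lm _ notin nonzero])
      show "A = carrier (X_module \<delta> w) \<or> A \<subseteq> family_radical \<delta> w"
        if "submodule A (TL_infinity \<delta>) (X_module \<delta> w)" for A
        using that radical_proper[of A] unfolding sub carrier by blast
    qed (use X(2) carrier ops family_radical_add in auto)
    with cyclic irreducible[OF notin] show ?thesis by (intro conjI impI)
  next
    case True
    then have ws: "w \<in> stringless" using w num_strings_eq_0 by (simp add: stringless_def)
    let ?P = "{x. delete_first_vector x \<in> family_radical \<delta> (delete_first w)}"
    obtain a where a: "w 0 = Suc a" using stringlessD(3)[OF ws, of 0] by (cases "w 0") auto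
    then have "delete_first w a = a"
      using stringlessD(4)[OF ws, of 0] by (simp add: delete_first_def)
    then have "Poly_Mapping.single (delete_first w) 1 \<notin> family_radical \<delta> (delete_first w)"
      using single_not_radical[OF infinite_link_state_delete_first[OF ws]] by blast
    then have notin: "?w \<notin> ?P" by (simp add: delete_first_vector_def)
    have "indecomposable_module (TL_infinity \<delta>) (X_module \<delta> w)"
    proof (rule indecomposableI[OF lm _ notin nonzero])
      show "A = carrier (X_module \<delta> w) \<or> A \<subseteq> ?P"
        if A: "submodule A (TL_infinity \<delta>) (X_module \<delta> w)" for A
      proof -
        have "A \<subseteq> ?X" "TL_stable \<delta> A" using A sub by blast+
        then show ?thesis
          using generates_stringless[OF ws, of \<delta> A] whole[of A] X(3) carrier by blast
      qed
      show "x \<oplus>\<^bsub>X_module \<delta> w\<^esub> y \<in> ?P" if "x \<in> ?P" "y \<in> ?P" for x y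
        using that family_radical_add by (simp add: ops delete_first_vector_def linear_extension_add)
    qed (use X(2) carrier in auto)
    moreover have "irreducible_module (TL_infinity \<delta>) (quotient_module (X_module \<delta> w) (X_radical \<delta> w))"
      if "\<not> (\<delta> = 0 \<and> num_strings w = 0)"
      using that True by contradiction
    ultimately show ?thesis using cyclic by (intro conjI impI)
  qed
qed

end
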